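(* Let $\Delta$ be a weakly vertex decomposable simplicial complex having at least one vertex. Then there exists a vertex $i$ of $\Delta$ such that the Alexander dual ideal $I_{\Delta}^*$ admits an $x_i$-splitting.
   Context: Let $\mathbb{k}$ be a field and $S=\mathbb{k}[x_1,\dots,x_n]$. An abstract simplicial complex $\Delta$ on $\{1,\dots,n\}$ is a collection of subsets of $\{1,\dots,n\}$ (faces) closed under taking subsets; facets are the maximal faces, $\mathcal{F}(\Delta)$ is the set of facets, and $\Delta$ is pure if all facets have the same cardinality. $\Delta$ is Cohen-Macaulay if its Stanley-Reisner ring over $\mathbb{k}$ is Cohen-Macaulay. For a vertex $v$ of $\Delta$, $$\mathrm{link}_{\Delta}(v)=\{F \in \Delta: v \notin F,\ F \cup \{v\} \in \Delta\},\qquad \mathrm{del}_{\Delta}(v)=\{F \in \Delta: v \notin F\},$$ both regarded as complexes on $\{1,\dots,n\}\setminus\{v\}$. $\Delta$ is a cone over $\mathrm{del}_\Delta(v)$ with apex $v$ if every facet of $\Delta$ contains $v$. Weakly vertex decomposable (WVD) complexes are defined recursively: $\{\emptyset\}$ is WVD, and a pure non-empty simplicial complex $\Delta$ is WVD if there is a vertex $v$ of $\Delta$ fulfilling exactly one of the following conditions: (i) $\mathrm{del}_{\Delta}(v)$ is WVD and $\Delta$ is a cone over $\mathrm{del}_{\Delta}(v)$ with apex $v$; (ii) $\mathrm{link}_{\Delta}(v)$ is WVD and $\mathrm{del}_{\Delta}(v)$ is Cohen-Macaulay of the same dimension as $\Delta$. The Alexander dual ideal of $\Delta$ is $I_{\Delta}^*=(x_{\overline{F}}: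 F \in \mathcal{F}(\Delta))\subseteq S$, where $\overline{F}=\{1,\dots,n\}\setminus F$ and $x_{\overline{F}}=\prod_{j\in\overline{F}}x_j$. For a monomial ideal $I\subseteq S$, $G(I)$ is its set of minimal monomial generators and $\beta_{r,j}(I)=\dim_{\mathbb{k}}\mathrm{Tor}_r(I,\mathbb{k})_j$ its graded Betti numbers (zero for $r<0$ and for the zero ideal). If $I=A+B$ with $A,B$ monomial ideals and $G(I)$ the disjoint union of $G(A)$ and $G(B)$, then $A+B$ is a Betti splitting of $I$ if $\beta_{r,j}(I)=\beta_{r,j}(A)+\beta_{r,j}(B)+\beta_{r-1,j}(A\cap B)$ for all $r,j\in\mathbb{N}$. For a variable $x_i$, let $M=\{m\in G(I): x_i \text{ divides } m\}$, $J=(m/x_i: m\in M)$ (so $J=0$ if $M=\emptyset$) and $K$ the ideal generated by $G(I)\setminus M$; the $x_i$-partition of $I$ is $I=x_iJ+K$, and $I$ admits an $x_i$-splitting if this decomposition is a Betti splitting of $I$. *)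

theory Defs
  imports
    "HOL-Algebra.Algebra"
    "HOL-Library.Poly_Mapping"
    "HOL-Library.Extended_Nat"
    "HOL-Library.Function_Algebras"
begin

section \<open>Simplicial complexes\<close>

definition simplicial_complex :: "nat set \<Rightarrow> nat set set \<Rightarrow> bool" where
  "simplicial_complex V \<Delta> \<longleftrightarrow> (\<forall>F\<in>\<Delta>. F \<subseteq> V) \<and> (\<forall>F\<in>\<Delta>. \<forall>G. G \<subseteq> F \<longrightarrow> G \<in> \<Delta>)"

text \<open>Not every element of the ground set has to be a vertex.\<close>

definition is_vertex :: "nat \<Rightarrow> nat set set \<Rightarrow> bool" where
  "is_vertex v \<Delta> \<longleftrightarrow> {v} \<in> \<Delta>"

definition facets :: "nat set set \<Rightarrow> nat set set" where
  "facets \<Delta> = {F \<in> \<Delta>. \<forall>G\<in>\<Delta>. F \<subseteq> G \<longrightarrow> G = F}"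

definition pure_complex :: "nat set set \<Rightarrow> bool" where
  "pure_complex \<Delta> \<longleftrightarrow> (\<forall>F\<in>facets \<Delta>. \<forall>G\<in>facets \<Delta>. card F = card G)"

text \<open>Only meaningful for non-empty complexes; the complex \<open>{{}}\<close> has dimension \<open>-1\<close>.\<close>

definition complex_dim :: "nat set set \<Rightarrow> int" where
  "complex_dim \<Delta> = Max ((\<lambda>F. int (card F) - 1) ` \<Delta>)"

definition link :: "nat set set \<Rightarrow> nat \<Rightarrow> nat set set" where
  "link \<Delta> v = {F \<in> \<Delta>. v \<notin> F \<and> F \<union> {v} \<in> \<Delta>}"

definition del :: "nat set set \<Rightarrow> nat \<Rightarrow> nat set set" where
  "del \<Delta> v = {F \<in> \<Delta>. v \<notin> F}"

definition is_cone :: "nat set set \<Rightarrow> nat \<Rightarrow> bool" where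
  "is_cone \<Delta> v \<longleftrightarrow> (\<forall>F\<in>facets \<Delta>. v \<in> F)"


section \<open>Cohen-Macaulay rings\<close>

text \<open>
  We use the definition of Eisenbud (Commutative Algebra, Section 18.2): a Noetherian
  commutative ring \<open>R\<close> is Cohen-Macaulay if \<open>depth(P) = codim(P)\<close> for every maximal ideal \<open>P\<close>,
  where \<open>depth(P)\<close> is the maximal length of an \<open>R\<close>-regular sequence in \<open>P\<close> and \<open>codim(P)\<close>
  is the height of \<open>P\<close>, i.e. the Krull dimension of the localization of \<open>R\<close> at \<open>P\<close>.
\<close>

definition regular_sequence :: "('a, 'b) ring_scheme \<Rightarrow> 'a list \<Rightarrow> bool" where
  "regular_sequence R xs \<longleftrightarrow>
     set xs \<subseteq> carrier R \<and>
     (\<forall>i < length xs. \<forall>a \<in> carrier R.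
        xs ! i \<otimes>\<^bsub>R\<^esub> a \<in> Idl\<^bsub>R\<^esub> (set (take i xs)) \<longrightarrow> a \<in> Idl\<^bsub>R\<^esub> (set (take i xs))) \<and>
     Idl\<^bsub>R\<^esub> (set xs) \<noteq> carrier R"

definition ideal_depth :: "('a, 'b) ring_scheme \<Rightarrow> 'a set \<Rightarrow> enat" where
  "ideal_depth R P = (SUP xs \<in> {xs. regular_sequence R xs \<and> set xs \<subseteq> P}. enat (length xs))"

definition prime_chain :: "('a, 'b) ring_scheme \<Rightarrow> 'a set list \<Rightarrow> bool" where
  "prime_chain R Ps \<longleftrightarrow> (\<forall>P\<in>set Ps. primeideal P R) \<and> sorted_wrt (\<subset>) Ps"

definition prime_height :: "('a, 'b) ring_scheme \<Rightarrow> 'a set \<Rightarrow> enat" where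
  "prime_height R P =
     (SUP Ps \<in> {Ps. prime_chain R Ps \<and> Ps \<noteq> [] \<and> last Ps = P}. enat (length Ps - 1))"

definition cohen_macaulay_ring :: "('a, 'b) ring_scheme \<Rightarrow> bool" where
  "cohen_macaulay_ring R \<longleftrightarrow>
     cring R \<and> noetherian_ring R \<and>
     (\<forall>P. maximalideal P R \<longrightarrow> ideal_depth R P = prime_height R P)"


section \<open>Polynomial rings and monomial ideals\<close>

text \<open>
  A polynomial is a finitely supported map from exponent vectors \<open>nat \<Rightarrow>\<^sub>0 nat\<close> to coefficients;
  its ring operations are those of the type class instance in
  \<^theory>\<open>HOL-Library.Poly_Mapping\<close>.  The polynomial ring in the variables indexed by \<open>V\<close> is a
  subring of this type, given as a ring record so that ideals and quotients are those of
  HOL-Algebra.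
\<close>

type_synonym 'k mpoly = "(nat \<Rightarrow>\<^sub>0 nat) \<Rightarrow>\<^sub>0 'k"

definition mpoly_ring :: "nat set \<Rightarrow> 'k::field mpoly ring" where
  "mpoly_ring V =
     \<lparr>carrier = {p. \<forall>u \<in> Poly_Mapping.keys p. Poly_Mapping.keys u \<subseteq> V},
      monoid.mult = (*), one = 1, ring.zero = 0, add = (+)\<rparr>"

lemma mpoly_ring_simps [simp]:
  "monoid.mult (mpoly_ring V) = (*)" "one (mpoly_ring V) = 1"
  "ring.zero (mpoly_ring V) = 0" "add (mpoly_ring V) = (+)"
  by (simp_all add: mpoly_ring_def)

lemma mem_carrier_mpoly_ring:
  "p \<in> carrier (mpoly_ring V) \<longleftrightarrow> (\<forall>u \<in> Poly_Mapping.keys p. Poly_Mapping.keys u \<subseteq> V)"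
  by (simp add: mpoly_ring_def)

lemma cring_mpoly_ring: "cring (mpoly_ring V :: 'k::field mpoly ring)"
proof -
  have add: "p + q \<in> carrier (mpoly_ring V)"
    if "p \<in> carrier (mpoly_ring V)" "q \<in> carrier (mpoly_ring V)" for p q :: "'k mpoly"
    using that Poly_Mapping.keys_add[of p q] unfolding mem_carrier_mpoly_ring by blast
  have mul: "p * q \<in> carrier (mpoly_ring V)"
    if pq: "p \<in> carrier (mpoly_ring V)" "q \<in> carrier (mpoly_ring V)" for p q :: "'k mpoly"
    unfolding mem_carrier_mpoly_ring
  proof
    fix u assume "u \<in> Poly_Mapping.keys (p * q)"
    then obtain a b where ab: "u = a + b" "a \<in> Poly_Mapping.keys p" "b \<in> Poly_Mapping.keys q"
      using Poly_Mapping.keys_mult[of p q] by blast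
    then show "Poly_Mapping.keys u \<subseteq> V"
      using pq Poly_Mapping.keys_add[of a b] unfolding mem_carrier_mpoly_ring by blast
  qed
  have neg: "- p \<in> carrier (mpoly_ring V)"
    if "p \<in> carrier (mpoly_ring V)" for p :: "'k mpoly"
    using that unfolding mem_carrier_mpoly_ring by simp
  have one: "(1 :: 'k mpoly) \<in> carrier (mpoly_ring V)"
    unfolding mem_carrier_mpoly_ring by simp
  have zero: "(0 :: 'k mpoly) \<in> carrier (mpoly_ring V)"
    unfolding mem_carrier_mpoly_ring by simp
  show ?thesis
  proof (rule cringI)
    show "abelian_group (mpoly_ring V :: 'k mpoly ring)"
    proof (rule abelian_groupI)
      fix p :: "'k mpoly" assume "p \<in> carrier (mpoly_ring V)"
      then show "\<exists>q\<in>carrier (mpoly_ring V). q \<oplus>\<^bsub>mpoly_ring V\<^esub> p = \<zero>\<^bsub>mpoly_ring V\<^esub>"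
        using neg by (intro bexI[of _ "- p"]) auto
    qed (use add zero in \<open>auto simp: algebra_simps\<close>)
    show "comm_monoid (mpoly_ring V :: 'k mpoly ring)"
      by (rule comm_monoidI) (use mul one in \<open>auto simp: algebra_simps\<close>)
  qed (simp add: algebra_simps)
qed

definition mvar :: "nat \<Rightarrow> 'k::field mpoly" where
  "mvar i = Poly_Mapping.single (Poly_Mapping.single i 1) 1"

definition sqfree_monomial :: "nat set \<Rightarrow> 'k::field mpoly" where
  "sqfree_monomial F = (\<Prod>j\<in>F. mvar j)"

definition is_monomial :: "'k::field mpoly \<Rightarrow> bool" where
  "is_monomial m \<longleftrightarrow> (\<exists>u. m = Poly_Mapping.single u 1)"

definition monomial_ideal :: "nat set \<Rightarrow> 'k::field mpoly set \<Rightarrow> bool" where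
  "monomial_ideal V I \<longleftrightarrow>
     (\<exists>M \<subseteq> carrier (mpoly_ring V). (\<forall>m\<in>M. is_monomial m) \<and> I = Idl\<^bsub>mpoly_ring V\<^esub> M)"

text \<open>
  The minimal monomial generators of a monomial ideal are its monomials that are minimal
  with respect to divisibility.
\<close>

definition min_gens :: "'k::field mpoly set \<Rightarrow> 'k mpoly set" where
  "min_gens I = {m \<in> I. is_monomial m \<and> (\<forall>m'\<in>I. is_monomial m' \<and> m' dvd m \<longrightarrow> m' = m)}"

definition stanley_reisner_ideal :: "nat set \<Rightarrow> nat set set \<Rightarrow> 'k::field mpoly set" where
  "stanley_reisner_ideal V \<Delta> =
     Idl\<^bsub>mpoly_ring V\<^esub> (sqfree_monomial ` {F. F \<subseteq> V \<and> F \<notin> \<Delta>})"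

definition stanley_reisner_ring :: "nat set \<Rightarrow> nat set set \<Rightarrow> 'k::field mpoly set ring" where
  "stanley_reisner_ring V \<Delta> = mpoly_ring V Quot stanley_reisner_ideal V \<Delta>"

definition cohen_macaulay_complex :: "'k::field itself \<Rightarrow> nat set \<Rightarrow> nat set set \<Rightarrow> bool" where
  "cohen_macaulay_complex k V \<Delta> \<longleftrightarrow>
     cohen_macaulay_ring (stanley_reisner_ring V \<Delta> :: 'k mpoly set ring)"

definition alexander_dual_ideal :: "nat set \<Rightarrow> nat set set \<Rightarrow> 'k::field mpoly set" where
  "alexander_dual_ideal V \<Delta> =
     Idl\<^bsub>mpoly_ring V\<^esub> ((\<lambda>F. sqfree_monomial (V - F)) ` facets \<Delta>)"


section \<open>Weakly vertex decomposable complexes\<close>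

text \<open>
  The disequation between the two bracketed formulas is the exclusive or of conditions
  (i) and (ii).  The conjuncts \<open>finite V\<close> and \<open>v \<in> V\<close> make the recursion terminate; they
  hold automatically for a vertex \<open>v\<close> of a complex on a finite ground set \<open>V\<close>.
\<close>

declare conj_cong [fundef_cong]

function weakly_vertex_decomposable ::
  "'k::field itself \<Rightarrow> nat set \<Rightarrow> nat set set \<Rightarrow> bool" where
  "weakly_vertex_decomposable k V \<Delta> \<longleftrightarrow>
     \<Delta> = {{}} \<or>
     (finite V \<and> simplicial_complex V \<Delta> \<and> \<Delta> \<noteq> {} \<and> pure_complex \<Delta> \<and>
      (\<exists>v\<in>V. is_vertex v \<Delta> \<and>
         (weakly_vertex_decomposable k (V - {v}) (del \<Delta> v) \<and> is_cone \<Delta> v)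
         \<noteq>
         (weakly_vertex_decomposable k (V - {v}) (link \<Delta> v) \<and>
          cohen_macaulay_complex k (V - {v}) (del \<Delta> v) \<and>
          complex_dim (del \<Delta> v) = complex_dim \<Delta>)))"
  by pat_completeness auto
termination
  by (relation "measure (\<lambda>(k, V, \<Delta>). card V)") (auto simp del: card_Diff_singleton card_Diff_insert intro: card_Diff1_less)

declare conj_cong [fundef_cong del]
declare weakly_vertex_decomposable.simps [simp del]


section \<open>Graded Betti numbers\<close>

text \<open>
  A polynomial is homogeneous of degree \<open>d\<close>; the zero polynomial is so for every \<open>d\<close>, and it
  is the only one if \<open>d\<close> is negative.
\<close>

definition homogeneous :: "int \<Rightarrow> 'k::field mpoly \<Rightarrow> bool" where
  "homogeneous d p \<longleftrightarrow>
     (\<forall>u \<in> Poly_Mapping.keys p. int (\<Sum>i\<in>Poly_Mapping.keys u. Poly_Mapping.lookup u i) = d)"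

text \<open>
  An augmented complex of finitely generated graded free modules
  \<open>\<dots> \<rightarrow> F\<^sub>2 \<rightarrow> F\<^sub>1 \<rightarrow> F\<^sub>0 \<rightarrow> S\<close> with homogeneous bases: \<open>F\<^sub>r\<close> has basis
  \<open>{0..<free_rank r}\<close>, the basis element \<open>b\<close> has degree \<open>shift r b\<close>
  (so \<open>F\<^sub>r\<close> is the direct sum of the \<open>S(- shift r b)\<close>), \<open>augm b\<close> is the image in \<open>S\<close>
  of the basis element \<open>b\<close> of \<open>F\<^sub>0\<close>, and \<open>diff r c b\<close> is the entry in row \<open>c\<close> and column \<open>b\<close> of
  the matrix of \<open>F\<^bsub>r+1\<^esub> \<rightarrow> F\<^sub>r\<close>.
\<close>

record (overloaded) 'k free_complex =
  free_rank :: "nat \<Rightarrow> nat"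
  shift :: "nat \<Rightarrow> nat \<Rightarrow> int"
  augm :: "nat \<Rightarrow> 'k mpoly"
  diff :: "nat \<Rightarrow> nat \<Rightarrow> nat \<Rightarrow> 'k mpoly"

definition free_module :: "nat set \<Rightarrow> nat \<Rightarrow> (nat \<Rightarrow> 'k::field mpoly) set" where
  "free_module V m = {a. (\<forall>b<m. a b \<in> carrier (mpoly_ring V)) \<and> (\<forall>b\<ge>m. a b = 0)}"

definition mat_apply ::
  "nat \<Rightarrow> nat \<Rightarrow> (nat \<Rightarrow> nat \<Rightarrow> 'a::comm_ring_1) \<Rightarrow> (nat \<Rightarrow> 'a) \<Rightarrow> nat \<Rightarrow> 'a" where
  "mat_apply m n A a = (\<lambda>c. if c < m then \<Sum>b<n. A c b * a b else 0)"

definition augm_map :: "'k::field free_complex \<Rightarrow> (nat \<Rightarrow> 'k mpoly) \<Rightarrow> 'k mpoly" where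
  "augm_map F a = (\<Sum>b<free_rank F 0. augm F b * a b)"

definition diff_map ::
  "'k::field free_complex \<Rightarrow> nat \<Rightarrow> (nat \<Rightarrow> 'k mpoly) \<Rightarrow> nat \<Rightarrow> 'k mpoly" where
  "diff_map F r = mat_apply (free_rank F r) (free_rank F (Suc r)) (diff F r)"

definition graded_free_resolution ::
  "nat set \<Rightarrow> 'k::field mpoly set \<Rightarrow> 'k free_complex \<Rightarrow> bool" where
  "graded_free_resolution V I F \<longleftrightarrow>
     (\<forall>b<free_rank F 0.
        augm F b \<in> carrier (mpoly_ring V) \<and> homogeneous (shift F 0 b) (augm F b)) \<and>
     (\<forall>r. \<forall>c<free_rank F r. \<forall>b<free_rank F (Suc r).
        diff F r c b \<in> carrier (mpoly_ring V) \<and>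
        homogeneous (shift F (Suc r) b - shift F r c) (diff F r c b)) \<and>
     augm_map F ` free_module V (free_rank F 0) = I \<and>
     {a \<in> free_module V (free_rank F 0). augm_map F a = 0}
       = diff_map F 0 ` free_module V (free_rank F 1) \<and>
     (\<forall>r. {a \<in> free_module V (free_rank F (Suc r)). diff_map F r a = 0}
       = diff_map F (Suc r) ` free_module V (free_rank F (Suc (Suc r))))"

text \<open>
  The tensor product of \<open>F\<close> with the residue field \<open>S/(x\<^sub>i)\<^sub>i\<close>: the component in degree \<open>j\<close> of its
  \<open>r\<close>-th module is the space of vectors supported on the basis elements of degree \<open>j\<close>, and
  the entries of the differentials are replaced by their constant terms.
\<close>

definition tor_chains :: "'k::field free_complex \<Rightarrow> nat \<Rightarrow> int \<Rightarrow> (nat \<Rightarrow> 'k) set" where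
  "tor_chains F r j = {v. \<forall>b. v b \<noteq> 0 \<longrightarrow> b < free_rank F r \<and> shift F r b = j}"

definition tor_diff :: "'k::field free_complex \<Rightarrow> nat \<Rightarrow> (nat \<Rightarrow> 'k) \<Rightarrow> nat \<Rightarrow> 'k" where
  "tor_diff F r = mat_apply (free_rank F r) (free_rank F (Suc r))
                    (\<lambda>c b. Poly_Mapping.lookup (diff F r c b) 0)"

definition tor_cycles :: "'k::field free_complex \<Rightarrow> nat \<Rightarrow> int \<Rightarrow> (nat \<Rightarrow> 'k) set" where
  "tor_cycles F r j =
     {v \<in> tor_chains F r j. case r of 0 \<Rightarrow> True | Suc s \<Rightarrow> tor_diff F s v = 0}"

definition tor_boundaries :: "'k::field free_complex \<Rightarrow> nat \<Rightarrow> int \<Rightarrow> (nat \<Rightarrow> 'k) set" where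
  "tor_boundaries F r j = tor_diff F r ` tor_chains F (Suc r) j"

definition fun_scale :: "'k::field \<Rightarrow> (nat \<Rightarrow> 'k) \<Rightarrow> nat \<Rightarrow> 'k" where
  "fun_scale c v = (\<lambda>b. c * v b)"

lemma vector_space_fun_scale: "vector_space (fun_scale :: 'k::field \<Rightarrow> _)"
  by unfold_locales (auto simp: fun_scale_def fun_eq_iff algebra_simps)

text \<open>
  The boundaries form a subspace of the finite-dimensional space of cycles when \<open>F\<close> is a
  complex, so the truncated subtraction gives the dimension of the homology.
\<close>

definition tor_dim :: "'k::field free_complex \<Rightarrow> nat \<Rightarrow> int \<Rightarrow> nat" where
  "tor_dim F r j =
     vector_space.dim fun_scale (tor_cycles F r j) - vector_space.dim fun_scale (tor_boundaries F r j)"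

text \<open>
  Here \<open>Tor\<^sub>r(I, k)\<close> is computed from a chosen graded free resolution of \<open>I\<close>; as usual, the
  choice does not matter.
\<close>

definition graded_betti :: "nat set \<Rightarrow> int \<Rightarrow> int \<Rightarrow> 'k::field mpoly set \<Rightarrow> nat" where
  "graded_betti V r j I =
     (if r < 0 then 0 else tor_dim (SOME F. graded_free_resolution V I F) (nat r) j)"


section \<open>Betti splittings\<close>

definition betti_splitting ::
  "nat set \<Rightarrow> 'k::field mpoly set \<Rightarrow> 'k mpoly set \<Rightarrow> 'k mpoly set \<Rightarrow> bool" where
  "betti_splitting V I A B \<longleftrightarrow>
     monomial_ideal V I \<and> monomial_ideal V A \<and> monomial_ideal V B \<and>
     I = A <+>\<^bsub>mpoly_ring V\<^esub> B \<and>
     min_gens I = min_gens A \<union> min_gens B \<and> min_gens A \<inter> min_gens B = {} \<and>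
     (\<forall>r j :: nat.
        graded_betti V (int r) (int j) I =
          graded_betti V (int r) (int j) A + graded_betti V (int r) (int j) B +
          graded_betti V (int r - 1) (int j) (A \<inter> B))"

definition divisible_gens :: "nat \<Rightarrow> 'k::field mpoly set \<Rightarrow> 'k mpoly set" where
  "divisible_gens i I = {m \<in> min_gens I. mvar i dvd m}"

definition partition_J :: "nat set \<Rightarrow> nat \<Rightarrow> 'k::field mpoly set \<Rightarrow> 'k mpoly set" where
  "partition_J V i I = Idl\<^bsub>mpoly_ring V\<^esub> {q. mvar i * q \<in> divisible_gens i I}"

definition partition_K :: "nat set \<Rightarrow> nat \<Rightarrow> 'k::field mpoly set \<Rightarrow> 'k mpoly set" where
  "partition_K V i I = Idl\<^bsub>mpoly_ring V\<^esub> (min_gens I - divisible_gens i I)"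

definition admits_splitting :: "nat set \<Rightarrow> nat \<Rightarrow> 'k::field mpoly set \<Rightarrow> bool" where
  "admits_splitting V i I \<longleftrightarrow>
     betti_splitting V I ((\<lambda>p. mvar i * p) ` partition_J V i I) (partition_K V i I)"

end

theory Submission
  imports Defs
begin

text \<open>
  Let \<open>v\<close> be the vertex given by weak vertex decomposability, and let \<open>A = x\<^sub>v J\<close> and \<open>K\<close> be the two
  parts of the dual ideal.  By purity all its generators have the same degree \<open>e\<close>.  Either every
  facet contains \<open>v\<close> and \<open>A = 0\<close>, or \<open>A\<close> is the dual ideal of the Cohen-Macaulay deletion; in both
  cases \<open>A\<close> has a linear resolution.  Then \<open>Tor(A \<inter> K) \<rightarrow> Tor(A) \<oplus> Tor(K)\<close> vanishes, for degree
  reasons in the first component and because \<open>A \<inter> K\<close> lies in \<open>x\<^sub>v K\<close> in the second, so that the long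
  exact sequence splits.

  Graded Betti numbers are computed as Koszul homology, by dimension shifting along the syzygies of
  a resolution.  For the linearity of \<open>A\<close>, a regular sequence of length \<open>d\<close> in the irrelevant maximal
  ideal kills the Koszul homology of the Stanley-Reisner ring above degree \<open>n - d\<close>; in squarefree
  multidegrees this is the vanishing of cohomology of restrictions of the complex, which passes
  to the homology of links, that is to the squarefree Koszul homology of \<open>A\<close>.
\<close>

section \<open>Exponents, monomials and homogeneous components\<close>

text \<open>The resolution behind \<open>graded_betti\<close> is an arbitrary chosen one, neither
  explicit nor minimal. Koszul homology depends on the ideal alone, so the long exact sequence
  becomes a manipulation of chains with coefficients in that ideal. The passage from the
  Cohen-Macaulay property to linearity is one direction of the Eagon-Reiner theorem. Its two halves
  do not fit together directly: Hochster's formula speaks of restrictions of the complex, while the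
  Koszul complex of the dual ideal speaks of links. They are joined by an induction over the
  vertices of the face whose link is taken. It works because the bound in
  \<open>acyclic_at_link\<close> survives adding a vertex to the restriction and raising the degree
  by one. A further obstacle is that \<open>A\<close> is built from those facets of the whole
  complex that avoid \<open>v\<close>, whereas the hypothesis concerns the deletion. All facets of
  the deletion have to be facets of the complex, so the deletion must be shown pure; this comes from
  the vanishing for links in degree 0.\<close>

type_synonym expo = "nat \<Rightarrow>\<^sub>0 nat"

abbreviation lk :: "('a \<Rightarrow>\<^sub>0 'b::zero) \<Rightarrow> 'a \<Rightarrow> 'b" where "lk \<equiv> Poly_Mapping.lookup"
abbreviation ks :: "('a \<Rightarrow>\<^sub>0 'b::zero) \<Rightarrow> 'a set" where "ks \<equiv> Poly_Mapping.keys"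
abbreviation sing :: "'a \<Rightarrow> 'b \<Rightarrow> 'a \<Rightarrow>\<^sub>0 'b::zero" where "sing \<equiv> Poly_Mapping.single"

definition adds :: "expo \<Rightarrow> expo \<Rightarrow> bool" (infix "adds" 50) where
  "u adds w \<longleftrightarrow> (\<forall>i. lk u i \<le> lk w i)"

definition tdeg :: "expo \<Rightarrow> nat" where
  "tdeg u = (\<Sum>i\<in>ks u. lk u i)"

text \<open>Exponent vector of the squarefree monomial with support \<sigma>, for finite
  \<sigma>.\<close>

definition chi :: "nat set \<Rightarrow> expo" where
  "chi \<sigma> = (\<Sum>j\<in>\<sigma>. sing j 1)"

lemma lookup_chi: "finite \<sigma> \<Longrightarrow> lk (chi \<sigma>) i = (if i \<in> \<sigma> then 1 else 0)"
  by (simp add: chi_def lookup_sum lookup_single when_def)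

lemma keys_chi: "finite \<sigma> \<Longrightarrow> ks (chi \<sigma>) = \<sigma>"
  by (rule Set.set_eqI) (simp only: in_keys_iff lookup_chi split: if_split, simp)

lemma chi_insert: "finite \<sigma> \<Longrightarrow> j \<notin> \<sigma> \<Longrightarrow> chi (insert j \<sigma>) = sing j 1 + chi \<sigma>"
  by (simp add: chi_def)

lemma tdeg_sum: "finite A \<Longrightarrow> ks u \<subseteq> A \<Longrightarrow> tdeg u = (\<Sum>i\<in>A. lk u i)"
  unfolding tdeg_def by (rule sum.mono_neutral_left) (auto simp: in_keys_iff)

lemma tdeg_add [simp]: "tdeg (u + w) = tdeg u + tdeg w"
proof -
  have "ks (u + w) \<subseteq> ks u \<union> ks w" by (rule Poly_Mapping.keys_add)
  then show ?thesis
    by (simp add: tdeg_sum[of "ks u \<union> ks w"] lookup_add sum.distrib)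
qed

lemma tdeg_zero [simp]: "tdeg 0 = 0" by (simp add: tdeg_def)

lemma tdeg_single [simp]: "tdeg (sing j n) = n" by (simp add: tdeg_def)

lemma tdeg_chi: "finite \<sigma> \<Longrightarrow> tdeg (chi \<sigma>) = card \<sigma>"
  by (simp add: tdeg_def keys_chi lookup_chi)

lemma tdeg_eq_0_iff [simp]: "tdeg u = 0 \<longleftrightarrow> u = 0"
  by (auto simp: tdeg_def in_keys_iff intro: poly_mapping_eqI)

lemma adds_refl [simp]: "u adds u" and zero_adds [simp]: "0 adds u"
  by (auto simp: adds_def)

lemma adds_trans: "u adds v \<Longrightarrow> v adds w \<Longrightarrow> u adds w"
  by (auto simp: adds_def intro: order_trans)

lemma adds_antisym: "u adds v \<Longrightarrow> v adds u \<Longrightarrow> u = v"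
  by (auto simp: adds_def intro!: poly_mapping_eqI antisym)

lemma adds_add_left [simp]: "u adds u + w" and adds_add_right [simp]: "u adds w + u"
  by (auto simp: adds_def lookup_add)

lemma adds_minus: "u adds w \<Longrightarrow> u + (w - u) = w" and adds_minus': "u adds w \<Longrightarrow> (w - u) + u = w"
  by (auto simp: adds_def lookup_add lookup_minus intro!: poly_mapping_eqI)

lemma adds_iff_add: "u adds w \<longleftrightarrow> (\<exists>t. w = u + t)"
  using adds_minus[of u w] by (metis adds_add_left)

lemma adds_tdeg: "u adds w \<Longrightarrow> tdeg u \<le> tdeg w"
  by (metis adds_iff_add tdeg_add le_add1)

lemma adds_tdeg_eq: "u adds w \<Longrightarrow> tdeg u = tdeg w \<Longrightarrow> u = w"
  by (metis adds_iff_add tdeg_add add_cancel_left_right tdeg_eq_0_iff add_0_right)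

lemma adds_keys: "u adds w \<Longrightarrow> ks u \<subseteq> ks w"
  by (auto simp: adds_def in_keys_iff) (metis less_le_trans)

lemma keys_add_expo: "ks (u + w :: expo) = ks u \<union> ks w"
  by (auto simp: in_keys_iff lookup_add)

lemma keys_minus_subset: "ks (u - w :: expo) \<subseteq> ks u"
  by (auto simp: in_keys_iff lookup_minus)

lemma chi_adds_iff: "finite \<sigma> \<Longrightarrow> chi \<sigma> adds u \<longleftrightarrow> \<sigma> \<subseteq> ks u"
  by (auto simp: adds_def lookup_chi in_keys_iff subset_iff Suc_le_eq)

lemma single_adds_iff: "sing j 1 adds u \<longleftrightarrow> j \<in> ks u"
  using chi_adds_iff[of "{j}" u] by (simp add: chi_def)

lemma chi_Diff: "finite \<sigma> \<Longrightarrow> \<tau> \<subseteq> \<sigma> \<Longrightarrow> chi \<sigma> - chi \<tau> = chi (\<sigma> - \<tau>)"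
  by (rule poly_mapping_eqI) (auto simp: lookup_minus lookup_chi finite_subset)

lemma lookup_mono_times:
  fixes p :: "'k::field mpoly"
  shows "lk (sing w c * p) u = (if w adds u then c * lk p (u - w) else 0)"
proof -
  \<comment> \<open>Subtraction of exponents is truncated, so \<open>q = u - w\<close> is meaningful
    only together with divisibility.\<close>
  have eq: "u = w + q \<longleftrightarrow> w adds u \<and> q = u - w" for q
    by (metis adds_add_left adds_minus add_diff_cancel_left')
  have "lk (sing w c * p) u = c * (Sum_any (\<lambda>q. lk p q when u = w + q))"
    by (simp add: lookup_mult lookup_single when_mult Sum_any_when_equal)
  also have "Sum_any (\<lambda>q. lk p q when u = w + q) = (if w adds u then lk p (u - w) else 0)"
    unfolding eq by (auto simp: when_def[abs_def] Sum_any_when_equal[unfolded when_def])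
  finally show ?thesis by simp
qed

lemma poly_eq_sum_single: "p = (\<Sum>u\<in>ks p. sing u (lk p u))"
  by (rule poly_mapping_eqI) (auto simp: lookup_sum lookup_single when_def in_keys_iff)

lemma lookup_const_times [simp]: "lk (sing 0 c * p) u = c * lk (p::'k::field mpoly) u"
  by (simp add: lookup_mono_times)

lemma lookup_mvar_times:
  "lk (mvar j * p) u = (if j \<in> ks u then lk (p::'k::field mpoly) (u - sing j 1) else 0)"
  by (simp add: mvar_def lookup_mono_times single_adds_iff del: One_nat_def)

lemma sqfree_monomial_eq: "finite F \<Longrightarrow> (sqfree_monomial F :: 'k::field mpoly) = sing (chi F) 1"
  unfolding sqfree_monomial_def chi_def mvar_def
  by (induction F rule: finite_induct) (auto simp: mult_single)

lemma keys_times_subset: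
  fixes p q :: "'k::field mpoly"
  shows "u \<in> ks (p * q) \<Longrightarrow> \<exists>a\<in>ks p. \<exists>b\<in>ks q. u = a + b"
  using keys_mult[of p q] by blast

lemma homogeneous_iff: "homogeneous d p \<longleftrightarrow> (\<forall>u\<in>ks p. int (tdeg u) = d)"
  by (simp add: homogeneous_def tdeg_def)

lemma homogeneous_zero [simp]: "homogeneous d 0" by (simp add: homogeneous_def)

lemma homogeneous_add: "homogeneous d p \<Longrightarrow> homogeneous d q \<Longrightarrow> homogeneous d (p + q)"
  unfolding homogeneous_iff using Poly_Mapping.keys_add[of p q] by blast

lemma homogeneous_uminus [simp]: "homogeneous d (- p) \<longleftrightarrow> homogeneous d p"
  by (simp add: homogeneous_iff)

lemma homogeneous_diff: "homogeneous d p \<Longrightarrow> homogeneous d q \<Longrightarrow> homogeneous d (p - q)"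
  using homogeneous_add[of d p "- q"] by simp

lemma homogeneous_sum: "(\<And>i. i \<in> A \<Longrightarrow> homogeneous d (f i)) \<Longrightarrow> homogeneous d (sum f A)"
  by (induction A rule: infinite_finite_induct) (auto intro: homogeneous_add)

lemma homogeneous_mult: "homogeneous d p \<Longrightarrow> homogeneous e q \<Longrightarrow> homogeneous (d + e) (p * q)"
  unfolding homogeneous_iff by (metis keys_times_subset tdeg_add of_nat_add)

lemma homogeneous_single: "homogeneous d (sing u c) \<longleftrightarrow> c = 0 \<or> int (tdeg u) = d"
  by (auto simp: homogeneous_iff)

lemma homogeneous_scale: "homogeneous d p \<Longrightarrow> homogeneous d (sing 0 c * p)"
  using homogeneous_mult[of 0 "sing 0 c" d p] by (simp add: homogeneous_single)

text \<open>The degree is an integer because shifted degrees such as \<open>d - e\<close> may be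
  negative; the component is then zero.\<close>

definition hcomp :: "int \<Rightarrow> 'k::field mpoly \<Rightarrow> 'k mpoly" where
  "hcomp d p = (\<Sum>u\<in>{u\<in>ks p. int (tdeg u) = d}. sing u (lk p u))"

lemma lookup_hcomp: "lk (hcomp d p) u = (if int (tdeg u) = d then lk p u else 0)"
  by (auto simp: hcomp_def lookup_sum lookup_single when_def in_keys_iff)

lemma homogeneous_hcomp: "homogeneous d (hcomp d p)"
  by (auto simp: homogeneous_iff in_keys_iff lookup_hcomp split: if_splits)

lemma hcomp_homogeneous: "homogeneous d p \<Longrightarrow> hcomp d p = p"
  by (rule poly_mapping_eqI) (auto simp: lookup_hcomp homogeneous_iff in_keys_iff)

lemma hcomp_zero [simp]: "hcomp d 0 = 0" by (simp add: hcomp_def)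

lemma hcomp_add: "hcomp d (p + q) = hcomp d p + hcomp d q"
  by (rule poly_mapping_eqI) (auto simp: lookup_hcomp lookup_add)

lemma hcomp_sum: "hcomp d (sum f A) = (\<Sum>i\<in>A. hcomp d (f i))"
  by (induction A rule: infinite_finite_induct) (auto simp: hcomp_add)

lemma keys_hcomp: "ks (hcomp d p) \<subseteq> ks p"
  by (auto simp: in_keys_iff lookup_hcomp split: if_splits)

text \<open>After removing from \<open>p\<close> its part of degree \<open>d - e\<close>, no term is
  left that a term of \<open>a\<close> could lift to degree \<open>d\<close>.\<close>

lemma hcomp_mult:
  assumes "homogeneous e a"
  shows "hcomp d (a * p) = a * hcomp (d - e) p"
proof -
  let ?h = "hcomp (d - e) p"
  have "homogeneous d (a * ?h)"
    using homogeneous_mult[OF assms homogeneous_hcomp[of "d - e" p]] by simp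
  moreover have "hcomp d (a * (p - ?h)) = 0"
  proof (rule poly_mapping_eqI)
    fix u show "lk (hcomp d (a * (p - ?h))) u = lk 0 u"
    proof (cases "int (tdeg u) = d \<and> u \<in> ks (a * (p - ?h))")
      case True
      then obtain x y where xy: "x \<in> ks a" "y \<in> ks (p - ?h)" "u = x + y"
        using keys_times_subset by blast
      then have "int (tdeg x) = e" using assms by (simp add: homogeneous_iff)
      then have "int (tdeg y) = d - e" using True xy by simp
      then show ?thesis using xy(2) by (simp add: in_keys_iff lookup_minus lookup_hcomp)
    qed (auto simp: lookup_hcomp in_keys_iff)
  qed
  moreover have "hcomp d (a * p) = hcomp d (a * ?h) + hcomp d (a * (p - ?h))"
    by (simp only: hcomp_add[symmetric] distrib_left[symmetric]) simp
  ultimately show ?thesis by (simp only: hcomp_homogeneous add_0_right)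
qed

lemma sum_hcomp: 
  "p = (\<Sum>d\<in>(\<lambda>u. int (tdeg u)) ` ks p. hcomp d p)"
proof (rule poly_mapping_eqI)
  fix u
  show "lk p u = lk (\<Sum>d\<in>(\<lambda>u. int (tdeg u)) ` ks p. hcomp d p) u"
      unfolding lookup_sum lookup_hcomp by (cases "u \<in> ks p") (auto simp: in_keys_iff)
qed

section \<open>Monomial ideals\<close>

abbreviation Pol :: "nat set \<Rightarrow> 'k::field mpoly set" where "Pol V \<equiv> carrier (mpoly_ring V)"

lemma Pol_iff: "p \<in> Pol V \<longleftrightarrow> (\<forall>u\<in>ks p. ks u \<subseteq> V)"
  by (rule mem_carrier_mpoly_ring)

lemma Pol_zero [simp]: "0 \<in> Pol V" and Pol_one [simp]: "1 \<in> Pol V"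
  by (simp_all add: Pol_iff)

lemma Pol_add: "p \<in> Pol V \<Longrightarrow> q \<in> Pol V \<Longrightarrow> p + q \<in> Pol V"
  using ring.ring_simprules(1)[OF cring.axioms(1)[OF cring_mpoly_ring[of V]]] by simp

lemma Pol_mult: "p \<in> Pol V \<Longrightarrow> q \<in> Pol V \<Longrightarrow> p * q \<in> Pol V"
  using ring.ring_simprules(5)[OF cring.axioms(1)[OF cring_mpoly_ring[of V]]] by simp

lemma Pol_uminus [simp]: "- p \<in> Pol V \<longleftrightarrow> p \<in> Pol V"
  by (simp add: Pol_iff)

lemma Pol_diff: "p \<in> Pol V \<Longrightarrow> q \<in> Pol V \<Longrightarrow> p - q \<in> Pol V"
  using Pol_add[of p V "- q"] by simp

lemma Pol_sum: "(\<And>i. i \<in> A \<Longrightarrow> f i \<in> Pol V) \<Longrightarrow> sum f A \<in> Pol V"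
  by (induction A rule: infinite_finite_induct) (auto intro: Pol_add)

lemma Pol_single: "sing u c \<in> Pol V \<longleftrightarrow> c = 0 \<or> ks u \<subseteq> V"
  by (simp add: Pol_iff)

lemma Pol_mvar: "j \<in> V \<Longrightarrow> mvar j \<in> Pol V"
  by (simp add: mvar_def Pol_single)

lemma Pol_hcomp: "p \<in> Pol V \<Longrightarrow> hcomp d p \<in> Pol V"
  using keys_hcomp[of d p] by (auto simp: Pol_iff)

lemma Pol_sgn: "(-1) ^ n \<in> Pol V"
  by (induction n) auto

text \<open>Bridge from ideals of the ring record to closure conditions in the type class
  operations, in which the later calculations are done.\<close>

lemma ideal_mpoly_ringI:
  assumes "I \<subseteq> Pol V" "0 \<in> I" "\<And>p q. p \<in> I \<Longrightarrow> q \<in> I \<Longrightarrow> p + q \<in> I"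
    and "\<And>p a. p \<in> I \<Longrightarrow> a \<in> Pol V \<Longrightarrow> a * p \<in> I"
  shows "ideal I (mpoly_ring V :: 'k::field mpoly ring)"
proof -
  interpret R: cring "mpoly_ring V :: 'k mpoly ring" by (rule cring_mpoly_ring)
  have uminus: "- p \<in> I" if "p \<in> I" for p
    using assms(4)[OF that, of "- 1"] by simp
  show ?thesis
  proof (rule idealI)
    show "subgroup I (add_monoid (mpoly_ring V :: 'k mpoly ring))"
    proof (rule R.add.subgroupI)
      fix p assume p: "p \<in> I"
      then have "\<ominus>\<^bsub>mpoly_ring V\<^esub> p = - p"
        using assms(1) by (intro R.minus_equality) auto
      then show "\<ominus>\<^bsub>mpoly_ring V\<^esub> p \<in> I" using uminus[OF p] by simp
    qed (use assms in auto)
  qed (use assms in \<open>auto simp: R.ring_axioms mult.commute\<close>)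
qed

lemma ideal_mpoly_ringD:
  assumes "ideal I (mpoly_ring V :: 'k::field mpoly ring)"
  shows "I \<subseteq> Pol V" "0 \<in> I" "\<And>p q. p \<in> I \<Longrightarrow> q \<in> I \<Longrightarrow> p + q \<in> I"
    "\<And>p a. p \<in> I \<Longrightarrow> a \<in> Pol V \<Longrightarrow> a * p \<in> I"
    "\<And>p. p \<in> I \<Longrightarrow> - p \<in> I"
    "\<And>p q. p \<in> I \<Longrightarrow> q \<in> I \<Longrightarrow> p - q \<in> I"
proof -
  interpret I: ideal I "mpoly_ring V :: 'k mpoly ring" by fact
  show sub: "I \<subseteq> Pol V" using I.a_subset .
  show "0 \<in> I" using additive_subgroup.zero_closed[OF I.additive_subgroup_axioms] by simp
  show add: "p + q \<in> I" if "p \<in> I" "q \<in> I" for p q using additive_subgroup.a_closed[OF I.additive_subgroup_axioms that] by simp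
  show mult: "a * p \<in> I" if "p \<in> I" "a \<in> Pol V" for p a using I.I_l_closed[OF that] by simp
  show neg: "- p \<in> I" if "p \<in> I" for p using mult[OF that, of "- 1"] by simp
  show "p - q \<in> I" if "p \<in> I" "q \<in> I" for p q using add[OF that(1) neg[OF that(2)]] by simp
qed

lemma ideal_mpoly_ring_sum:
  assumes "ideal I (mpoly_ring V)" "\<And>i. i \<in> A \<Longrightarrow> f i \<in> I"
  shows "sum f A \<in> I"
  using assms(2)
  by (induction A rule: infinite_finite_induct) (auto intro: ideal_mpoly_ringD[OF assms(1)])

text \<open>The monomial ideal generated by \<open>U\<close>, encoded by supports so that
  membership, intersections and multigraded pieces can be decided term by term.
  \<open>Idl_monomials\<close> identifies it with the generated ideal.\<close>

definition mideal :: "nat set \<Rightarrow> expo set \<Rightarrow> 'k::field mpoly set" where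
  "mideal V U = {p \<in> Pol V. \<forall>u\<in>ks p. \<exists>g\<in>U. g adds u}"

lemma ideal_mideal: "ideal (mideal V U) (mpoly_ring V)"
proof (rule ideal_mpoly_ringI)
  fix p q :: "'a mpoly" assume "p \<in> mideal V U" "q \<in> mideal V U"
  then show "p + q \<in> mideal V U"
    unfolding mideal_def using Poly_Mapping.keys_add[of p q] by (auto intro: Pol_add)
next
  fix p a :: "'a mpoly" assume pa: "p \<in> mideal V U" "a \<in> Pol V"
  show "a * p \<in> mideal V U"
    unfolding mideal_def
  proof (intro CollectI conjI ballI)
    fix u assume "u \<in> ks (a * p)"
    then obtain x y where "x \<in> ks a" "y \<in> ks p" "u = x + y"
      using keys_times_subset by blast
    then show "\<exists>g\<in>U. g adds u"
      using pa adds_trans[OF _ adds_add_right] unfolding mideal_def by blast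
  qed (use pa in \<open>auto simp: mideal_def intro: Pol_mult\<close>)
qed (auto simp: mideal_def)

lemma single_in_mideal: "g \<in> U \<Longrightarrow> g adds u \<Longrightarrow> ks u \<subseteq> V \<Longrightarrow> sing u c \<in> mideal V U"
  by (auto simp: mideal_def Pol_single)

lemma Idl_monomials:
  assumes "\<And>u. u \<in> U \<Longrightarrow> ks u \<subseteq> V"
  shows "Idl\<^bsub>mpoly_ring V\<^esub> ((\<lambda>u. sing u (1::'k::field)) ` U) = mideal V U"
proof
  interpret R: cring "mpoly_ring V :: 'k mpoly ring" by (rule cring_mpoly_ring)
  let ?G = "(\<lambda>u. sing u (1::'k)) ` U"
  have G: "?G \<subseteq> Pol V" using assms by (auto simp: Pol_single)
  show "Idl\<^bsub>mpoly_ring V\<^esub> ?G \<subseteq> mideal V U"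
    by (rule R.genideal_minimal[OF ideal_mideal]) (use assms in \<open>auto intro!: single_in_mideal[OF _ adds_refl]\<close>)
  have id: "ideal (Idl\<^bsub>mpoly_ring V\<^esub> ?G) (mpoly_ring V)" by (rule R.genideal_ideal[OF G])
  show "mideal V U \<subseteq> Idl\<^bsub>mpoly_ring V\<^esub> ?G"
  proof
    fix p :: "'k mpoly" assume p: "p \<in> mideal V U"
    have "sing u (lk p u) \<in> Idl\<^bsub>mpoly_ring V\<^esub> ?G" if u: "u \<in> ks p" for u
    proof -
      obtain g where g: "g \<in> U" "g adds u" using p u by (auto simp: mideal_def)
      have "ks u \<subseteq> V" using p u by (auto simp: mideal_def Pol_iff)
      then have "sing (u - g) (lk p u) \<in> Pol V"
        using keys_minus_subset[of u g] by (auto simp: Pol_single)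
      moreover have "sing g 1 \<in> Idl\<^bsub>mpoly_ring V\<^esub> ?G"
        using R.genideal_self[OF G] g by blast
      moreover have "sing u (lk p u) = sing (u - g) (lk p u) * sing g 1"
        by (simp add: mult_single adds_minus' g)
      ultimately show ?thesis using ideal_mpoly_ringD(4)[OF id] by metis
    qed
    then show "p \<in> Idl\<^bsub>mpoly_ring V\<^esub> ?G"
      by (subst poly_eq_sum_single) (rule ideal_mpoly_ring_sum[OF id])
  qed
qed

lemma monomial_ideal_mideal:
  assumes "\<And>u. u \<in> U \<Longrightarrow> ks u \<subseteq> V"
  shows "monomial_ideal V (mideal V U :: 'k::field mpoly set)"
  unfolding monomial_ideal_def
  by (rule exI[of _ "(\<lambda>u. sing u (1::'k)) ` U"])
    (use assms in \<open>auto simp: Idl_monomials is_monomial_def Pol_single\<close>)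

lemma single_dvd_iff: "sing u (1::'k::field) dvd sing w 1 \<longleftrightarrow> u adds w"
proof
  assume "sing u (1::'k) dvd sing w 1"
  then obtain q where "sing w 1 = sing u (1::'k) * q" by (elim dvdE)
  then have "lk (sing u 1 * q) w = (1::'k)" by (metis lookup_single_eq)
  then show "u adds w" by (simp add: lookup_mono_times split: if_splits)
next
  assume "u adds w"
  then show "sing u (1::'k) dvd sing w 1"
    by (intro dvdI[of _ _ "sing (w - u) 1"]) (simp add: mult_single adds_minus)
qed

lemma single_eq_iff: "sing u (1::'k::field) = sing w 1 \<longleftrightarrow> u = w"
  by (metis lookup_single_eq lookup_single_not_eq zero_neq_one)

lemma single_in_mideal_iff: "sing u (1::'k::field) \<in> mideal V U \<longleftrightarrow> ks u \<subseteq> V \<and> (\<exists>g\<in>U. g adds u)"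
  by (simp add: mideal_def Pol_single)

text \<open>Each monomial of the ideal is divisible by some element of \<open>U\<close>, so minimal
  ones come from \<open>U\<close>; as \<open>U\<close> is an antichain, none of its elements is
  redundant.\<close>

lemma min_gens_mideal:
  assumes "\<And>u. u \<in> U \<Longrightarrow> ks u \<subseteq> V"
    and anti: "\<And>u w. u \<in> U \<Longrightarrow> w \<in> U \<Longrightarrow> u adds w \<Longrightarrow> u = w"
  shows "min_gens (mideal V U) = (\<lambda>u. sing u (1::'k::field)) ` U"
proof
  show "min_gens (mideal V U) \<subseteq> (\<lambda>u. sing u (1::'k)) ` U"
  proof
    fix m :: "'k mpoly" assume m: "m \<in> min_gens (mideal V U)"
    then obtain u where u: "m = sing u 1" by (auto simp: min_gens_def is_monomial_def)
    then obtain g where g: "g \<in> U" "g adds u"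
      using m by (auto simp: min_gens_def single_in_mideal_iff)
    have "sing g (1::'k) \<in> mideal V U" unfolding single_in_mideal_iff using g(1) assms(1) adds_refl by blast
    moreover have "sing g (1::'k) dvd m" using g u by (simp add: single_dvd_iff)
    ultimately have "sing g 1 = m" using m by (auto simp: min_gens_def is_monomial_def)
    then show "m \<in> (\<lambda>u. sing u (1::'k)) ` U" using g by auto
  qed
  show "(\<lambda>u. sing u (1::'k)) ` U \<subseteq> min_gens (mideal V U)"
  proof
    fix m :: "'k mpoly" assume "m \<in> (\<lambda>u. sing u (1::'k)) ` U"
    then obtain u where u: "u \<in> U" "m = sing u 1" by auto
    have "m' = m" if m': "m' \<in> mideal V U" "is_monomial m'" "m' dvd m" for m'
    proof -
      obtain w where w: "m' = sing w 1" using m' by (auto simp: is_monomial_def)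
      then obtain g where g: "g \<in> U" "g adds w" using m' by (auto simp: single_in_mideal_iff)
      have "w adds u" using m' w u by (simp add: single_dvd_iff)
      then show ?thesis using anti[OF g(1) u(1)] g adds_trans adds_antisym u w by blast
    qed
    moreover have "m \<in> mideal V U"
      unfolding u(2) by (rule single_in_mideal[OF u(1) adds_refl assms(1)[OF u(1)]])
    ultimately show "m \<in> min_gens (mideal V U)"
      using u by (auto simp: min_gens_def is_monomial_def)
  qed
qed

lemma mideal_Un:
  "mideal V (U \<union> W) = mideal V U <+>\<^bsub>mpoly_ring V\<^esub> (mideal V W :: 'k::field mpoly set)"
proof
  show "mideal V U <+>\<^bsub>mpoly_ring V\<^esub> (mideal V W :: 'k mpoly set) \<subseteq> mideal V (U \<union> W)"
  proof
    fix p :: "'k mpoly" assume "p \<in> mideal V U <+>\<^bsub>mpoly_ring V\<^esub> mideal V W"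
    then obtain a b where "a \<in> mideal V U" "b \<in> mideal V W" "p = a + b"
      by (auto simp: set_add_def')
    moreover from this have "a \<in> mideal V (U \<union> W)" "b \<in> mideal V (U \<union> W)"
      by (auto simp: mideal_def)
    ultimately show "p \<in> mideal V (U \<union> W)" using ideal_mpoly_ringD(3)[OF ideal_mideal] by blast
  qed
  show "mideal V (U \<union> W) \<subseteq> mideal V U <+>\<^bsub>mpoly_ring V\<^esub> (mideal V W :: 'k mpoly set)"
  proof
    fix p :: "'k mpoly" assume p: "p \<in> mideal V (U \<union> W)"
    \<comment> \<open>The terms of \<open>p\<close> are sorted by whether an element of
      \<open>U\<close> divides them; the remaining ones are divisible by an element of
      \<open>W\<close>.\<close>
    let ?A = "{u \<in> ks p. \<exists>g\<in>U. g adds u}"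
    let ?a = "\<Sum>u\<in>?A. sing u (lk p u)" and ?b = "\<Sum>u\<in>ks p - ?A. sing u (lk p u)"
    have "p = ?b + ?a"
      by (subst poly_eq_sum_single, rule sum.subset_diff) auto
    moreover have "?a \<in> mideal V U"
      by (rule ideal_mpoly_ring_sum[OF ideal_mideal])
        (use p in \<open>auto simp: mideal_def Pol_iff\<close>)
    moreover have "?b \<in> mideal V W"
      by (rule ideal_mpoly_ring_sum[OF ideal_mideal])
        (use p in \<open>auto simp: mideal_def Pol_iff\<close>)
    ultimately show "p \<in> mideal V U <+>\<^bsub>mpoly_ring V\<^esub> mideal V W"
      by (auto simp: set_add_def' add.commute)
  qed
qed

lemma mvar_times_mideal:
  assumes "v \<in> V"
  shows "(\<lambda>p. mvar v * p) ` mideal V U = (mideal V ((\<lambda>u. sing v 1 + u) ` U) :: 'k::field mpoly set)"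
proof
  show "(\<lambda>p. mvar v * p) ` mideal V U \<subseteq> (mideal V ((\<lambda>u. sing v 1 + u) ` U) :: 'k mpoly set)"
  proof
    fix q :: "'k mpoly" assume "q \<in> (\<lambda>p. mvar v * p) ` mideal V U"
    then obtain p where p: "p \<in> mideal V U" "q = mvar v * p" by auto
    show "q \<in> mideal V ((\<lambda>u. sing v 1 + u) ` U)"
      unfolding mideal_def
    proof (intro CollectI conjI ballI)
      show "q \<in> Pol V" using p assms by (auto simp: mideal_def intro: Pol_mult Pol_mvar)
      fix u assume "u \<in> ks q"
      then obtain x y where "x \<in> ks (mvar v :: 'k mpoly)" "y \<in> ks p" "u = x + y"
        using keys_times_subset p by blast
      moreover from this obtain g where "g \<in> U" "g adds y" using p by (auto simp: mideal_def)
      ultimately show "\<exists>g\<in>(\<lambda>u. sing v 1 + u) ` U. g adds u"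
        by (auto simp: mvar_def adds_def lookup_add)
    qed
  qed
  show "(mideal V ((\<lambda>u. sing v 1 + u) ` U) :: 'k mpoly set) \<subseteq> (\<lambda>p. mvar v * p) ` mideal V U"
  proof
    fix q :: "'k mpoly" assume q: "q \<in> mideal V ((\<lambda>u. sing v 1 + u) ` U)"
    \<comment> \<open>Termwise quotient of \<open>q\<close> by the variable, which divides each term
      because it divides each generator.\<close>
    let ?p = "\<Sum>u\<in>ks q. sing (u - sing v 1) (lk q u)"
    have *: "\<exists>g\<in>U. g adds u - sing v 1 \<and> u = sing v 1 + (u - sing v 1)" if "u \<in> ks q" for u
    proof -
      obtain g where g: "g \<in> U" "sing v 1 + g adds u" using q \<open>u \<in> ks q\<close> by (auto simp: mideal_def)
      then have "sing v 1 adds u" by (metis adds_trans adds_add_left)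
      moreover obtain t where "u = sing v 1 + g + t" using g adds_iff_add by blast
      ultimately have "u = sing v 1 + (u - sing v 1)" "u - sing v 1 = g + t"
        using adds_minus by (metis, metis add.assoc add_diff_cancel_left')
      then show ?thesis using g(1) by (metis adds_add_left)
    qed
    have "mvar v * ?p = (\<Sum>u\<in>ks q. sing u (lk q u))"
      unfolding sum_distrib_left
      by (rule sum.cong) (use * in \<open>auto simp: mvar_def mult_single simp del: One_nat_def\<close>)
    then have "q = mvar v * ?p" using poly_eq_sum_single by metis
    moreover have "?p \<in> mideal V U"
    proof (rule ideal_mpoly_ring_sum[OF ideal_mideal])
      fix u assume u: "u \<in> ks q"
      then have "ks u \<subseteq> V" using q by (auto simp: mideal_def Pol_iff)
      then show "sing (u - sing v 1) (lk q u) \<in> mideal V U"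
        using *[OF u] keys_minus_subset[of u "sing v 1"] by (auto intro: single_in_mideal)
    qed
    ultimately show "q \<in> (\<lambda>p. mvar v * p) ` mideal V U" by blast
  qed
qed

lemma mvar_dvd_single: "mvar v dvd sing u (1::'k::field) \<longleftrightarrow> v \<in> ks u"
  unfolding mvar_def single_dvd_iff single_adds_iff by simp

text \<open>For an antichain the minimal generators can be read off \<open>U\<close>, so the
  partition by \<open>v\<close> is the partition of \<open>U\<close> and only the numerical identity
  remains.\<close>

lemma admits_splitting_mideal:
  fixes U :: "expo set"
  assumes v: "v \<in> V" and U: "\<And>u. u \<in> U \<Longrightarrow> ks u \<subseteq> V"
    and anti: "\<And>u w. u \<in> U \<Longrightarrow> w \<in> U \<Longrightarrow> u adds w \<Longrightarrow> u = w"
    and betti: "\<And>r j :: nat. graded_betti V (int r) (int j) (mideal V U :: 'k::field mpoly set) =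
          graded_betti V (int r) (int j) (mideal V {u\<in>U. v \<in> ks u} :: 'k mpoly set) +
          graded_betti V (int r) (int j) (mideal V {u\<in>U. v \<notin> ks u} :: 'k mpoly set) +
          graded_betti V (int r - 1) (int j)
            (mideal V {u\<in>U. v \<in> ks u} \<inter> mideal V {u\<in>U. v \<notin> ks u} :: 'k mpoly set)"
  shows "admits_splitting V v (mideal V U :: 'k mpoly set)"
proof -
  let ?m = "\<lambda>u. sing u (1::'k)"
  let ?U1 = "{u\<in>U. v \<in> ks u}" and ?U2 = "{u\<in>U. v \<notin> ks u}"
  have mg: "min_gens (mideal V U) = ?m ` U"
    by (rule min_gens_mideal[OF U anti])
  have mg1: "min_gens (mideal V ?U1) = ?m ` ?U1" "min_gens (mideal V ?U2) = ?m ` ?U2"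
    by (rule min_gens_mideal; use U anti in blast)+
  have dg: "divisible_gens v (mideal V U) = ?m ` ?U1"
    by (auto simp: divisible_gens_def mg mvar_dvd_single)
  have "{q. mvar v * q \<in> ?m ` ?U1} = ?m ` ((\<lambda>u. u - sing v 1) ` ?U1)"
  proof -
    have eq: "?m u = mvar v * ?m (u - sing v 1)" if "v \<in> ks u" for u
      using adds_minus[of "sing v 1" u] that
      by (simp add: mvar_def mult_single single_adds_iff del: One_nat_def)
    have "q = ?m (u - sing v 1)" if "v \<in> ks u" "mvar v * q = ?m u" for q u
    proof -
      have "mvar v * q = mvar v * ?m (u - sing v 1)" using eq that by simp
      moreover have "mvar v \<noteq> (0 :: 'k mpoly)"
        unfolding mvar_def by (metis lookup_single_eq lookup_zero zero_neq_one)
      ultimately show ?thesis by simp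
    qed
    then show ?thesis using eq by (force simp del: One_nat_def)
  qed
  then have J: "partition_J V v (mideal V U :: 'k mpoly set) = mideal V ((\<lambda>u. u - sing v 1) ` ?U1)"
    unfolding partition_J_def dg
    using Idl_monomials[of "(\<lambda>u. u - sing v 1) ` ?U1" V] U keys_minus_subset by (smt (verit) image_iff mem_Collect_eq subset_trans)
  have "(\<lambda>u. sing v 1 + u) ` (\<lambda>u. u - sing v 1) ` ?U1 = ?U1"
    using adds_minus[of "sing v 1"] by (force simp: image_image single_adds_iff simp del: One_nat_def)
  then have xJ: "(\<lambda>p. mvar v * p) ` partition_J V v (mideal V U :: 'k mpoly set) = mideal V ?U1"
    unfolding J mvar_times_mideal[OF v] by simp
  have inj: "inj ?m" by (auto simp: inj_def single_eq_iff)
  have "min_gens (mideal V U) - divisible_gens v (mideal V U) = ?m ` ?U2"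
    unfolding mg dg using inj by (auto simp: single_eq_iff)
  then have K: "partition_K V v (mideal V U :: 'k mpoly set) = mideal V ?U2"
    unfolding partition_K_def using Idl_monomials[of ?U2 V] U by auto
  have UU: "U = ?U1 \<union> ?U2" by auto
  have sum: "mideal V U = mideal V ?U1 <+>\<^bsub>mpoly_ring V\<^esub> (mideal V ?U2 :: 'k mpoly set)"
    using mideal_Un[of V ?U1 ?U2] UU by simp
  have "monomial_ideal V (mideal V U :: 'k mpoly set)" "monomial_ideal V (mideal V ?U1 :: 'k mpoly set)"
    "monomial_ideal V (mideal V ?U2 :: 'k mpoly set)"
    by (rule monomial_ideal_mideal; use U in blast)+
  moreover have "?m ` U = ?m ` ?U1 \<union> ?m ` ?U2" "?m ` ?U1 \<inter> ?m ` ?U2 = {}"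
    by (auto simp: single_eq_iff)
  ultimately show ?thesis
    unfolding admits_splitting_def betti_splitting_def xJ K mg mg1 using betti sum by blast
qed

section \<open>The Koszul differential\<close>

text \<open>Sign of moving the \<open>j\<close>-th basis vector past the smaller elements of \<tau>
  in an exterior product.\<close>

definition ksgn :: "nat \<Rightarrow> nat set \<Rightarrow> 'a::comm_ring_1" where
  "ksgn j \<tau> = (-1) ^ card {i \<in> \<tau>. i < j}"

text \<open>Contraction on the exterior algebra over \<open>V\<close>; a chain is given by its
  coefficients on the basis elements indexed by sets. The variables as \<open>x\<close> give the
  Koszul differential, the constant 1 gives the simplicial boundary.\<close>

definition kd :: "nat set \<Rightarrow> (nat \<Rightarrow> 'a) \<Rightarrow> (nat set \<Rightarrow> 'a) \<Rightarrow> nat set \<Rightarrow> 'a::comm_ring_1" where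
  "kd V x z \<tau> = (\<Sum>j\<in>V - \<tau>. ksgn j \<tau> * (x j * z (insert j \<tau>)))"

text \<open>Exterior multiplication by the \<open>j\<close>-th basis vector.\<close>

definition ke :: "nat \<Rightarrow> (nat set \<Rightarrow> 'a) \<Rightarrow> nat set \<Rightarrow> 'a::comm_ring_1" where
  "ke j z \<sigma> = (if j \<in> \<sigma> then ksgn j (\<sigma> - {j}) * z (\<sigma> - {j}) else 0)"

lemma ksgn_square: "ksgn j \<tau> * (ksgn j \<tau> * a) = a"
  by (simp add: ksgn_def mult.assoc[symmetric] power_add[symmetric] mult_2[symmetric])

lemma ksgn_insert:
  assumes "finite \<tau>" "i \<notin> \<tau>"
  shows "ksgn j (insert i \<tau>) = (if i < j then - ksgn j \<tau> else ksgn j \<tau>)"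
proof -
  have "{k \<in> insert i \<tau>. k < j} = (if i < j then insert i {k \<in> \<tau>. k < j} else {k \<in> \<tau>. k < j})"
    by auto
  then show ?thesis using assms by (simp add: ksgn_def)
qed

lemma ksgn_Un:
  assumes "finite \<sigma>" "finite \<tau>" "\<sigma> \<inter> \<tau> = {}"
  shows "ksgn j (\<sigma> \<union> \<tau>) = ksgn j \<sigma> * ksgn j \<tau>"
proof -
  have "{k \<in> \<sigma> \<union> \<tau>. k < j} = {k \<in> \<sigma>. k < j} \<union> {k \<in> \<tau>. k < j}" by auto
  then show ?thesis
    using assms by (simp add: ksgn_def power_add card_Un_disjoint disjoint_iff)
qed

lemma kd_outside: "(\<And>j. j \<in> V - \<tau> \<Longrightarrow> z (insert j \<tau>) = 0) \<Longrightarrow> kd V x z \<tau> = 0"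
  by (simp add: kd_def)

lemma kd_nonzero: "kd V x z \<tau> \<noteq> 0 \<Longrightarrow> \<exists>j\<in>V - \<tau>. z (insert j \<tau>) \<noteq> 0"
  using kd_outside by blast

lemma kd_zero [simp]: "kd V x (\<lambda>_. 0) \<tau> = 0"
  by (simp add: kd_def)

lemma kd_add: "kd V x (\<lambda>\<sigma>. z \<sigma> + y \<sigma>) \<tau> = kd V x z \<tau> + kd V x y \<tau>"
  by (simp add: kd_def algebra_simps sum.distrib)

lemma kd_diff: "kd V x (\<lambda>\<sigma>. z \<sigma> - y \<sigma>) \<tau> = kd V x z \<tau> - kd V x y \<tau>"
  by (simp add: kd_def algebra_simps sum_subtractf)

lemma kd_scale: "kd V x (\<lambda>\<sigma>. c * z \<sigma>) \<tau> = c * kd V x z \<tau>"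
  by (simp add: kd_def sum_distrib_left algebra_simps)

lemma kd_sum: "kd V x (\<lambda>\<sigma>. \<Sum>i\<in>A. z i \<sigma>) \<tau> = (\<Sum>i\<in>A. kd V x (z i) \<tau>)"
  by (induction A rule: infinite_finite_induct) (simp_all add: kd_add)

text \<open>The terms at \<open>(i, j)\<close> and \<open>(j, i)\<close> cancel. Induction is used
  because a sum equal to its own negative need not vanish in characteristic 2.\<close>

lemma sum_antisymmetric:
  fixes f :: "'b \<Rightarrow> 'b \<Rightarrow> 'a::comm_ring_1"
  assumes "finite A" "\<And>i j. i \<in> A \<Longrightarrow> j \<in> A \<Longrightarrow> i \<noteq> j \<Longrightarrow> f i j = - f j i"
  shows "(\<Sum>j\<in>A. \<Sum>i\<in>A - {j}. f j i) = 0"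
  using assms
proof (induction A rule: finite_induct)
  case (insert a A)
  have "(\<Sum>j\<in>A. \<Sum>i\<in>insert a A - {j}. f j i) = (\<Sum>j\<in>A. f j a + (\<Sum>i\<in>A - {j}. f j i))"
  proof (rule sum.cong[OF refl])
    fix j assume j: "j \<in> A"
    then have "insert a A - {j} = insert a (A - {j})" using insert.hyps by auto
    then show "(\<Sum>i\<in>insert a A - {j}. f j i) = f j a + (\<Sum>i\<in>A - {j}. f j i)"
      using insert.hyps by simp
  qed
  also have "\<dots> = (\<Sum>j\<in>A. f j a)"
  proof -
    have "(\<Sum>j\<in>A. \<Sum>i\<in>A - {j}. f j i) = 0" by (rule insert.IH, rule insert.prems) auto
    then show ?thesis by (simp add: sum.distrib)
  qed
  also have "\<dots> = - (\<Sum>j\<in>A. f a j)"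
    unfolding sum_negf[symmetric]
    by (rule sum.cong[OF refl], rule insert.prems) (use insert.hyps in auto)
  finally have "(\<Sum>j\<in>A. \<Sum>i\<in>insert a A - {j}. f j i) = - (\<Sum>j\<in>A. f a j)" .
  moreover have "insert a A - {a} = A" using insert.hyps by auto
  ultimately show ?case using insert.hyps by simp
qed simp

text \<open>Two elements inserted in either order produce the same set with opposite signs.\<close>

lemma kd_kd:
  assumes V: "finite V" and supp: "\<And>\<sigma>. z \<sigma> \<noteq> 0 \<Longrightarrow> \<sigma> \<subseteq> V"
  shows "kd V x (kd V x z) \<tau> = 0"
proof (cases "\<tau> \<subseteq> V")
  case False
  then have "kd V x z (insert j \<tau>) = 0" for j
    using supp by (intro kd_outside) blast
  then show ?thesis by (simp add: kd_def)
next
  case True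
  then have fin: "finite \<tau>" using V finite_subset by blast
  define f where "f j i = ksgn j \<tau> * (x j * (ksgn i (insert j \<tau>) * (x i * z (insert i (insert j \<tau>)))))" for i j
  have "kd V x (kd V x z) \<tau> = (\<Sum>j\<in>V - \<tau>. \<Sum>i\<in>(V - \<tau>) - {j}. f j i)"
  proof -
    have "V - insert j \<tau> = V - \<tau> - {j}" for j by auto
    then show ?thesis unfolding kd_def f_def sum_distrib_left by (simp only:)
  qed
  also have "\<dots> = 0"
  proof (rule sum_antisymmetric)
    fix i j assume "i \<in> V - \<tau>" "j \<in> V - \<tau>" "i \<noteq> j"
    then show "f i j = - f j i"
      using fin by (auto simp: f_def ksgn_insert insert_commute algebra_simps)
  qed (use V in auto)
  finally show ?thesis .
qed

lemma ke_nonzero: "ke j z \<sigma> \<noteq> 0 \<Longrightarrow> j \<in> \<sigma> \<and> z (\<sigma> - {j}) \<noteq> 0"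
  by (auto simp: ke_def split: if_splits)

text \<open>Exterior multiplication is a null homotopy for multiplication by \<open>x j\<close>.
  With \<open>x = 1\<close> it makes cones acyclic; with the variables it drives both the splitting
  and the descent along regular sequences.\<close>

lemma kd_ke:
  assumes V: "finite V" and supp: "\<And>\<sigma>. z \<sigma> \<noteq> 0 \<Longrightarrow> \<sigma> \<subseteq> V" and j: "j \<in> V"
  shows "kd V x (ke j z) \<tau> + ke j (kd V x z) \<tau> = x j * z \<tau>"
proof (cases "\<tau> \<subseteq> V")
  case False
  have "ke j z (insert i \<tau>) = 0" for i
  proof -
    have "\<not> insert i \<tau> - {j} \<subseteq> V" using False j by auto
    then show ?thesis using ke_nonzero supp by blast
  qed
  moreover have "z (\<tau> - {j}) = 0" using supp[of "\<tau> - {j}"] False j by blast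
  moreover have "kd V x z (\<tau> - {j}) = 0"
    using supp False j by (intro kd_outside) blast
  moreover have "z \<tau> = 0" using supp False by blast
  ultimately show ?thesis by (simp add: kd_def ke_def)
next
  case True
  then have fin: "finite \<tau>" using V finite_subset by blast
  show ?thesis
  proof (cases "j \<in> \<tau>")
    case False
    \<comment> \<open>Without \<open>j\<close> in \<tau>, only the insertion of \<open>j\<close>
      itself survives, as \<open>ke j z\<close> vanishes on sets that omit \<open>j\<close>.\<close>
    have "kd V x (ke j z) \<tau> = (\<Sum>i\<in>{j}. ksgn i \<tau> * (x i * ke j z (insert i \<tau>)))"
      unfolding kd_def
      by (rule sum.mono_neutral_right) (use V j False in \<open>auto simp: ke_def\<close>)
    also have "\<dots> = x j * z \<tau>"
      using False ksgn_square[of j \<tau> "x j * z \<tau>"] by (simp add: ke_def algebra_simps)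
    finally show ?thesis using False by (simp add: ke_def)
  next
    case jt: True
    define \<rho> where "\<rho> = \<tau> - {j}"
    have \<tau>: "\<tau> = insert j \<rho>" "j \<notin> \<rho>" and fin': "finite \<rho>" using jt fin by (auto simp: \<rho>_def)
    have "ke j (kd V x z) \<tau> = ksgn j \<rho> * (\<Sum>i\<in>insert j (V - \<tau>). ksgn i \<rho> * (x i * z (insert i \<rho>)))"
      using \<tau> j by (auto simp: ke_def kd_def intro!: arg_cong2[where f="(*)"] sum.cong)
    also have "\<dots> = ksgn j \<rho> * (ksgn j \<rho> * (x j * z \<tau>)) +
      (\<Sum>i\<in>V - \<tau>. ksgn j \<rho> * (ksgn i \<rho> * (x i * z (insert i \<rho>))))"
      using V \<tau> by (simp add: distrib_left sum_distrib_left)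
    also have "\<dots> = x j * z \<tau> - kd V x (ke j z) \<tau>"
    proof -
      \<comment> \<open>For distinct \<open>i\<close> and \<open>j\<close>, contraction by one and
        multiplication by the other anticommute.\<close>
      have "ksgn i \<tau> * (x i * ke j z (insert i \<tau>)) = - (ksgn j \<rho> * (ksgn i \<rho> * (x i * z (insert i \<rho>))))"
        if i: "i \<in> V - \<tau>" for i
      proof -
        have "insert i \<tau> - {j} = insert i \<rho>" "i \<noteq> j" "i \<notin> \<rho>" using i \<tau> by auto
        then show ?thesis using \<tau> fin' by (auto simp: ke_def ksgn_insert)
      qed
      then show ?thesis by (simp add: kd_def ksgn_square sum_negf)
    qed
    finally show ?thesis by simp
  qed
qed

section \<open>Multigraded pieces\<close>

abbreviation sd :: "nat set \<Rightarrow> (nat set \<Rightarrow> 'k) \<Rightarrow> nat set \<Rightarrow> 'k::field" where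
  "sd V \<equiv> kd V (\<lambda>_. 1)"

abbreviation kdm :: "nat set \<Rightarrow> (nat set \<Rightarrow> 'k mpoly) \<Rightarrow> nat set \<Rightarrow> 'k::field mpoly" where
  "kdm V \<equiv> kd V mvar"

text \<open>
  In homological degree \<open>q\<close>, counted by cardinality, so this is the vanishing of the reduced
  homology in dimension \<open>q - 1\<close> when \<open>D\<close> is a simplicial complex.
\<close>

definition acyclic_at :: "'k::field itself \<Rightarrow> nat set \<Rightarrow> nat set set \<Rightarrow> nat \<Rightarrow> bool" where
  "acyclic_at k V D q \<longleftrightarrow>
     (\<forall>c :: nat set \<Rightarrow> 'k. (\<forall>\<sigma>. c \<sigma> \<noteq> 0 \<longrightarrow> \<sigma> \<in> D \<and> card \<sigma> = q) \<longrightarrow> (\<forall>\<tau>. sd V c \<tau> = 0) \<longrightarrow>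
        (\<exists>b. (\<forall>\<sigma>. b \<sigma> \<noteq> 0 \<longrightarrow> \<sigma> \<in> D \<and> card \<sigma> = Suc q) \<and> sd V b = c))"

lemma acyclic_atD:
  fixes c :: "nat set \<Rightarrow> 'k::field"
  assumes "acyclic_at TYPE('k) V D q"
    and "\<And>\<sigma>. c \<sigma> \<noteq> 0 \<Longrightarrow> \<sigma> \<in> D \<and> card \<sigma> = q" "\<And>\<tau>. sd V c \<tau> = 0"
  obtains b where "\<And>\<sigma>. b \<sigma> \<noteq> 0 \<Longrightarrow> \<sigma> \<in> D \<and> card \<sigma> = Suc q" "sd V b = c"
proof -
  have "\<exists>b. (\<forall>\<sigma>. b \<sigma> \<noteq> 0 \<longrightarrow> \<sigma> \<in> D \<and> card \<sigma> = Suc q) \<and> sd V b = c"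
    using assms(1)[unfolded acyclic_at_def, THEN spec[of _ c]] assms(2,3) by simp
  then show ?thesis using that by auto
qed

text \<open>By \<open>kd_ke\<close> with all \<open>x\<close> equal to 1, a cycle is the boundary of
  its exterior product with the apex.\<close>

lemma acyclic_at_cone:
  assumes V: "finite V" "D \<subseteq> Pow V" and j: "j \<in> V" "\<And>\<sigma>. \<sigma> \<in> D \<Longrightarrow> insert j \<sigma> \<in> D"
  shows "acyclic_at TYPE('k::field) V D q"
  unfolding acyclic_at_def
proof (intro allI impI)
  fix c :: "nat set \<Rightarrow> 'k"
  assume c: "\<forall>\<sigma>. c \<sigma> \<noteq> 0 \<longrightarrow> \<sigma> \<in> D \<and> card \<sigma> = q" "\<forall>\<tau>. sd V c \<tau> = 0"
  have "sd V (ke j c) \<tau> + ke j (sd V c) \<tau> = 1 * c \<tau>" for \<tau>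
    by (rule kd_ke) (use V j c in blast)+
  moreover have "ke j (sd V c) \<tau> = 0" for \<tau> using c by (simp add: ke_def)
  ultimately have "sd V (ke j c) = c" by auto
  moreover have "\<sigma> \<in> D \<and> card \<sigma> = Suc q" if "ke j c \<sigma> \<noteq> 0" for \<sigma>
  proof -
    have "j \<in> \<sigma>" "c (\<sigma> - {j}) \<noteq> 0" using ke_nonzero[OF that] by auto
    then have "\<sigma> - {j} \<in> D" "card (\<sigma> - {j}) = q" "insert j (\<sigma> - {j}) = \<sigma>" using c by auto
    moreover from this have "finite \<sigma>" using V j by (metis PowD finite_subset subsetD)
    ultimately show ?thesis
      using j \<open>j \<in> \<sigma>\<close> by (metis card.remove)
  qed
  ultimately show "\<exists>b. (\<forall>\<sigma>. b \<sigma> \<noteq> 0 \<longrightarrow> \<sigma> \<in> D \<and> card \<sigma> = Suc q) \<and> sd V b = c" by blast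
qed

text \<open>The part of a Koszul chain in multidegree \<open>u\<close>. The basis element of
  \<sigma> has multidegree \<open>chi \<sigma>\<close>, which its coefficient must complete to
  \<open>u\<close>; the guard excludes values produced by truncated subtraction.\<close>

definition slice :: "expo \<Rightarrow> (nat set \<Rightarrow> 'k::field mpoly) \<Rightarrow> nat set \<Rightarrow> 'k" where
  "slice u z \<sigma> = (if \<sigma> \<subseteq> ks u then lk (z \<sigma>) (u - chi \<sigma>) else 0)"

lemma lookup_sgn_times: "lk ((-1) ^ n * p) u = (-1) ^ n * lk (p :: 'k::field mpoly) u"
  by (induction n) auto

lemma lookup_ksgn_times: "lk (ksgn j \<tau> * p) u = ksgn j \<tau> * lk (p :: 'k::field mpoly) u"
  by (simp add: ksgn_def lookup_sgn_times)

text \<open>The Koszul differential preserves multidegrees, and within one multidegree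
  multiplication by a variable only relabels coefficients. So it becomes the simplicial
  boundary.\<close>

lemma slice_kd:
  fixes z :: "nat set \<Rightarrow> 'k::field mpoly"
  assumes V: "finite V" and supp: "\<And>\<sigma>. z \<sigma> \<noteq> 0 \<Longrightarrow> \<sigma> \<subseteq> V"
  shows "slice u (kdm V z) \<tau> = sd V (slice u z) \<tau>"
proof (cases "\<tau> \<subseteq> V \<and> \<tau> \<subseteq> ks u")
  case False
  have "kdm V z \<tau> = 0 \<or> \<not> \<tau> \<subseteq> ks u"
    using False supp by (intro disjCI kd_outside) blast
  moreover have "slice u z (insert j \<tau>) = 0" for j
  proof (cases "z (insert j \<tau>) = 0")
    case True
    then show ?thesis by (simp add: slice_def)
  next
    case F: False
    then have "\<not> insert j \<tau> \<subseteq> ks u" using False supp[OF F] by blast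
    then show ?thesis by (auto simp: slice_def)
  qed
  ultimately show ?thesis by (auto simp: slice_def kd_def)
next
  case True
  then have fin: "finite \<tau>" using V finite_subset by blast
  have "lk (ksgn j \<tau> * (mvar j * z (insert j \<tau>))) (u - chi \<tau>) = ksgn j \<tau> * (1 * slice u z (insert j \<tau>))"
    if j: "j \<in> V - \<tau>" for j
  proof -
    have "j \<in> ks (u - chi \<tau>) \<longleftrightarrow> j \<in> ks u"
      using j by (simp add: in_keys_iff lookup_minus lookup_chi[OF fin])
    moreover have "u - chi \<tau> - sing j 1 = u - chi (insert j \<tau>)"
      using j fin by (simp add: chi_insert diff_diff_add add.commute del: One_nat_def)
    ultimately show ?thesis
      using True by (auto simp: lookup_ksgn_times lookup_mvar_times slice_def simp del: One_nat_def)
  qed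
  then show ?thesis using True by (simp add: slice_def kd_def lookup_sum)
qed

lemma lookup_eq_slice: "finite \<sigma> \<Longrightarrow> lk (z \<sigma>) w = slice (w + chi \<sigma>) z \<sigma>"
  by (simp add: slice_def keys_add_expo keys_chi)

lemma slice_ext:
  assumes V: "finite V" and "\<And>\<sigma>. z \<sigma> \<noteq> 0 \<Longrightarrow> \<sigma> \<subseteq> V" "\<And>\<sigma>. y \<sigma> \<noteq> 0 \<Longrightarrow> \<sigma> \<subseteq> V"
    and "\<And>u \<sigma>. slice u z \<sigma> = slice u y \<sigma>"
  shows "z = y"
proof
  fix \<sigma> show "z \<sigma> = y \<sigma>"
  proof (cases "\<sigma> \<subseteq> V")
    case True
    then have "finite \<sigma>" using V finite_subset by blast
    then show ?thesis using assms(4) by (intro poly_mapping_eqI) (simp add: lookup_eq_slice)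
  qed (use assms in metis)
qed

text \<open>Solutions in the finitely many multidegrees of \<open>z\<close> are assembled into one
  chain. \<open>P\<close> carries membership of the coefficients in an ideal; the clause on slices
  says that no new multidegree appears, which later yields homogeneity.\<close>

lemma kdm_lift_slices:
  fixes z :: "nat set \<Rightarrow> 'k::field mpoly"
  assumes V: "finite V" and supp: "\<And>\<sigma>. z \<sigma> \<noteq> 0 \<Longrightarrow> \<sigma> \<subseteq> V"
    and ex: "\<And>u. (\<exists>\<sigma>. slice u z \<sigma> \<noteq> 0) \<Longrightarrow>
      \<exists>b. (\<forall>\<sigma>. b \<sigma> \<noteq> 0 \<longrightarrow> \<sigma> \<subseteq> V \<and> card \<sigma> = q \<and> \<sigma> \<subseteq> ks u \<and> P (u - chi \<sigma>)) \<and> sd V b = slice u z"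
  shows "\<exists>y. (\<forall>\<sigma>. y \<sigma> \<noteq> 0 \<longrightarrow> \<sigma> \<subseteq> V \<and> card \<sigma> = q) \<and>
    (\<forall>\<sigma>. \<forall>w\<in>ks (y \<sigma>). P w \<and> (\<exists>\<tau>. slice (w + chi \<sigma>) z \<tau> \<noteq> 0)) \<and> kdm V y = z"
proof -
  define U where "U = {u. \<exists>\<sigma>. slice u z \<sigma> \<noteq> 0}"
  obtain b where b: "\<And>u \<sigma>. u \<in> U \<Longrightarrow> b u \<sigma> \<noteq> 0 \<Longrightarrow> \<sigma> \<subseteq> V \<and> card \<sigma> = q \<and> \<sigma> \<subseteq> ks u \<and> P (u - chi \<sigma>)"
    and bz: "\<And>u. u \<in> U \<Longrightarrow> sd V (b u) = slice u z"
    using ex unfolding U_def mem_Collect_eq by metis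
  \<comment> \<open>Each multidegree of \<open>z\<close> comes from a term of one of its finitely
    many nonzero coefficients.\<close>
  have "U \<subseteq> (\<Union>\<sigma>\<in>Pow V. (\<lambda>w. w + chi \<sigma>) ` ks (z \<sigma>))"
  proof
    fix u assume "u \<in> U"
    then obtain \<sigma> where s: "slice u z \<sigma> \<noteq> 0" by (auto simp: U_def)
    then have su: "\<sigma> \<subseteq> ks u" "u - chi \<sigma> \<in> ks (z \<sigma>)"
      by (auto simp: slice_def in_keys_iff split: if_splits)
    then have "z \<sigma> \<noteq> 0" by auto
    then have "\<sigma> \<in> Pow V" using supp by blast
    moreover have "u = (u - chi \<sigma>) + chi \<sigma>"
      using su(1) finite_subset[OF su(1)] by (simp add: adds_minus' chi_adds_iff)
    ultimately show "u \<in> (\<Union>\<sigma>\<in>Pow V. (\<lambda>w. w + chi \<sigma>) ` ks (z \<sigma>))" using su(2) by blast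
  qed
  then have fU: "finite U" by (rule finite_subset) (use V in auto)
  define y where "y \<sigma> = (\<Sum>u\<in>U. sing (u - chi \<sigma>) (b u \<sigma>))" for \<sigma>
  have lk_y: "\<exists>u\<in>U. w = u - chi \<sigma> \<and> b u \<sigma> \<noteq> 0" if "w \<in> ks (y \<sigma>)" for w \<sigma>
    using that Poly_Mapping.keys_sum[of "\<lambda>u. sing (u - chi \<sigma>) (b u \<sigma>)" U] unfolding y_def by (auto split: if_splits)
  have y_supp: "\<sigma> \<subseteq> V \<and> card \<sigma> = q" if "y \<sigma> \<noteq> 0" for \<sigma>
  proof -
    have "ks (y \<sigma>) \<noteq> {}" using that by simp
    then obtain w where "w \<in> ks (y \<sigma>)" by blast
    then show ?thesis using lk_y b by blast
  qed
  have slice_y: "slice w y \<sigma> = (if w \<in> U then b w \<sigma> else 0)" for w \<sigma>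
  proof (cases "\<sigma> \<subseteq> V \<and> \<sigma> \<subseteq> ks w")
    case True
    then have fin: "finite \<sigma>" using V finite_subset by blast
    have "slice w y \<sigma> = (\<Sum>u\<in>U. if u - chi \<sigma> = w - chi \<sigma> then b u \<sigma> else 0)"
      using True by (simp add: slice_def y_def lookup_sum lookup_single when_def)
    also have "\<dots> = (\<Sum>u\<in>U. if u = w then b u \<sigma> else 0)"
    proof (rule sum.cong[OF refl])
      fix u assume u: "u \<in> U"
      \<comment> \<open>Truncated subtraction is injective here because \<open>chi \<sigma>\<close>
        divides both exponents.\<close>
      have "u = w" if "u - chi \<sigma> = w - chi \<sigma>" "b u \<sigma> \<noteq> 0"
      proof -
        have "chi \<sigma> adds u" "chi \<sigma> adds w" using b[OF u that(2)] True fin by (auto simp: chi_adds_iff)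
        then show ?thesis using that(1) by (metis adds_minus)
      qed
      then show "(if u - chi \<sigma> = w - chi \<sigma> then b u \<sigma> else 0) = (if u = w then b u \<sigma> else 0)"
        by auto
    qed
    also have "\<dots> = (if w \<in> U then b w \<sigma> else 0)" using fU by simp
    finally show ?thesis .
  next
    case False
    then have "slice w y \<sigma> = 0"
      using y_supp[of \<sigma>] by (cases "y \<sigma> = 0") (auto simp: slice_def)
    moreover have "w \<in> U \<Longrightarrow> b w \<sigma> = 0" using b[of w \<sigma>] False by blast
    ultimately show ?thesis by simp
  qed
  have "kdm V y = z"
  proof (rule slice_ext[OF V _ supp])
    fix \<sigma> assume "kdm V y \<sigma> \<noteq> 0"
    then show "\<sigma> \<subseteq> V" using kd_nonzero y_supp by blast
  next
    fix u \<sigma>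
    have "slice u (kdm V y) \<sigma> = sd V (slice u y) \<sigma>"
      by (rule slice_kd[OF V]) (use y_supp in blast)
    also have "slice u y = (if u \<in> U then b u else (\<lambda>_. 0))"
      by (auto simp: slice_y)
    also have "sd V \<dots> \<sigma> = slice u z \<sigma>"
      using bz[of u] by (auto simp: U_def)
    finally show "slice u (kdm V y) \<sigma> = slice u z \<sigma>" .
  qed
  moreover have "P w \<and> (\<exists>\<tau>. slice (w + chi \<sigma>) z \<tau> \<noteq> 0)" if "w \<in> ks (y \<sigma>)" for w \<sigma>
  proof -
    obtain u where u: "u \<in> U" "w = u - chi \<sigma>" "b u \<sigma> \<noteq> 0" using lk_y \<open>w \<in> ks (y \<sigma>)\<close> by blast
    have "chi \<sigma> adds u" using b[OF u(1,3)] V by (auto simp: chi_adds_iff finite_subset)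
    then have "w + chi \<sigma> = u" using u by (simp add: adds_minus')
    then show ?thesis using b[OF u(1,3)] u by (auto simp: U_def)
  qed
  ultimately show ?thesis using y_supp by blast
qed

text \<open>
  Koszul chains with coefficients in \<open>I\<close>, of homological degree \<open>q\<close> and internal degree \<open>j\<close>: the
  basis elements of the \<open>q\<close>-th module have degree \<open>q\<close>.
\<close>

definition KK :: "nat set \<Rightarrow> 'k::field mpoly set \<Rightarrow> nat \<Rightarrow> int \<Rightarrow> (nat set \<Rightarrow> 'k mpoly) set" where
  "KK V I q j = {z. (\<forall>\<sigma>. z \<sigma> \<noteq> 0 \<longrightarrow> \<sigma> \<subseteq> V \<and> card \<sigma> = q) \<and> (\<forall>\<sigma>. z \<sigma> \<in> I) \<and>
     (\<forall>\<sigma>. homogeneous (j - int q) (z \<sigma>))}"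

text \<open>In multidegree \<open>u\<close> the chains over the ideal are supported on the upper
  Koszul complex: those \<sigma> for which \<open>u - chi \<sigma>\<close> still lies above a
  generator. The hypothesis \<open>ac\<close> may use that \<open>z\<close> lives in multidegree
  \<open>u\<close>.\<close>

lemma KK_mideal_exact:
  fixes z :: "nat set \<Rightarrow> 'k::field mpoly"
  assumes V: "finite V" and z: "z \<in> KK V (mideal V U) q j" and cyc: "\<And>\<tau>. kdm V z \<tau> = 0"
    and ac: "\<And>u. int (tdeg u) = j \<Longrightarrow> ks u \<subseteq> V \<Longrightarrow> \<exists>\<sigma>. slice u z \<sigma> \<noteq> 0 \<Longrightarrow>
      acyclic_at TYPE('k) V {\<sigma>. \<sigma> \<subseteq> ks u \<and> (\<exists>g\<in>U. g adds u - chi \<sigma>)} q"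
  shows "\<exists>y\<in>KK V (mideal V U) (Suc q) j. kdm V y = z"
proof -
  have supp: "\<sigma> \<subseteq> V" "card \<sigma> = q" if "z \<sigma> \<noteq> 0" for \<sigma> using z that by (auto simp: KK_def)
  let ?P = "\<lambda>w. ks w \<subseteq> V \<and> (\<exists>g\<in>U. g adds w)"
  have slice: "int (tdeg u) = j \<and> ks u \<subseteq> V \<and> \<sigma> \<subseteq> ks u \<and> (\<exists>g\<in>U. g adds u - chi \<sigma>) \<and> card \<sigma> = q"
    if "slice u z \<sigma> \<noteq> 0" for u \<sigma>
  proof -
    have 1: "\<sigma> \<subseteq> ks u" "u - chi \<sigma> \<in> ks (z \<sigma>)"
      using that by (auto simp: slice_def in_keys_iff split: if_splits)
    then have "z \<sigma> \<noteq> 0" by auto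
    note s = supp[OF this]
    have fin: "finite \<sigma>" using s V finite_subset by blast
    then have u: "u = (u - chi \<sigma>) + chi \<sigma>" using 1 by (simp add: adds_minus' chi_adds_iff)
    have "int (tdeg (u - chi \<sigma>)) = j - int q" "ks (u - chi \<sigma>) \<subseteq> V" "\<exists>g\<in>U. g adds u - chi \<sigma>"
      using z 1 by (auto simp: KK_def homogeneous_iff mideal_def Pol_iff)
    moreover have "tdeg u = tdeg (u - chi \<sigma>) + q" "ks u = ks (u - chi \<sigma>) \<union> \<sigma>"
      by (subst u, simp add: tdeg_chi fin s) (subst u, simp add: keys_add_expo keys_chi fin)
    ultimately show ?thesis using 1 s by auto
  qed
  have "\<exists>y. (\<forall>\<sigma>. y \<sigma> \<noteq> 0 \<longrightarrow> \<sigma> \<subseteq> V \<and> card \<sigma> = Suc q) \<and>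
    (\<forall>\<sigma>. \<forall>w\<in>ks (y \<sigma>). ?P w \<and> (\<exists>\<tau>. slice (w + chi \<sigma>) z \<tau> \<noteq> 0)) \<and> kdm V y = z"
  proof (rule kdm_lift_slices[OF V supp(1)])
    fix u assume ex: "\<exists>\<sigma>. slice u z \<sigma> \<noteq> 0"
    let ?D = "{\<sigma>. \<sigma> \<subseteq> ks u \<and> (\<exists>g\<in>U. g adds u - chi \<sigma>)}"
    have u: "int (tdeg u) = j" "ks u \<subseteq> V" using ex slice by blast+
    have "sd V (slice u z) \<tau> = 0" for \<tau>
      using slice_kd[of V z u \<tau>, OF V supp(1)] unfolding slice_def[of u "kdm V z"] cyc by (simp split: if_splits)
    then obtain b where "\<And>\<sigma>. b \<sigma> \<noteq> 0 \<Longrightarrow> \<sigma> \<in> ?D \<and> card \<sigma> = Suc q" "sd V b = slice u z"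
      using acyclic_atD[OF ac[OF u ex], of "slice u z"] slice by blast
    then show "\<exists>b. (\<forall>\<sigma>. b \<sigma> \<noteq> 0 \<longrightarrow> \<sigma> \<subseteq> V \<and> card \<sigma> = Suc q \<and> \<sigma> \<subseteq> ks u \<and> ?P (u - chi \<sigma>)) \<and> sd V b = slice u z"
      using u(2) keys_minus_subset[of u] by (intro exI[of _ b]) blast
  qed
  then obtain y where y: "\<And>\<sigma>. y \<sigma> \<noteq> 0 \<Longrightarrow> \<sigma> \<subseteq> V \<and> card \<sigma> = Suc q"
    "\<And>\<sigma> w. w \<in> ks (y \<sigma>) \<Longrightarrow> ?P w \<and> (\<exists>\<tau>. slice (w + chi \<sigma>) z \<tau> \<noteq> 0)" "kdm V y = z"
    by blast
  have "homogeneous (j - int (Suc q)) (y \<sigma>)" for \<sigma>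
    unfolding homogeneous_iff
  proof
    fix w assume w: "w \<in> ks (y \<sigma>)"
    then have "y \<sigma> \<noteq> 0" by auto
    then have s: "\<sigma> \<subseteq> V" "card \<sigma> = Suc q" using y(1) by auto
    then have "finite \<sigma>" using V finite_subset by blast
    then show "int (tdeg w) = j - int (Suc q)"
      using y(2)[OF w] slice s by (fastforce simp: tdeg_chi)
  qed
  moreover have "y \<sigma> \<in> mideal V U" for \<sigma> using y(2) by (auto simp: mideal_def Pol_iff)
  ultimately have "y \<in> KK V (mideal V U) (Suc q) j" using y(1) by (simp add: KK_def)
  then show ?thesis using y(3) by blast
qed

lemma Pol_eq_mideal: "Pol V = mideal V {0}"
  by (auto simp: mideal_def)

text \<open>The polynomial ring is the monomial ideal with generator exponent 0, so its upper Koszul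
  complexes are full simplices, cones unless \<open>u = 0\<close>. The condition on \<open>q\<close>
  excludes that case, where the constants contribute homology.\<close>

lemma KK_Pol_exact:
  fixes z :: "nat set \<Rightarrow> 'k::field mpoly"
  assumes V: "finite V" and z: "z \<in> KK V (Pol V) q j" and cyc: "\<And>\<tau>. kdm V z \<tau> = 0"
    and q: "q > 0 \<or> lk (z {}) 0 = 0"
  shows "\<exists>y\<in>KK V (Pol V) (Suc q) j. kdm V y = z"
  unfolding Pol_eq_mideal
proof (rule KK_mideal_exact[OF V z[unfolded Pol_eq_mideal] cyc])
  fix u assume u: "ks u \<subseteq> V" "\<exists>\<sigma>. slice u z \<sigma> \<noteq> 0"
  then obtain \<sigma> where s: "slice u z \<sigma> \<noteq> 0" by blast
  then have "z \<sigma> \<noteq> 0" by (auto simp: slice_def split: if_splits)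
  then have \<sigma>: "\<sigma> \<subseteq> V" "card \<sigma> = q" "finite \<sigma>" using z V finite_subset by (auto simp: KK_def)
  have "ks u \<noteq> {}"
  proof
    assume "ks u = {}"
    then have "u = 0" "\<sigma> = {}" using s by (auto simp: slice_def split: if_splits)
    then show False using s q \<sigma> by (auto simp: slice_def chi_def)
  qed
  then obtain i where "i \<in> ks u" by blast
  then show "acyclic_at TYPE('k) V {\<sigma>. \<sigma> \<subseteq> ks u \<and> (\<exists>g\<in>{0}. g adds u - chi \<sigma>)} q"
    using u V by (intro acyclic_at_cone[of _ _ i]) auto
qed

section \<open>Dimensions of subquotients\<close>

text \<open>
  The dimension of \<open>Z / B\<close>, as a relation because \<open>dim Z - dim B\<close> makes no sense if \<open>Z\<close> and \<open>B\<close>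
  have infinite dimension.
\<close>

definition qdim :: "('k::field \<Rightarrow> 'a \<Rightarrow> 'a::ab_group_add) \<Rightarrow> 'a set \<Rightarrow> 'a set \<Rightarrow> nat \<Rightarrow> bool" where
  "qdim s Z B n \<longleftrightarrow> (\<exists>Xs. (\<forall>i<n. Xs i \<in> Z) \<and> (\<forall>z\<in>Z. \<exists>a. z - (\<Sum>i<n. s (a i) (Xs i)) \<in> B) \<and>
     (\<forall>a. (\<Sum>i<n. s (a i) (Xs i)) \<in> B \<longrightarrow> (\<forall>i<n. a i = 0)))"

text \<open>An isomorphism of subquotients \<open>Z / B\<close> and \<open>Z' / B'\<close>, given by a linear relation.\<close>

definition siso :: "('k::field \<Rightarrow> 'a \<Rightarrow> 'a::ab_group_add) \<Rightarrow> 'a set \<Rightarrow> 'a set \<Rightarrow>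
    ('k \<Rightarrow> 'b \<Rightarrow> 'b::ab_group_add) \<Rightarrow> 'b set \<Rightarrow> 'b set \<Rightarrow> bool" where
  "siso s Z B s' Z' B' \<longleftrightarrow> (\<exists>R. (\<forall>x y. R x y \<longrightarrow> x \<in> Z \<and> y \<in> Z' \<and> (x \<in> B \<longleftrightarrow> y \<in> B')) \<and>
     (\<forall>x\<in>Z. \<exists>y. R x y) \<and> (\<forall>y\<in>Z'. \<exists>x. R x y) \<and> R 0 0 \<and>
     (\<forall>x y x' y'. R x y \<longrightarrow> R x' y' \<longrightarrow> R (x - x') (y - y')) \<and>
     (\<forall>c x y. R x y \<longrightarrow> R (s c x) (s' c y)))"

lemma sisoI:
  assumes "\<And>x y. R x y \<Longrightarrow> x \<in> Z" "\<And>x y. R x y \<Longrightarrow> y \<in> Z'"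
    and "\<And>x y. R x y \<Longrightarrow> x \<in> B \<Longrightarrow> y \<in> B'" "\<And>x y. R x y \<Longrightarrow> y \<in> B' \<Longrightarrow> x \<in> B"
    and "\<And>x. x \<in> Z \<Longrightarrow> \<exists>y. R x y" "\<And>y. y \<in> Z' \<Longrightarrow> \<exists>x. R x y" "R 0 0"
    and "\<And>x y x' y'. R x y \<Longrightarrow> R x' y' \<Longrightarrow> R (x - x') (y - y')"
    and "\<And>c x y. R x y \<Longrightarrow> R (s c x) (s' c y)"
  shows "siso s Z B s' Z' B'"
  unfolding siso_def using assms by (intro exI[of _ R] conjI allI impI ballI iffI) assumption+

lemma sisoE:
  assumes "siso s Z B s' Z' B'"
  obtains R where "\<forall>x y. R x y \<longrightarrow> x \<in> Z \<and> y \<in> Z' \<and> (x \<in> B \<longleftrightarrow> y \<in> B')"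
    "\<forall>x\<in>Z. \<exists>y. R x y" "\<forall>y\<in>Z'. \<exists>x. R x y" "R 0 0"
    "\<forall>x y x' y'. R x y \<longrightarrow> R x' y' \<longrightarrow> R (x - x') (y - y')"
    "\<forall>c x y. R x y \<longrightarrow> R (s c x) (s' c y)"
  using assms unfolding siso_def by (elim exE conjE) (rule that)

lemma siso_sym:
  assumes "siso s Z B s' Z' B'"
  shows "siso s' Z' B' s Z B"
proof -
  obtain R where R: "\<forall>x y. R x y \<longrightarrow> x \<in> Z \<and> y \<in> Z' \<and> (x \<in> B \<longleftrightarrow> y \<in> B')"
    "\<forall>x\<in>Z. \<exists>y. R x y" "\<forall>y\<in>Z'. \<exists>x. R x y" "R 0 0"
    "\<forall>x y x' y'. R x y \<longrightarrow> R x' y' \<longrightarrow> R (x - x') (y - y')"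
    "\<forall>c x y. R x y \<longrightarrow> R (s c x) (s' c y)"
    by (rule sisoE[OF assms])
  show ?thesis
    by (rule sisoI[where R = "\<lambda>x y. R y x"]) (use R in blast)+
qed

text \<open>Linear combinations of related elements are related, so any choice of partners for a
  basis modulo \<open>B\<close> is a basis modulo \<open>B'\<close>.\<close>

lemma siso_qdim:
  assumes "siso s Z B s' Z' B'" "qdim s Z B n"
  shows "qdim s' Z' B' n"
proof -
  obtain R where R0: "\<forall>x y. R x y \<longrightarrow> x \<in> Z \<and> y \<in> Z' \<and> (x \<in> B \<longleftrightarrow> y \<in> B')"
    "\<forall>x\<in>Z. \<exists>y. R x y" "\<forall>y\<in>Z'. \<exists>x. R x y" "R 0 0"
    "\<forall>x y x' y'. R x y \<longrightarrow> R x' y' \<longrightarrow> R (x - x') (y - y')"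
    "\<forall>c x y. R x y \<longrightarrow> R (s c x) (s' c y)"
    by (rule sisoE[OF assms(1)])
  note R = R0[rule_format]
  obtain Xs where Xs: "\<And>i. i < n \<Longrightarrow> Xs i \<in> Z" "\<And>z. z \<in> Z \<Longrightarrow> \<exists>a. z - (\<Sum>i<n. s (a i) (Xs i)) \<in> B"
    "\<And>a. (\<Sum>i<n. s (a i) (Xs i)) \<in> B \<Longrightarrow> \<forall>i<n. a i = 0"
    using assms(2) unfolding qdim_def by blast
  have add: "R (x + x') (y + y')" if "R x y" "R x' y'" for x y x' y'
    using R(5)[OF that(1) R(5)[OF R(4) that(2)]] by simp
  have "\<forall>i. \<exists>y. i < n \<longrightarrow> R (Xs i) y" using Xs(1) R(2) by blast
  then obtain Y where Y: "\<And>i. i < n \<Longrightarrow> R (Xs i) (Y i)" by metis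
  have sum: "R (\<Sum>i<m. s (a i) (Xs i)) (\<Sum>i<m. s' (a i) (Y i))" if "m \<le> n" for a m
    using that by (induction m) (auto simp: R(4) intro!: add R(6) Y)
  show ?thesis
    unfolding qdim_def
  proof (intro exI[of _ Y] conjI allI impI ballI)
    fix i assume "i < n" then show "Y i \<in> Z'" using Y R(1) by blast
  next
    fix z assume "z \<in> Z'"
    then obtain x where x: "R x z" using R(3) by blast
    then obtain a where "x - (\<Sum>i<n. s (a i) (Xs i)) \<in> B" using R(1) Xs(2) by blast
    then show "\<exists>a. z - (\<Sum>i<n. s' (a i) (Y i)) \<in> B'"
      using R(1)[OF R(5)[OF x sum[OF order_refl]]] by blast
  next
    fix a i assume "(\<Sum>i<n. s' (a i) (Y i)) \<in> B'" "i < n"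
    then show "a i = 0" using Xs(3) R(1)[OF sum[OF order_refl]] by blast
  qed
qed

lemma siso_trans:
  assumes "siso s1 Z1 B1 s2 Z2 B2" "siso s2 Z2 B2 s3 Z3 B3"
  shows "siso s1 Z1 B1 s3 Z3 B3"
proof -
  obtain R where R0: "\<forall>x y. R x y \<longrightarrow> x \<in> Z1 \<and> y \<in> Z2 \<and> (x \<in> B1 \<longleftrightarrow> y \<in> B2)"
    "\<forall>x\<in>Z1. \<exists>y. R x y" "\<forall>y\<in>Z2. \<exists>x. R x y" "R 0 0"
    "\<forall>x y x' y'. R x y \<longrightarrow> R x' y' \<longrightarrow> R (x - x') (y - y')"
    "\<forall>c x y. R x y \<longrightarrow> R (s1 c x) (s2 c y)"
    by (rule sisoE[OF assms(1)])
  note R = R0[rule_format]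
  obtain S where S0: "\<forall>x y. S x y \<longrightarrow> x \<in> Z2 \<and> y \<in> Z3 \<and> (x \<in> B2 \<longleftrightarrow> y \<in> B3)"
    "\<forall>x\<in>Z2. \<exists>y. S x y" "\<forall>y\<in>Z3. \<exists>x. S x y" "S 0 0"
    "\<forall>x y x' y'. S x y \<longrightarrow> S x' y' \<longrightarrow> S (x - x') (y - y')"
    "\<forall>c x y. S x y \<longrightarrow> S (s2 c x) (s3 c y)"
    by (rule sisoE[OF assms(2)])
  note S = S0[rule_format]
  show ?thesis
    by (rule sisoI[where R = "\<lambda>x y. \<exists>t. R x t \<and> S t y"]) (use R S in meson)+
qed

lemma sum_lessThan_add: "(\<Sum>i<m + n :: nat. f i) = (\<Sum>i<m. f i) + (\<Sum>i<n. f (m + i) :: 'a::comm_monoid_add)"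
  by (induction n) (auto simp: add.assoc)

context vector_space
begin

lemma qdim_trans:
  assumes "qdim scale Z' B m" "qdim scale Z Z' n" and Z: "subspace Z'" "Z' \<subseteq> Z" "B \<subseteq> Z'"
  shows "qdim scale Z B (m + n)"
proof -
  obtain Xs where Xs: "\<And>i. i < m \<Longrightarrow> Xs i \<in> Z'" "\<And>z. z \<in> Z' \<Longrightarrow> \<exists>a. z - (\<Sum>i<m. scale (a i) (Xs i)) \<in> B"
    "\<And>a. (\<Sum>i<m. scale (a i) (Xs i)) \<in> B \<Longrightarrow> \<forall>i<m. a i = 0"
    using assms(1) unfolding qdim_def by blast
  obtain Y where Y: "\<And>i. i < n \<Longrightarrow> Y i \<in> Z" "\<And>z. z \<in> Z \<Longrightarrow> \<exists>a. z - (\<Sum>i<n. scale (a i) (Y i)) \<in> Z'"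
    "\<And>a. (\<Sum>i<n. scale (a i) (Y i)) \<in> Z' \<Longrightarrow> \<forall>i<n. a i = 0"
    using assms(2) unfolding qdim_def by blast
  define W where "W i = (if i < m then Xs i else Y (i - m))" for i
  have sum: "(\<Sum>i<m + n. scale (a i) (W i)) = (\<Sum>i<m. scale (a i) (Xs i)) + (\<Sum>i<n. scale (a (m + i)) (Y i))" for a
    by (simp add: sum_lessThan_add W_def)
  show ?thesis
    unfolding qdim_def
  proof (intro exI[of _ W] conjI allI impI ballI)
    fix i assume "i < m + n" then show "W i \<in> Z" using Xs(1) Y(1) Z by (auto simp: W_def)
  next
    fix z assume "z \<in> Z"
    then obtain b where b: "z - (\<Sum>i<n. scale (b i) (Y i)) \<in> Z'" using Y(2) by blast
    then obtain a where a: "z - (\<Sum>i<n. scale (b i) (Y i)) - (\<Sum>i<m. scale (a i) (Xs i)) \<in> B"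
      using Xs(2) by blast
    let ?c = "\<lambda>i. if i < m then a i else b (i - m)"
    have "(\<Sum>i<m + n. scale (?c i) (W i)) = (\<Sum>i<m. scale (a i) (Xs i)) + (\<Sum>i<n. scale (b i) (Y i))"
      unfolding sum by simp
    then have "z - (\<Sum>i<m + n. scale (?c i) (W i)) \<in> B" using a by (simp add: algebra_simps)
    then show "\<exists>a. z - (\<Sum>i<m + n. scale (a i) (W i)) \<in> B" by (rule exI[of _ ?c])
  next
    fix a i assume a: "(\<Sum>i<m + n. scale (a i) (W i)) \<in> B" and i: "i < m + n"
    have "(\<Sum>i<m. scale (a i) (Xs i)) \<in> Z'"
      using Xs(1) Z(1) by (intro subspace_sum subspace_scale) auto
    moreover have "(\<Sum>i<m + n. scale (a i) (W i)) \<in> Z'" using a Z by blast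
    ultimately have "(\<Sum>i<n. scale (a (m + i)) (Y i)) \<in> Z'"
      unfolding sum using subspace_diff[OF Z(1)] by (metis add_diff_cancel_left')
    then have 1: "a (m + i) = 0" if "i < n" for i using Y(3)[of "\<lambda>i. a (m + i)"] that by blast
    then have "(\<Sum>i<m. scale (a i) (Xs i)) \<in> B" using a unfolding sum by simp
    then have "a i = 0" if "i < m" for i using Xs(3) that by blast
    then show "a i = 0" using 1[of "i - m"] i by (cases "i < m") auto
  qed
qed

text \<open>The last hypothesis says that addition induces an injection of the direct sum of the two
  quotients modulo \<open>B\<close>. The spaces \<open>Z1\<close> and \<open>Z2\<close> themselves
  may intersect.\<close>

lemma qdim_sum:
  assumes "qdim scale Z1 B1 m" "qdim scale Z2 B2 n" and Z: "subspace Z1" "subspace Z2"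
    and B: "\<And>a b. a \<in> Z1 \<Longrightarrow> b \<in> Z2 \<Longrightarrow> a + b \<in> B \<longleftrightarrow> a \<in> B1 \<and> b \<in> B2"
  shows "qdim scale {a + b | a b. a \<in> Z1 \<and> b \<in> Z2} B (m + n)"
proof -
  obtain Xs where Xs: "\<And>i. i < m \<Longrightarrow> Xs i \<in> Z1" "\<And>z. z \<in> Z1 \<Longrightarrow> \<exists>a. z - (\<Sum>i<m. scale (a i) (Xs i)) \<in> B1"
    "\<And>a. (\<Sum>i<m. scale (a i) (Xs i)) \<in> B1 \<Longrightarrow> \<forall>i<m. a i = 0"
    using assms(1) unfolding qdim_def by blast
  obtain Y where Y: "\<And>i. i < n \<Longrightarrow> Y i \<in> Z2" "\<And>z. z \<in> Z2 \<Longrightarrow> \<exists>a. z - (\<Sum>i<n. scale (a i) (Y i)) \<in> B2"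
    "\<And>a. (\<Sum>i<n. scale (a i) (Y i)) \<in> B2 \<Longrightarrow> \<forall>i<n. a i = 0"
    using assms(2) unfolding qdim_def by blast
  define W where "W i = (if i < m then Xs i else Y (i - m))" for i
  have sum: "(\<Sum>i<m + n. scale (a i) (W i)) = (\<Sum>i<m. scale (a i) (Xs i)) + (\<Sum>i<n. scale (a (m + i)) (Y i))" for a
    by (simp add: sum_lessThan_add W_def)
  have in1: "(\<Sum>i<m. scale (a i) (Xs i)) \<in> Z1" for a
    using Xs(1) Z(1) by (intro subspace_sum subspace_scale) auto
  have in2: "(\<Sum>i<n. scale (a i) (Y i)) \<in> Z2" for a
    using Y(1) Z(2) by (intro subspace_sum subspace_scale) auto
  show ?thesis
    unfolding qdim_def
  proof (intro exI[of _ W] conjI allI impI ballI)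
    fix i assume "i < m + n"
    then show "W i \<in> {a + b | a b. a \<in> Z1 \<and> b \<in> Z2}"
      using Xs(1)[of i] Y(1)[of "i - m"] subspace_0[OF Z(1)] subspace_0[OF Z(2)]
      unfolding W_def by (cases "i < m") (force intro: exI[of _ 0])+
  next
    fix z assume "z \<in> {a + b | a b. a \<in> Z1 \<and> b \<in> Z2}"
    then obtain u w where z: "z = u + w" "u \<in> Z1" "w \<in> Z2" by blast
    then obtain a b where ab: "u - (\<Sum>i<m. scale (a i) (Xs i)) \<in> B1" "w - (\<Sum>i<n. scale (b i) (Y i)) \<in> B2"
      using Xs(2) Y(2) by blast
    let ?c = "\<lambda>i. if i < m then a i else b (i - m)"
    have "(\<Sum>i<m + n. scale (?c i) (W i)) = (\<Sum>i<m. scale (a i) (Xs i)) + (\<Sum>i<n. scale (b i) (Y i))"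
      unfolding sum by simp
    then have "z - (\<Sum>i<m + n. scale (?c i) (W i)) =
        (u - (\<Sum>i<m. scale (a i) (Xs i))) + (w - (\<Sum>i<n. scale (b i) (Y i)))"
      using z by (simp add: algebra_simps)
    moreover have "\<dots> \<in> B"
      using B ab z in1 in2 Z by (simp add: subspace_diff)
    ultimately have "z - (\<Sum>i<m + n. scale (?c i) (W i)) \<in> B" by simp
    then show "\<exists>a. z - (\<Sum>i<m + n. scale (a i) (W i)) \<in> B" by (rule exI[of _ ?c])
  next
    fix a i assume a: "(\<Sum>i<m + n. scale (a i) (W i)) \<in> B" and i: "i < m + n"
    then have "(\<Sum>i<m. scale (a i) (Xs i)) \<in> B1" "(\<Sum>i<n. scale (a (m + i)) (Y i)) \<in> B2"
      using B[OF in1[of a] in2[of "\<lambda>i. a (m + i)"]] unfolding sum by simp_all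
    then show "a i = 0" using Xs(3)[of a] Y(3)[of "\<lambda>i. a (m + i)"] i
      by (cases "i < m") (simp, metis add_diff_inverse_nat nat_add_left_cancel_less)
  qed
qed

text \<open>A basis of \<open>B\<close> is extended by one vector at a time; a relation expressing
  the new vector by the earlier ones would contradict independence modulo \<open>B\<close>.\<close>

lemma independent_mod:
  assumes B: "subspace B" and b: "finite b" "independent b" "span b = B"
    and ind: "\<And>a. (\<Sum>i<n. scale (a i) (Xs i)) \<in> B \<Longrightarrow> \<forall>i<n. a i = 0"
  shows "\<exists>c. finite c \<and> independent c \<and> card c = n + card b \<and>
    span c = {(\<Sum>i<n. scale (a i) (Xs i)) + \<beta> | a \<beta>. \<beta> \<in> B}"
  using ind
proof (induction n)
  case 0
  then show ?case using b by (intro exI[of _ b]) auto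
next
  case (Suc n)
  have ext: "(\<Sum>i<n. scale (a i) (Xs i)) = (\<Sum>i<Suc n. scale (if i < n then a i else 0) (Xs i))" for a
    by simp
  have "\<forall>i<n. a i = 0" if "(\<Sum>i<n. scale (a i) (Xs i)) \<in> B" for a
    using Suc.prems[of "\<lambda>i. if i < n then a i else 0"] that unfolding ext by (auto dest: less_SucI)
  from Suc.IH[OF this] obtain c where c: "finite c" "independent c" "card c = n + card b"
    "span c = {(\<Sum>i<n. scale (a i) (Xs i)) + \<beta> | a \<beta>. \<beta> \<in> B}" by blast
  have Xs_n: "Xs n \<notin> span c"
  proof
    assume "Xs n \<in> span c"
    then obtain a \<beta> where "Xs n = (\<Sum>i<n. scale (a i) (Xs i)) + \<beta>" "\<beta> \<in> B" using c by blast
    \<comment> \<open>Coefficient 1 at the last index turns membership in the span into a nontrivial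
      relation modulo \<open>B\<close>.\<close>
    then have "(\<Sum>i<Suc n. scale (if i < n then - a i else 1) (Xs i)) = \<beta>"
      by (simp add: sum_negf)
    then show False using Suc.prems[of "\<lambda>i. if i < n then - a i else 1"] \<open>\<beta> \<in> B\<close> by auto
  qed
  then have "Xs n \<notin> c" using span_base by blast
  then have "finite (insert (Xs n) c)" "independent (insert (Xs n) c)" "card (insert (Xs n) c) = Suc n + card b"
    using c independent_insertI[OF Xs_n c(2)] by simp_all
  moreover have "span (insert (Xs n) c) = {(\<Sum>i<Suc n. scale (a i) (Xs i)) + \<beta> | a \<beta>. \<beta> \<in> B}"
  proof (intro equalityI subsetI)
    fix x assume "x \<in> span (insert (Xs n) c)"
    then obtain k where "x - scale k (Xs n) \<in> span c" by (auto simp: span_insert)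
    then obtain a \<beta> where "x - scale k (Xs n) = (\<Sum>i<n. scale (a i) (Xs i)) + \<beta>" "\<beta> \<in> B" using c by blast
    then have "x = (\<Sum>i<Suc n. scale (if i < n then a i else k) (Xs i)) + \<beta>"
      by (simp add: algebra_simps)
    then show "x \<in> {(\<Sum>i<Suc n. scale (a i) (Xs i)) + \<beta> | a \<beta>. \<beta> \<in> B}" using \<open>\<beta> \<in> B\<close>
      by (intro CollectI exI[of _ "\<lambda>i. if i < n then a i else k"] exI[of _ \<beta>]) simp
  next
    fix x assume "x \<in> {(\<Sum>i<Suc n. scale (a i) (Xs i)) + \<beta> | a \<beta>. \<beta> \<in> B}"
    then obtain a \<beta> where x: "x = (\<Sum>i<Suc n. scale (a i) (Xs i)) + \<beta>" "\<beta> \<in> B" by blast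
    then have "x - scale (a n) (Xs n) = (\<Sum>i<n. scale (a i) (Xs i)) + \<beta>" by simp
    then have "x - scale (a n) (Xs n) \<in> span c" using c x(2) by blast
    then show "x \<in> span (insert (Xs n) c)" unfolding span_insert by blast
  qed
  ultimately show ?case by blast
qed

lemma qdim_unique:
  assumes Z: "subspace Z" "Z \<subseteq> span S" "finite S" and B: "subspace B" "B \<subseteq> Z" and q: "qdim scale Z B n"
  shows "n = dim Z - dim B"
proof -
  obtain Xs where Xs: "\<And>i. i < n \<Longrightarrow> Xs i \<in> Z" "\<And>z. z \<in> Z \<Longrightarrow> \<exists>a. z - (\<Sum>i<n. scale (a i) (Xs i)) \<in> B"
    "\<And>a. (\<Sum>i<n. scale (a i) (Xs i)) \<in> B \<Longrightarrow> \<forall>i<n. a i = 0"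
    using q unfolding qdim_def by blast
  obtain b where b: "b \<subseteq> B" "independent b" "B \<subseteq> span b" "card b = dim B" by (rule basis_exists)
  have fb: "finite b" using independent_span_bound[of S b] Z B b by auto
  have sb: "span b = B" using b B span_minimal by blast
  obtain c where c: "finite c" "independent c" "card c = n + card b"
    "span c = {(\<Sum>i<n. scale (a i) (Xs i)) + \<beta> | a \<beta>. \<beta> \<in> B}"
    using independent_mod[where B = B and b = b and n = n and Xs = Xs, OF B(1) fb b(2) sb Xs(3)] by blast
  have "span c = Z"
  proof (intro equalityI subsetI)
    fix x assume "x \<in> span c"
    then obtain a \<beta> where "x = (\<Sum>i<n. scale (a i) (Xs i)) + \<beta>" "\<beta> \<in> B" using c by blast
    moreover have "(\<Sum>i<n. scale (a i) (Xs i)) \<in> Z"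
      using Xs(1) Z(1) by (intro subspace_sum subspace_scale) auto
    ultimately show "x \<in> Z" using Z(1) B(2) subspace_add by blast
  next
    fix x assume "x \<in> Z"
    then obtain a where "x - (\<Sum>i<n. scale (a i) (Xs i)) \<in> B" using Xs(2) by blast
    moreover have "x = (\<Sum>i<n. scale (a i) (Xs i)) + (x - (\<Sum>i<n. scale (a i) (Xs i)))" by simp
    ultimately show "x \<in> span c" using c by blast
  qed
  moreover have "span Z = Z" using Z(1) by (rule span_eq_iff[THEN iffD2])
  ultimately have "dim Z = card c" by (intro dim_eq_card[OF _ c(2)]) (simp only:)
  then show ?thesis using c b by simp
qed

text \<open>Families in \<open>Z\<close> independent modulo \<open>B\<close> have length at most
  \<open>card S\<close>. A longest one generates \<open>Z\<close> modulo \<open>B\<close>, and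
  uniqueness computes its length.\<close>

lemma qdim_dim:
  assumes Z: "subspace Z" "Z \<subseteq> span S" "finite S" and B: "subspace B" "B \<subseteq> Z"
  shows "qdim scale Z B (dim Z - dim B)"
proof -
  obtain b where b: "b \<subseteq> B" "independent b" "B \<subseteq> span b" "card b = dim B" by (rule basis_exists)
  have fb: "finite b" using independent_span_bound[of S b] Z B b by auto
  have sb: "span b = B" using b B span_minimal by blast
  define indep :: "nat \<Rightarrow> bool" where "indep n \<longleftrightarrow> (\<exists>Xs. (\<forall>i<n. Xs i \<in> Z) \<and> (\<forall>a. (\<Sum>i<n. scale (a i) (Xs i)) \<in> B \<longrightarrow> (\<forall>i<n. a i = 0)))" for n
  have bound: "n \<le> card S" if n: "indep n" for n
  proof -
    obtain Xs where Xs: "\<And>i. i < n \<Longrightarrow> Xs i \<in> Z"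
      "\<And>a. (\<Sum>i<n. scale (a i) (Xs i)) \<in> B \<Longrightarrow> \<forall>i<n. a i = 0"
      using n unfolding indep_def by blast
    obtain c where c: "finite c" "independent c" "card c = n + card b"
      "span c = {(\<Sum>i<n. scale (a i) (Xs i)) + \<beta> | a \<beta>. \<beta> \<in> B}"
      using independent_mod[where B = B and b = b and n = n and Xs = Xs, OF B(1) fb b(2) sb Xs(2)] by blast
    have "span c \<subseteq> Z"
    proof
      fix x assume "x \<in> span c"
      then obtain a \<beta> where "x = (\<Sum>i<n. scale (a i) (Xs i)) + \<beta>" "\<beta> \<in> B" using c by blast
      moreover have "(\<Sum>i<n. scale (a i) (Xs i)) \<in> Z"
        using Xs(1) Z(1) by (intro subspace_sum subspace_scale) auto
      ultimately show "x \<in> Z" using Z(1) B(2) subspace_add by blast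
    qed
    then have "c \<subseteq> span S" using Z(2) span_base by blast
    then show ?thesis using independent_span_bound[OF Z(3) c(2)] c(3) by simp
  qed
  have "indep 0" by (auto simp: indep_def)
  then obtain n where n: "indep n" "\<And>m. indep m \<Longrightarrow> m \<le> n"
    using bound Nat.ex_has_greatest_nat[of indep 0 "card S"] by blast
  then obtain Xs where Xs: "\<And>i. i < n \<Longrightarrow> Xs i \<in> Z"
    "\<And>a. (\<Sum>i<n. scale (a i) (Xs i)) \<in> B \<Longrightarrow> \<forall>i<n. a i = 0"
    unfolding indep_def by blast
  have "\<exists>a. z - (\<Sum>i<n. scale (a i) (Xs i)) \<in> B" if z: "z \<in> Z" for z
  proof (rule ccontr)
    assume no: "\<nexists>a. z - (\<Sum>i<n. scale (a i) (Xs i)) \<in> B"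
    define Y where "Y i = (if i < n then Xs i else z)" for i
    have sum: "(\<Sum>i<Suc n. scale (a i) (Y i)) = (\<Sum>i<n. scale (a i) (Xs i)) + scale (a n) z" for a
      by (simp add: Y_def)
    have "indep (Suc n)"
      unfolding indep_def
    proof (intro exI[of _ Y] conjI allI impI)
      fix i assume "i < Suc n" then show "Y i \<in> Z" using Xs(1) z by (auto simp: Y_def)
    next
      fix a i assume a: "(\<Sum>i<Suc n. scale (a i) (Y i)) \<in> B" and i: "i < Suc n"
      have an: "a n = 0"
      proof (rule ccontr)
        assume 0: "a n \<noteq> 0"
        have "scale (1 / a n) (\<Sum>i<Suc n. scale (a i) (Y i)) \<in> B" using a B subspace_scale by blast
        also have "scale (1 / a n) (\<Sum>i<Suc n. scale (a i) (Y i)) = z - (\<Sum>i<n. scale (- a i / a n) (Xs i))"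
          using 0 unfolding sum by (simp add: scale_right_distrib scale_sum_right sum_negf)
        finally show False using no[unfolded not_ex, rule_format, of "\<lambda>i. - a i / a n"] by simp
      qed
      then have "(\<Sum>i<n. scale (a i) (Xs i)) \<in> B" using a unfolding sum by simp
      then show "a i = 0" using Xs(2)[of a] an i less_Suc_eq by blast
    qed
    then show False using n(2) by fastforce
  qed
  then have q: "qdim scale Z B n" unfolding qdim_def using Xs by blast
  then show ?thesis using qdim_unique[OF assms q] by simp
qed

end

section \<open>Betti numbers as Koszul homology\<close>

definition fscale :: "'k::field \<Rightarrow> ('a \<Rightarrow> 'k mpoly) \<Rightarrow> 'a \<Rightarrow> 'k mpoly" where
  "fscale c z = (\<lambda>\<sigma>. sing 0 c * z \<sigma>)"

definition vscale :: "'k::field \<Rightarrow> ('b \<Rightarrow> 'a \<Rightarrow> 'k mpoly) \<Rightarrow> 'b \<Rightarrow> 'a \<Rightarrow> 'k mpoly" where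
  "vscale c z = (\<lambda>b \<sigma>. sing 0 c * z b \<sigma>)"

lemma vector_space_fscale: "vector_space (fscale :: 'k::field \<Rightarrow> ('a \<Rightarrow> 'k mpoly) \<Rightarrow> _)"
  by unfold_locales
    (auto simp: fscale_def fun_eq_iff algebra_simps single_add mult.assoc[symmetric] mult_single)

section \<open>Submodules of free modules and Koszul chains over them\<close>

definition submod :: "nat set \<Rightarrow> nat \<Rightarrow> (nat \<Rightarrow> 'k::field mpoly) set \<Rightarrow> bool" where
  "submod V m M \<longleftrightarrow> M \<subseteq> free_module V m \<and> 0 \<in> M \<and> (\<forall>f\<in>M. \<forall>g\<in>M. f + g \<in> M) \<and>
     (\<forall>f\<in>M. \<forall>a\<in>Pol V. (\<lambda>b. a * f b) \<in> M)"

lemma submodD: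
  assumes "submod V m M"
  shows "M \<subseteq> free_module V m" "0 \<in> M" "\<And>f g. f \<in> M \<Longrightarrow> g \<in> M \<Longrightarrow> f + g \<in> M"
    "\<And>f a. f \<in> M \<Longrightarrow> a \<in> Pol V \<Longrightarrow> (\<lambda>b. a * f b) \<in> M"
    "\<And>f g. f \<in> M \<Longrightarrow> g \<in> M \<Longrightarrow> f - g \<in> M"
proof -
  show *: "M \<subseteq> free_module V m" "0 \<in> M" "\<And>f g. f \<in> M \<Longrightarrow> g \<in> M \<Longrightarrow> f + g \<in> M"
    "\<And>f a. f \<in> M \<Longrightarrow> a \<in> Pol V \<Longrightarrow> (\<lambda>b. a * f b) \<in> M"
    using assms unfolding submod_def by blast+
  fix f g assume fg: "f \<in> M" "g \<in> M"
  have "(\<lambda>b. - 1 * g b) \<in> M" by (rule *(4)[OF fg(2)]) simp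
  from *(3)[OF fg(1) this] show "f - g \<in> M" by (simp add: plus_fun_def fun_diff_def)
qed

lemma submod_sum:
  assumes "submod V m M" "\<And>i. i \<in> A \<Longrightarrow> (\<lambda>b. f b i) \<in> M"
  shows "(\<lambda>b. \<Sum>i\<in>A. f b i) \<in> M"
  using assms(2)
proof (induction A rule: infinite_finite_induct)
  case (insert x F)
  have "(\<lambda>b. f b x) + (\<lambda>b. \<Sum>i\<in>F. f b i) \<in> M"
    by (rule submodD(3)[OF assms(1)]) (use insert in auto)
  then show ?case using insert by (simp add: plus_fun_def)
qed (use submodD(2)[OF assms(1)] in \<open>auto simp: zero_fun_def\<close>)

lemma free_module_iff: "f \<in> free_module V m \<longleftrightarrow> (\<forall>b. f b \<in> Pol V) \<and> (\<forall>b\<ge>m. f b = 0)"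
  unfolding free_module_def by (auto, metis Pol_zero not_le)

lemma submod_free: "submod V m (free_module V m)"
  by (auto simp: submod_def free_module_iff intro: Pol_add Pol_mult)

text \<open>Koszul chains with coefficients in a submodule \<open>M\<close> of a free module with shifts \<open>s\<close>.\<close>

definition VK :: "nat set \<Rightarrow> (nat \<Rightarrow> 'k::field mpoly) set \<Rightarrow> (nat \<Rightarrow> int) \<Rightarrow> nat \<Rightarrow> int \<Rightarrow>
    (nat \<Rightarrow> nat set \<Rightarrow> 'k mpoly) set" where
  "VK V M s q j = {z. (\<forall>b \<sigma>. z b \<sigma> \<noteq> 0 \<longrightarrow> \<sigma> \<subseteq> V \<and> card \<sigma> = q) \<and> (\<forall>\<sigma>. (\<lambda>b. z b \<sigma>) \<in> M) \<and>
     (\<forall>b \<sigma>. homogeneous (j - int q - s b) (z b \<sigma>))}"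

lemma VKD:
  assumes "z \<in> VK V M s q j"
  shows "\<And>b \<sigma>. z b \<sigma> \<noteq> 0 \<Longrightarrow> \<sigma> \<subseteq> V" "\<And>b \<sigma>. z b \<sigma> \<noteq> 0 \<Longrightarrow> card \<sigma> = q" "\<And>\<sigma>. (\<lambda>b. z b \<sigma>) \<in> M"
    "\<And>b \<sigma>. homogeneous (j - int q - s b) (z b \<sigma>)"
  using assms unfolding VK_def by blast+

lemma VKI:
  assumes "\<And>b \<sigma>. z b \<sigma> \<noteq> 0 \<Longrightarrow> \<sigma> \<subseteq> V \<and> card \<sigma> = q" "\<And>\<sigma>. (\<lambda>b. z b \<sigma>) \<in> M"
    "\<And>b \<sigma>. homogeneous (j - int q - s b) (z b \<sigma>)"
  shows "z \<in> VK V M s q j"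
  using assms unfolding VK_def by blast

lemma VK_zero: "submod V m M \<Longrightarrow> 0 \<in> VK V M s q j"
  by (rule VKI) (auto dest: submodD(2) simp: zero_fun_def)

lemma VK_diff:
  assumes M: "submod V m M" and zy: "z \<in> VK V M s q j" "y \<in> VK V M s q j"
  shows "z - y \<in> VK V M s q j"
proof (rule VKI)
  fix b \<sigma> assume "(z - y) b \<sigma> \<noteq> 0"
  then have "z b \<sigma> \<noteq> 0 \<or> y b \<sigma> \<noteq> 0" by auto
  then show "\<sigma> \<subseteq> V \<and> card \<sigma> = q" using VKD(1,2)[OF zy(1), of b \<sigma>] VKD(1,2)[OF zy(2), of b \<sigma>] by blast
next
  fix \<sigma> 
  have "(\<lambda>b. z b \<sigma>) - (\<lambda>b. y b \<sigma>) \<in> M" using submodD(5)[OF M] VKD(3) zy by blast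
  then show "(\<lambda>b. (z - y) b \<sigma>) \<in> M" by (simp add: fun_diff_def)
next
  fix b \<sigma> show "homogeneous (j - int q - s b) ((z - y) b \<sigma>)"
    using VKD(4)[OF zy(1)] VKD(4)[OF zy(2)] by (simp add: homogeneous_diff)
qed

lemma VK_scale:
  assumes M: "submod V m M" and z: "z \<in> VK V M s q j"
  shows "vscale c z \<in> VK V M s q j"
proof (rule VKI)
  fix b \<sigma> assume "vscale c z b \<sigma> \<noteq> 0"
  then show "\<sigma> \<subseteq> V \<and> card \<sigma> = q" using VKD[OF z] by (auto simp: vscale_def)
next
  fix \<sigma> show "(\<lambda>b. vscale c z b \<sigma>) \<in> M"
    unfolding vscale_def by (rule submodD(4)[OF M VKD(3)[OF z]]) (simp add: Pol_single)
next
  fix b \<sigma> show "homogeneous (j - int q - s b) (vscale c z b \<sigma>)"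
    unfolding vscale_def by (rule homogeneous_scale[OF VKD(4)[OF z]])
qed

lemma VK_mono: "M \<subseteq> N \<Longrightarrow> VK V M s q j \<subseteq> VK V N s q j"
  unfolding VK_def by blast

definition vd :: "nat set \<Rightarrow> (nat \<Rightarrow> nat set \<Rightarrow> 'k::field mpoly) \<Rightarrow> nat \<Rightarrow> nat set \<Rightarrow> 'k mpoly" where
  "vd V z = (\<lambda>b. kdm V (z b))"

lemma vd_zero [simp]: "vd V 0 = 0"
  by (simp add: vd_def fun_eq_iff zero_fun_def)

lemma vd_diff: "vd V (z - y) = vd V z - vd V y"
  by (simp add: vd_def fun_eq_iff fun_diff_def kd_diff)

lemma vd_scale: "vd V (vscale c z) = vscale c (vd V z)"
  by (simp add: vd_def vscale_def fun_eq_iff kd_scale)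

lemma homogeneous_ksgn: "homogeneous 0 (ksgn j \<tau> :: 'k::field mpoly)"
proof -
  have "homogeneous 0 ((-1) ^ n :: 'k mpoly)" for n
    by (induction n) (auto simp: homogeneous_iff)
  then show ?thesis by (simp add: ksgn_def)
qed

lemma Pol_ksgn: "ksgn j \<tau> \<in> Pol V"
  by (simp add: ksgn_def Pol_sgn)

lemma homogeneous_kdm:
  assumes "\<And>\<sigma>. homogeneous (d - 1) (z \<sigma>)"
  shows "homogeneous d (kdm V z \<tau>)"
  unfolding kd_def
proof (rule homogeneous_sum)
  fix j
  have "homogeneous 1 (mvar j :: 'a mpoly)" by (simp add: mvar_def homogeneous_single)
  from homogeneous_mult[OF this assms[of "insert j \<tau>"]]
  have "homogeneous d (mvar j * z (insert j \<tau>))" by simp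
  from homogeneous_mult[OF homogeneous_ksgn this]
  show "homogeneous d (ksgn j \<tau> * (mvar j * z (insert j \<tau>)))" by simp
qed

lemma card_insert_chain:
  assumes "finite V" "insert j \<tau> \<subseteq> V" "card (insert j \<tau>) = Suc q" "j \<notin> \<tau>"
  shows "\<tau> \<subseteq> V \<and> card \<tau> = q"
  using assms by (auto dest: finite_subset)

lemma vd_in_VK:
  assumes V: "finite V" and M: "submod V m M" and z: "z \<in> VK V M s (Suc q) j"
  shows "vd V z \<in> VK V M s q j"
proof (rule VKI)
  fix b \<sigma> assume "vd V z b \<sigma> \<noteq> 0"
  then obtain i where "i \<in> V - \<sigma>" "z b (insert i \<sigma>) \<noteq> 0"
    unfolding vd_def by (auto dest: kd_nonzero)
  then show "\<sigma> \<subseteq> V \<and> card \<sigma> = q"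
    using card_insert_chain[OF V] VKD(1,2)[OF z] by blast
next
  fix \<sigma>
  show "(\<lambda>b. vd V z b \<sigma>) \<in> M"
    unfolding vd_def kd_def
  proof (rule submod_sum[OF M])
    fix i assume i: "i \<in> V - \<sigma>"
    show "(\<lambda>b. ksgn i \<sigma> * (mvar i * z b (insert i \<sigma>))) \<in> M"
      by (rule submodD(4)[OF M submodD(4)[OF M VKD(3)[OF z]]]) (use i in \<open>auto intro: Pol_mvar Pol_ksgn\<close>)
  qed
next
  fix b \<sigma>
  show "homogeneous (j - int q - s b) (vd V z b \<sigma>)"
    unfolding vd_def
  proof (rule homogeneous_kdm)
    fix \<sigma>' show "homogeneous (j - int q - s b - 1) (z b \<sigma>')"
      using VKD(4)[OF z, of b \<sigma>'] by (simp add: algebra_simps)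
  qed
qed

lemma vd_vd:
  assumes V: "finite V" and z: "z \<in> VK V M s q j"
  shows "vd V (vd V z) = 0"
proof -
  have "kdm V (kdm V (z b)) \<tau> = 0" for b \<tau>
    by (rule kd_kd[OF V]) (rule VKD(1)[OF z])
  then show ?thesis by (simp add: vd_def fun_eq_iff)
qed

lemma vd_deg0:
  assumes V: "finite V" and z: "z \<in> VK V M s 0 j"
  shows "vd V z = 0"
proof -
  have "kdm V (z b) \<tau> = 0" for b \<tau>
  proof (rule kd_outside)
    fix i assume "i \<in> V - \<tau>"
    show "z b (insert i \<tau>) = 0"
    proof (rule ccontr)
      assume "z b (insert i \<tau>) \<noteq> 0"
      then have "insert i \<tau> \<subseteq> V" "card (insert i \<tau>) = 0" using VKD(1,2)[OF z] by blast+
      then show False using V by (metis card_0_eq finite_subset insert_not_empty)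
    qed
  qed
  then show ?thesis by (simp add: vd_def fun_eq_iff)
qed

text \<open>Coordinatewise exactness of the Koszul complex of the polynomial ring, shifted by
  \<open>s b\<close>. In degree 0 only chains without constant terms are boundaries.\<close>

lemma VK_free_exact:
  assumes V: "finite V" and z: "z \<in> VK V (free_module V m) s q j" and cyc: "vd V z = 0"
    and q: "q > 0 \<or> (\<forall>b. lk (z b {}) 0 = 0)"
  shows "\<exists>y\<in>VK V (free_module V m) s (Suc q) j. vd V y = z"
proof -
  have "\<exists>y\<in>KK V (Pol V) (Suc q) (j - s b). kdm V y = z b" for b
  proof (rule KK_Pol_exact[OF V])
    show "z b \<in> KK V (Pol V) q (j - s b)"
      using VKD[OF z] by (auto simp: KK_def free_module_iff algebra_simps)
    show "kdm V (z b) \<tau> = 0" for \<tau> using cyc by (auto simp: vd_def fun_eq_iff)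
  qed (use q in auto)
  then obtain y where y: "\<And>b. y b \<in> KK V (Pol V) (Suc q) (j - s b)" "\<And>b. kdm V (y b) = z b"
    by metis
  \<comment> \<open>Preimages were chosen for every coordinate; those beyond the rank are reset to
    zero to stay in the free module.\<close>
  define y' where "y' b = (if b < m then y b else (\<lambda>_. 0))" for b
  have "y' \<in> VK V (free_module V m) s (Suc q) j"
    by (rule VKI) (use y(1) in \<open>auto simp: y'_def KK_def free_module_iff algebra_simps split: if_splits\<close>)
  moreover have "vd V y' = z"
  proof (intro ext)
    fix b \<sigma> show "vd V y' b \<sigma> = z b \<sigma>"
      using y(2)[of b] VKD(3)[OF z, of \<sigma>] by (auto simp: vd_def y'_def free_module_iff)
  qed
  ultimately show ?thesis by blast
qed

lemma lookup_kdm_0: "lk (kdm V z \<tau>) 0 = 0"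
  by (simp add: kd_def lookup_sum lookup_ksgn_times lookup_mvar_times)

text \<open>
  The resolution together with its augmentation: \<open>D 0\<close> is the row of the augmentation map.
\<close>

locale graded_resolution =
  fixes V :: "nat set" and rk :: "nat \<Rightarrow> nat" and sh :: "nat \<Rightarrow> nat \<Rightarrow> int"
    and D :: "nat \<Rightarrow> nat \<Rightarrow> nat \<Rightarrow> 'k::field mpoly"
  assumes finite_V: "finite V"
    and D_Pol: "\<And>r c b. c < rk r \<Longrightarrow> b < rk (Suc r) \<Longrightarrow> D r c b \<in> Pol V"
    and D_hom: "\<And>r c b. c < rk r \<Longrightarrow> b < rk (Suc r) \<Longrightarrow> homogeneous (sh (Suc r) b - sh r c) (D r c b)"
    and exact: "\<And>r. {a \<in> free_module V (rk (Suc r)). mat_apply (rk r) (rk (Suc r)) (D r) a = 0} =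
      mat_apply (rk (Suc r)) (rk (Suc (Suc r))) (D (Suc r)) ` free_module V (rk (Suc (Suc r)))"
begin

definition app :: "nat \<Rightarrow> (nat \<Rightarrow> 'k mpoly) \<Rightarrow> nat \<Rightarrow> 'k mpoly" where
  "app r = mat_apply (rk r) (rk (Suc r)) (D r)"

abbreviation "Fr r \<equiv> free_module V (rk r)"

text \<open>Syzygy modules: in the intended instance \<open>Zs 0\<close> is the resolved ideal
  inside the ring, and \<open>Zs (Suc r)\<close> is the kernel of \<open>app r\<close> by
  \<open>ker_app\<close>.\<close>

definition Zs :: "nat \<Rightarrow> (nat \<Rightarrow> 'k mpoly) set" where
  "Zs r = app r ` Fr (Suc r)"

lemma app_apply: "app r a c = (if c < rk r then \<Sum>b<rk (Suc r). D r c b * a b else 0)"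
  by (simp add: app_def mat_apply_def)

lemma app_zero [simp]: "app r 0 = 0"
  by (simp add: fun_eq_iff app_apply)

lemma app_add: "app r (a + b) = app r a + app r b"
  by (auto simp: fun_eq_iff app_apply algebra_simps sum.distrib)

lemma app_mult: "app r (\<lambda>b. p * a b) = (\<lambda>c. p * app r a c)"
  by (auto simp: fun_eq_iff app_apply sum_distrib_left algebra_simps)

lemma app_in_free: "a \<in> Fr (Suc r) \<Longrightarrow> app r a \<in> Fr r"
  by (auto simp: free_module_iff app_apply intro!: Pol_sum Pol_mult D_Pol)

lemma submod_Zs: "submod V (rk r) (Zs r)"
  unfolding submod_def
proof (intro conjI ballI)
  show "Zs r \<subseteq> Fr r" using app_in_free by (auto simp: Zs_def)
  note F = submodD[OF submod_free[of V "rk (Suc r)"]]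
  show "0 \<in> Zs r" unfolding Zs_def using F(2) app_zero by (metis image_eqI)
  fix f assume "f \<in> Zs r"
  then obtain a where a: "f = app r a" "a \<in> Fr (Suc r)" by (auto simp: Zs_def)
  show "f + g \<in> Zs r" if "g \<in> Zs r" for g
    using a that unfolding Zs_def by (auto simp: app_add[symmetric] intro!: imageI F(3))
  show "(\<lambda>b. p * f b) \<in> Zs r" if "p \<in> Pol V" for p
    using a that unfolding Zs_def by (auto simp: app_mult[symmetric] intro!: imageI F(4))
qed

lemma ker_app: "a \<in> Fr (Suc r) \<and> app r a = 0 \<longleftrightarrow> a \<in> Zs (Suc r)"
  using exact[of r] unfolding Zs_def app_def by blast

lemma app_homogeneous:
  assumes "\<And>b. homogeneous (d - sh (Suc r) b) (a b)"
  shows "homogeneous (d - sh r c) (app r a c)"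
proof (cases "c < rk r")
  case True
  have "homogeneous (d - sh r c) (D r c b * a b)" if "b < rk (Suc r)" for b
    using homogeneous_mult[OF D_hom[OF True that] assms[of b]] by simp
  then show ?thesis using True by (auto simp: app_apply intro!: homogeneous_sum)
qed (simp add: app_apply)

text \<open>Taking components of the appropriate degrees in an arbitrary preimage does not change
  its image, because the matrix entries are homogeneous.\<close>

lemma homogeneous_lift:
  assumes a: "a \<in> Zs r" "\<And>c. homogeneous (d - sh r c) (a c)"
  shows "\<exists>f\<in>Fr (Suc r). (\<forall>b. homogeneous (d - sh (Suc r) b) (f b)) \<and> app r f = a"
proof -
  obtain f where f: "f \<in> Fr (Suc r)" "a = app r f" using a by (auto simp: Zs_def)
  define f' where "f' b = hcomp (d - sh (Suc r) b) (f b)" for b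
  have "app r f' c = a c" for c
  proof (cases "c < rk r")
    case True
    have "app r f' c = (\<Sum>b<rk (Suc r). D r c b * f' b)" using True by (simp add: app_apply)
    also have "\<dots> = (\<Sum>b<rk (Suc r). hcomp (d - sh r c) (D r c b * f b))"
    proof (rule sum.cong[OF refl])
      fix b assume "b \<in> {..<rk (Suc r)}"
      then show "D r c b * f' b = hcomp (d - sh r c) (D r c b * f b)"
        using hcomp_mult[OF D_hom[OF True], of b "d - sh r c" "f b"] by (simp add: f'_def)
    qed
    also have "\<dots> = hcomp (d - sh r c) (a c)"
      using True f by (simp add: hcomp_sum app_apply)
    also have "\<dots> = a c" by (rule hcomp_homogeneous[OF a(2)])
    finally show ?thesis .
  qed (use f in \<open>simp add: app_apply\<close>)
  moreover have "f' \<in> Fr (Suc r)"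
    using f by (auto simp: free_module_iff f'_def intro: Pol_hcomp)
  moreover have "homogeneous (d - sh (Suc r) b) (f' b)" for b
    by (simp add: f'_def homogeneous_hcomp)
  ultimately show ?thesis by (intro bexI[of _ f']) auto
qed

definition apc :: "nat \<Rightarrow> (nat \<Rightarrow> nat set \<Rightarrow> 'k mpoly) \<Rightarrow> nat \<Rightarrow> nat set \<Rightarrow> 'k mpoly" where
  "apc r z = (\<lambda>c \<sigma>. app r (\<lambda>b. z b \<sigma>) c)"

lemma apc_zero [simp]: "apc r 0 = 0"
  by (simp add: apc_def app_apply fun_eq_iff)

lemma apc_diff: "apc r (z - y) = apc r z - apc r y"
  by (simp add: apc_def app_apply fun_eq_iff algebra_simps sum_subtractf)

lemma apc_scale: "apc r (vscale c z) = vscale c (apc r z)"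
  by (simp add: apc_def app_apply vscale_def fun_eq_iff sum_distrib_left algebra_simps)

lemma vd_apc: "vd V (apc r z) = apc r (vd V z)"
  unfolding vd_def apc_def app_apply
  by (auto simp: fun_eq_iff kd_sum kd_scale)

abbreviation "VF r q j \<equiv> VK V (Fr r) (sh r) q j"
abbreviation "VZ r q j \<equiv> VK V (Zs r) (sh r) q j"

lemmas VF_diff = VK_diff[OF submod_free[of V "rk r" for r]] and VF_scale = VK_scale[OF submod_free[of V "rk r" for r]]
lemmas VZ_diff = VK_diff[OF submod_Zs] and VZ_scale = VK_scale[OF submod_Zs]
lemmas VZ_zero = VK_zero[OF submod_Zs] and VF_zero = VK_zero[OF submod_free[of V "rk r" for r]]
lemmas vd_VF = vd_in_VK[OF finite_V submod_free[of V "rk r" for r]]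

lemma VZ_VF: "z \<in> VZ r q j \<Longrightarrow> z \<in> VF r q j"
  using VK_mono[OF submodD(1)[OF submod_Zs]] by blast

lemma apc_in: 
  assumes f: "f \<in> VF (Suc r) q j"
  shows "apc r f \<in> VZ r q j"
proof (rule VKI)
  fix c \<sigma> assume "apc r f c \<sigma> \<noteq> 0"
  moreover have "apc r f c \<sigma> = 0" if "\<forall>b. f b \<sigma> = 0" using that by (simp add: apc_def app_apply)
  ultimately have "\<exists>b. f b \<sigma> \<noteq> 0" by blast
  then show "\<sigma> \<subseteq> V \<and> card \<sigma> = q" using VKD(1,2)[OF f] by blast
next
  fix \<sigma> show "(\<lambda>c. apc r f c \<sigma>) \<in> Zs r"
    using VKD(3)[OF f] by (auto simp: apc_def Zs_def)
next
  fix c \<sigma> show "homogeneous (j - int q - sh r c) (apc r f c \<sigma>)"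
    unfolding apc_def by (rule app_homogeneous) (rule VKD(4)[OF f])
qed

lemma apc_lift:
  assumes z: "z \<in> VZ r q j"
  shows "\<exists>f\<in>VF (Suc r) q j. apc r f = z"
proof -
  \<comment> \<open>The last clause makes the lift zero wherever \<open>z\<close> is, which keeps
    its support on sets of cardinality \<open>q\<close>.\<close>
  have "\<exists>f. f \<in> Fr (Suc r) \<and> (\<forall>b. homogeneous (j - int q - sh (Suc r) b) (f b)) \<and>
      app r f = (\<lambda>c. z c \<sigma>) \<and> ((\<forall>c. z c \<sigma> = 0) \<longrightarrow> f = 0)" for \<sigma>
  proof (cases "\<forall>c. z c \<sigma> = 0")
    case True
    then show ?thesis
      by (intro exI[of _ 0]) (auto simp: submodD(2)[OF submod_free] fun_eq_iff app_apply)
  next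
    case False
    then show ?thesis using homogeneous_lift[OF VKD(3)[OF z] VKD(4)[OF z]] by blast
  qed
  then obtain f where f: "\<And>\<sigma>. f \<sigma> \<in> Fr (Suc r)" "\<And>\<sigma> b. homogeneous (j - int q - sh (Suc r) b) (f \<sigma> b)"
    "\<And>\<sigma>. app r (f \<sigma>) = (\<lambda>c. z c \<sigma>)" "\<And>\<sigma>. \<forall>c. z c \<sigma> = 0 \<Longrightarrow> f \<sigma> = 0"
    by metis
  have "(\<lambda>b \<sigma>. f \<sigma> b) \<in> VF (Suc r) q j"
  proof (rule VKI)
    fix b \<sigma> assume "f \<sigma> b \<noteq> 0"
    then have "f \<sigma> \<noteq> 0" by auto
    then have "\<exists>c. z c \<sigma> \<noteq> 0" using f(4)[of \<sigma>] by blast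
    then show "\<sigma> \<subseteq> V \<and> card \<sigma> = q" using VKD(1,2)[OF z] by blast
  qed (use f in auto)
  moreover have "apc r (\<lambda>b \<sigma>. f \<sigma> b) = z"
    using f(3) by (simp add: apc_def)
  ultimately show ?thesis by blast
qed

lemma apc_ker: 
  assumes f: "f \<in> VF (Suc r) q j"
  shows "apc r f = 0 \<longleftrightarrow> f \<in> VZ (Suc r) q j"
proof
  assume 0: "apc r f = 0"
  have "(\<lambda>b. f b \<sigma>) \<in> Zs (Suc r)" for \<sigma>
  proof -
    have "app r (\<lambda>b. f b \<sigma>) = 0" using 0 by (simp add: apc_def fun_eq_iff)
    then show ?thesis using ker_app VKD(3)[OF f] by blast
  qed
  then show "f \<in> VZ (Suc r) q j" by (intro VKI) (use VKD[OF f] in auto)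
next
  assume "f \<in> VZ (Suc r) q j"
  then have "app r (\<lambda>b. f b \<sigma>) = 0" for \<sigma> using ker_app VKD(3) by blast
  then show "apc r f = 0" by (simp add: apc_def fun_eq_iff)
qed

text \<open>For \<open>r > 0\<close> the condition selects the kernel of the map from Koszul
  homology of \<open>Zs r\<close> to that of \<open>Fr r\<close>. It holds for all cycles if
  \<open>q > 0\<close>, where the free module has no homology, but is a restriction for
  \<open>q = 0\<close>. With it dimension shifting is uniform in \<open>q\<close>.\<close>

definition Cyc :: "nat \<Rightarrow> nat \<Rightarrow> int \<Rightarrow> (nat \<Rightarrow> nat set \<Rightarrow> 'k mpoly) set" where
  "Cyc r q j = {w \<in> VZ r q j. vd V w = 0 \<and> (r > 0 \<longrightarrow> (\<exists>f\<in>VF r (Suc q) j. vd V f = w))}"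

definition Bd :: "nat \<Rightarrow> nat \<Rightarrow> int \<Rightarrow> (nat \<Rightarrow> nat set \<Rightarrow> 'k mpoly) set" where
  "Bd r q j = vd V ` VZ r (Suc q) j"

lemma Cyc_diff:
  assumes "z \<in> Cyc r q j" "y \<in> Cyc r q j"
  shows "z - y \<in> Cyc r q j"
proof -
  have "\<exists>f\<in>VF r (Suc q) j. vd V f = z - y" if r: "r > 0"
  proof -
    obtain f g where "f \<in> VF r (Suc q) j" "vd V f = z" "g \<in> VF r (Suc q) j" "vd V g = y"
      using assms r unfolding Cyc_def by blast
    then show ?thesis by (intro bexI[of _ "f - g"]) (auto simp: vd_diff intro: VF_diff)
  qed
  then show ?thesis using assms by (auto simp: Cyc_def vd_diff intro: VZ_diff)
qed

lemma vscale_zero [simp]: "vscale c 0 = 0"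
  by (simp add: vscale_def fun_eq_iff)

lemma Cyc_scale:
  assumes "z \<in> Cyc r q j"
  shows "vscale c z \<in> Cyc r q j"
proof -
  have "\<exists>f\<in>VF r (Suc q) j. vd V f = vscale c z" if r: "r > 0"
  proof -
    obtain f where "f \<in> VF r (Suc q) j" "vd V f = z"
      using assms r unfolding Cyc_def by blast
    then show ?thesis by (intro bexI[of _ "vscale c f"]) (auto simp: vd_scale intro: VF_scale)
  qed
  then show ?thesis using assms by (auto simp: Cyc_def vd_scale intro: VZ_scale)
qed

lemma Cyc_zero: "0 \<in> Cyc r q j"
  unfolding Cyc_def using VZ_zero VF_zero vd_zero by blast

lemma Bd_diff: "z \<in> Bd r q j \<Longrightarrow> y \<in> Bd r q j \<Longrightarrow> z - y \<in> Bd r q j"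
  unfolding Bd_def by (auto simp: vd_diff[symmetric] intro!: imageI VZ_diff)

lemma Bd_scale: "z \<in> Bd r q j \<Longrightarrow> vscale c z \<in> Bd r q j"
  unfolding Bd_def by (auto simp: vd_scale[symmetric] intro!: imageI VZ_scale)

lemma Bd_zero: "0 \<in> Bd r q j"
  unfolding Bd_def by (rule image_eqI[of _ _ 0]) (simp_all add: VZ_zero)

text \<open>Connecting homomorphism of the Koszul complexes over \<open>Zs (Suc r)\<close>,
  \<open>Fr (Suc r)\<close> and \<open>Zs r\<close>, written as a relation: a chain \<open>f\<close>
  over the free module links its image \<open>z\<close> to its boundary \<open>w\<close>.\<close>

lemma siso_shift:
  "siso vscale (Cyc r (Suc q) j) (Bd r (Suc q) j) vscale (Cyc (Suc r) q j) (Bd (Suc r) q j)"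
proof (rule sisoI[where R = "\<lambda>z w. z \<in> Cyc r (Suc q) j \<and> w \<in> Cyc (Suc r) q j \<and>
    (\<exists>f\<in>VF (Suc r) (Suc q) j. apc r f = z \<and> vd V f = w)"], goal_cases)
  \<comment> \<open>If \<open>z\<close> bounds \<open>y\<close>, a preimage \<open>h\<close> of
    \<open>y\<close> corrects \<open>f\<close> by a boundary to a chain over the syzygies that still
    bounds to \<open>w\<close>.\<close>
  case (3 z w)
  then obtain f y where f: "f \<in> VF (Suc r) (Suc q) j" "apc r f = z" "vd V f = w"
    and y: "y \<in> VZ r (Suc (Suc q)) j" "z = vd V y" by (auto simp: Bd_def)
  obtain h where h: "h \<in> VF (Suc r) (Suc (Suc q)) j" "apc r h = y" using apc_lift[OF y(1)] by blast
  have g: "f - vd V h \<in> VF (Suc r) (Suc q) j" by (rule VF_diff[OF f(1) vd_VF[OF h(1)]])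
  have "apc r (f - vd V h) = 0" using f h y by (simp add: apc_diff vd_apc[symmetric])
  then have "f - vd V h \<in> VZ (Suc r) (Suc q) j" using apc_ker[OF g] by blast
  moreover have "vd V (f - vd V h) = w" using f vd_vd[OF finite_V h(1)] by (simp add: vd_diff)
  ultimately show ?case by (auto simp: Bd_def)
next
  \<comment> \<open>If \<open>w\<close> bounds \<open>g\<close> over the syzygies,
    \<open>f - g\<close> is a cycle of positive degree over the free module, hence a
    boundary.\<close>
  case (4 z w)
  then obtain f g where f: "f \<in> VF (Suc r) (Suc q) j" "apc r f = z" "vd V f = w"
    and g: "g \<in> VZ (Suc r) (Suc q) j" "w = vd V g" by (auto simp: Bd_def)
  have "f - g \<in> VF (Suc r) (Suc q) j" by (rule VF_diff[OF f(1) VZ_VF[OF g(1)]])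
  moreover have "vd V (f - g) = 0" using f g by (simp add: vd_diff)
  ultimately obtain h where h: "h \<in> VF (Suc r) (Suc (Suc q)) j" "vd V h = f - g"
    using VK_free_exact[OF finite_V] by blast
  have "apc r g = 0" using apc_ker[OF VZ_VF[OF g(1)]] g by blast
  then have "z = vd V (apc r h)" using f h by (simp add: vd_apc apc_diff)
  then show ?case using apc_in[OF h(1)] by (auto simp: Bd_def)
next
  case (5 z)
  then have z: "z \<in> VZ r (Suc q) j" "vd V z = 0" by (auto simp: Cyc_def)
  obtain f where f: "f \<in> VF (Suc r) (Suc q) j" "apc r f = z" using apc_lift[OF z(1)] by blast
  have "apc r (vd V f) = 0" using f z by (simp add: vd_apc[symmetric])
  then have "vd V f \<in> VZ (Suc r) q j" using apc_ker[OF vd_VF[OF f(1)]] by blast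
  then have "vd V f \<in> Cyc (Suc r) q j" using f vd_vd[OF finite_V f(1)] by (auto simp: Cyc_def)
  then show ?case using 5 f by blast
next
  \<comment> \<open>The extra condition in \<open>Cyc\<close> supplies the chain \<open>f\<close>
    bounding \<open>w\<close>, also in degree 0.\<close>
  case (6 w)
  then obtain f where f: "f \<in> VF (Suc r) (Suc q) j" "vd V f = w" and w: "w \<in> VZ (Suc r) q j"
    by (auto simp: Cyc_def)
  have "vd V (apc r f) = 0" using apc_ker[OF VZ_VF[OF w]] w f by (simp add: vd_apc)
  moreover have "apc r f \<in> VZ r (Suc q) j" by (rule apc_in[OF f(1)])
  moreover from this have "\<exists>h\<in>VF r (Suc (Suc q)) j. vd V h = apc r f"
    using VK_free_exact[OF finite_V VZ_VF] \<open>vd V (apc r f) = 0\<close> by blast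
  ultimately have "apc r f \<in> Cyc r (Suc q) j" by (auto simp: Cyc_def)
  then show ?case using 6 f by blast
next
  case 7
  then show ?case using Cyc_zero VF_zero by (intro conjI bexI[of _ 0]) auto
next
  case (8 x y x' y')
  then obtain f g where "f \<in> VF (Suc r) (Suc q) j" "apc r f = x" "vd V f = y"
    "g \<in> VF (Suc r) (Suc q) j" "apc r g = x'" "vd V g = y'" by blast
  then have "f - g \<in> VF (Suc r) (Suc q) j \<and> apc r (f - g) = x - x' \<and> vd V (f - g) = y - y'"
    by (simp add: VF_diff apc_diff vd_diff)
  then show ?case using 8 by (blast intro: Cyc_diff)
next
  case (9 c x y)
  then obtain f where "f \<in> VF (Suc r) (Suc q) j" "apc r f = x" "vd V f = y" by blast
  then have "vscale c f \<in> VF (Suc r) (Suc q) j \<and> apc r (vscale c f) = vscale c x \<and>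
      vd V (vscale c f) = vscale c y"
    by (simp add: VF_scale apc_scale vd_scale)
  then show ?case using 9 by (blast intro: Cyc_scale)
qed auto

text \<open>Each shift trades one syzygy step for one Koszul degree, with their sum fixed.\<close>

lemma siso_Cyc: "siso vscale (Cyc r 0 j) (Bd r 0 j) vscale (Cyc 0 r j) (Bd 0 r j)"
proof -
  have "siso vscale (Cyc (p + q) 0 j) (Bd (p + q) 0 j) vscale (Cyc p q j) (Bd p q j)" for p q
  proof (induction q arbitrary: p)
    case 0
    show ?case
      by (rule sisoI[where R = "\<lambda>x y. x = y \<and> x \<in> Cyc p 0 j"]) (auto intro: Cyc_diff Cyc_scale Cyc_zero)
  next
    case (Suc q)
    have "siso vscale (Cyc (Suc p + q) 0 j) (Bd (Suc p + q) 0 j) vscale (Cyc p (Suc q) j) (Bd p (Suc q) j)"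
      by (rule siso_trans[OF Suc siso_sym[OF siso_shift]])
    then show ?case by simp
  qed
  from this[of 0 r] show ?thesis by simp
qed

section \<open>Comparison with the complex of constant terms\<close>

definition TC :: "nat \<Rightarrow> int \<Rightarrow> (nat \<Rightarrow> 'k) set" where
  "TC r j = {v. \<forall>b. v b \<noteq> 0 \<longrightarrow> b < rk (Suc r) \<and> sh (Suc r) b = j}"

definition td :: "nat \<Rightarrow> (nat \<Rightarrow> 'k) \<Rightarrow> nat \<Rightarrow> 'k" where
  "td r = mat_apply (rk r) (rk (Suc r)) (\<lambda>c b. lk (D r c b) 0)"

definition cst :: "(nat \<Rightarrow> 'k) \<Rightarrow> nat \<Rightarrow> nat set \<Rightarrow> 'k mpoly" where
  "cst v = (\<lambda>b \<sigma>. if \<sigma> = {} then sing 0 (v b) else 0)"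

lemma cst_diff: "cst (v - w) = cst v - cst w"
  by (auto simp: cst_def fun_eq_iff single_diff)

lemma cst_scale: "cst (fun_scale c v) = vscale c (cst v)"
  by (auto simp: cst_def fun_eq_iff fun_scale_def vscale_def mult_single)

lemma cst_zero [simp]: "cst 0 = 0"
  by (auto simp: cst_def fun_eq_iff)

lemma cst_in: "v \<in> TC r j \<Longrightarrow> cst v \<in> VF (Suc r) 0 j"
proof (rule VKI)
  fix \<sigma> assume v: "v \<in> TC r j"
  have "v b = 0" if "b \<ge> rk (Suc r)" for b
    using v that unfolding TC_def mem_Collect_eq by (metis not_le)
  then show "(\<lambda>b. cst v b \<sigma>) \<in> Fr (Suc r)"
    by (auto simp: cst_def free_module_iff Pol_single)
qed (auto simp: cst_def TC_def homogeneous_single split: if_splits)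

text \<open>Exponents add up to 0 only if both are 0.\<close>

lemma lookup_times_0: "lk (p * q :: 'k mpoly) 0 = lk p 0 * lk q 0"
proof -
  have "p = sing 0 (lk p 0) + (p - sing 0 (lk p 0))" by simp
  moreover have "lk ((p - sing 0 (lk p 0)) * q) 0 = 0"
  proof (rule ccontr)
    assume "lk ((p - sing 0 (lk p 0)) * q) 0 \<noteq> 0"
    then have "0 \<in> ks ((p - sing 0 (lk p 0)) * q)" by (simp only: in_keys_iff not_False_eq_True)
    then obtain x y where "x \<in> ks (p - sing 0 (lk p 0))" "y \<in> ks q" "0 = x + y"
      using keys_times_subset by blast
    moreover from this have "x = 0" by (metis tdeg_add tdeg_zero add_is_0 tdeg_eq_0_iff)
    ultimately show False by (simp add: in_keys_iff lookup_minus)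
  qed
  ultimately show ?thesis
    by (metis (no_types, lifting) add_0_right distrib_right lookup_add lookup_const_times)
qed

lemma lookup_apc_0: "lk (apc r f c {}) 0 = td r (\<lambda>b. lk (f b {}) 0) c"
  by (simp add: apc_def app_apply td_def mat_apply_def lookup_sum lookup_times_0)

lemma const_part_cst: "(\<lambda>b. lk (cst v b {}) 0) = v"
  by (simp add: cst_def)

lemma const_part_TC:
  assumes f: "f \<in> VF (Suc r) 0 j"
  shows "(\<lambda>b. lk (f b {}) 0) \<in> TC r j"
  unfolding TC_def
proof (intro CollectI allI impI)
  fix b assume 0: "lk (f b {}) 0 \<noteq> 0"
  then have "f b {} \<noteq> 0" "0 \<in> ks (f b {})" by (auto simp: in_keys_iff)
  then show "b < rk (Suc r) \<and> sh (Suc r) b = j"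
    using VKD(3)[OF f, of "{}"] VKD(4)[OF f, of b "{}"]
    unfolding free_module_iff homogeneous_iff by (metis not_le tdeg_zero of_nat_0 diff_zero eq_iff_diff_eq_0)
qed

lemma VF_const_zero:
  assumes "f \<in> VF r 0 j" "\<And>b. lk (f b {}) 0 = 0"
  shows "\<exists>h\<in>VF r (Suc 0) j. vd V h = f"
  using VK_free_exact[OF finite_V assms(1) vd_deg0[OF finite_V assms(1)]] assms(2) by blast

lemma lookup_vd_0: "lk (vd V z b {}) 0 = 0"
  by (simp add: vd_def lookup_kdm_0)

text \<open>\<open>TC r\<close> belongs to the module of index \<open>Suc r\<close>, so its outgoing
  map is \<open>td r\<close>. For \<open>r = 0\<close> this is the augmentation, which is not part
  of the tensored complex; hence the guard.\<close>

definition Tcyc :: "nat \<Rightarrow> int \<Rightarrow> (nat \<Rightarrow> 'k) set" where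
  "Tcyc r j = {v \<in> TC r j. r > 0 \<longrightarrow> td r v = 0}"

lemma td_diff: "td r (v - w) = td r v - td r w"
  by (simp add: td_def mat_apply_def fun_eq_iff algebra_simps sum_subtractf)

lemma td_scale: "td r (fun_scale c v) = fun_scale c (td r v)"
  by (simp add: td_def mat_apply_def fun_eq_iff fun_scale_def sum_distrib_left algebra_simps)

lemma TC_diff: "v \<in> TC r j \<Longrightarrow> w \<in> TC r j \<Longrightarrow> v - w \<in> TC r j"
  unfolding TC_def mem_Collect_eq
proof (intro allI impI)
  fix b
  assume vw: "\<forall>b. v b \<noteq> 0 \<longrightarrow> b < rk (Suc r) \<and> sh (Suc r) b = j"
    "\<forall>b. w b \<noteq> 0 \<longrightarrow> b < rk (Suc r) \<and> sh (Suc r) b = j" and "(v - w) b \<noteq> 0"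
  then have "v b \<noteq> 0 \<or> w b \<noteq> 0" by auto
  then show "b < rk (Suc r) \<and> sh (Suc r) b = j" using vw by blast
qed

lemma TC_scale: "v \<in> TC r j \<Longrightarrow> fun_scale c v \<in> TC r j"
  by (auto simp: TC_def fun_scale_def)

lemma Tcyc_diff: "v \<in> Tcyc r j \<Longrightarrow> w \<in> Tcyc r j \<Longrightarrow> v - w \<in> Tcyc r j"
  by (auto simp: Tcyc_def TC_diff td_diff)

lemma Tcyc_scale: "v \<in> Tcyc r j \<Longrightarrow> fun_scale c v \<in> Tcyc r j"
  by (auto simp: Tcyc_def TC_scale td_scale) (simp add: fun_scale_def fun_eq_iff)

lemma td_zero: "td r 0 = 0"
  by (auto simp: td_def mat_apply_def fun_eq_iff)

text \<open>The class of \<open>apc r (cst v)\<close> modulo the variables vanishes exactly if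
  \<open>v\<close> agrees, up to chains without constant terms, with the image of a vector from the
  next module; chains without constant terms are Koszul boundaries.\<close>

lemma boundary_iff:
  assumes v: "v \<in> TC r j"
  shows "apc r (cst v) \<in> Bd r 0 j \<longleftrightarrow> v \<in> td (Suc r) ` TC (Suc r) j"
proof
  assume "apc r (cst v) \<in> Bd r 0 j"
  then obtain y where y: "y \<in> VZ r (Suc 0) j" "apc r (cst v) = vd V y" by (auto simp: Bd_def)
  obtain h where h: "h \<in> VF (Suc r) (Suc 0) j" "apc r h = y" using apc_lift[OF y(1)] by blast
  have g: "cst v - vd V h \<in> VF (Suc r) 0 j" by (rule VF_diff[OF cst_in[OF v] vd_VF[OF h(1)]])
  have "apc r (cst v - vd V h) = 0" using y h by (simp add: apc_diff vd_apc[symmetric])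
  then have "cst v - vd V h \<in> VZ (Suc r) 0 j" using apc_ker[OF g] by blast
  then obtain f where f: "f \<in> VF (Suc (Suc r)) 0 j" "apc (Suc r) f = cst v - vd V h"
    using apc_lift by blast
  \<comment> \<open>Comparing constant terms in the equation for \<open>f\<close>: the boundary of
    \<open>h\<close> has none, so only \<open>v\<close> remains.\<close>
  have "v b = td (Suc r) (\<lambda>b. lk (f b {}) 0) b" for b
    using lookup_apc_0[of "Suc r" f b] const_part_cst[of v, THEN fun_cong, of b]
    unfolding f by (simp add: lookup_minus lookup_vd_0)
  then have "v = td (Suc r) (\<lambda>b. lk (f b {}) 0)" by blast
  then show "v \<in> td (Suc r) ` TC (Suc r) j" using const_part_TC[OF f(1)] by blast
next
  assume "v \<in> td (Suc r) ` TC (Suc r) j"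
  then obtain u where u: "u \<in> TC (Suc r) j" "v = td (Suc r) u" by blast
  note cu = apc_in[OF cst_in[OF u(1)]]
  have g: "cst v - apc (Suc r) (cst u) \<in> VF (Suc r) 0 j" by (rule VF_diff[OF cst_in[OF v] VZ_VF[OF cu]])
  have "lk ((cst v - apc (Suc r) (cst u)) b {}) 0 = 0" for b
    using const_part_cst[of v, THEN fun_cong, of b] u
    by (simp add: lookup_minus lookup_apc_0 const_part_cst)
  from VF_const_zero[OF g this]
  obtain h where h: "h \<in> VF (Suc r) (Suc 0) j" "vd V h = cst v - apc (Suc r) (cst u)" by blast
  have "apc r (apc (Suc r) (cst u)) = 0" using apc_ker[OF VZ_VF[OF cu]] cu by blast
  then have "apc r (cst v) = vd V (apc r h)" by (simp add: vd_apc h apc_diff)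
  then show "apc r (cst v) \<in> Bd r 0 j" using apc_in[OF h(1)] by (auto simp: Bd_def)
qed

text \<open>A vector of constants is matched with every chain congruent to its image modulo
  boundaries. Constant entries of the matrices are allowed for, as \<open>td\<close> records
  them.\<close>

lemma siso_tor:
  "siso fun_scale (Tcyc r j) (td (Suc r) ` TC (Suc r) j) vscale (Cyc r 0 j) (Bd r 0 j)"
proof (rule sisoI[where R = "\<lambda>v w. v \<in> Tcyc r j \<and> w \<in> Cyc r 0 j \<and> w - apc r (cst v) \<in> Bd r 0 j"], goal_cases)
  case (3 v w)
  then have "apc r (cst v) \<in> Bd r 0 j" using boundary_iff by (auto simp: Tcyc_def)
  then have "(w - apc r (cst v)) - (0 - apc r (cst v)) \<in> Bd r 0 j"
    using 3 Bd_diff Bd_zero by blast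
  then show ?case by simp
next
  case (4 v w)
  then have "w - (w - apc r (cst v)) \<in> Bd r 0 j" using Bd_diff by blast
  then show ?case using 4 boundary_iff by (simp add: Tcyc_def)
next
  case (5 v)
  then have v: "v \<in> TC r j" "r > 0 \<Longrightarrow> td r v = 0" by (auto simp: Tcyc_def)
  note w = apc_in[OF cst_in[OF v(1)]]
  have "\<exists>f\<in>VF r (Suc 0) j. vd V f = apc r (cst v)" if "r > 0"
    by (rule VF_const_zero[OF VZ_VF[OF w]]) (use that v in \<open>simp add: lookup_apc_0 const_part_cst\<close>)
  then have "apc r (cst v) \<in> Cyc r 0 j"
    using w vd_deg0[OF finite_V w] by (auto simp: Cyc_def)
  then show ?case using 5 Bd_zero by (intro exI[of _ "apc r (cst v)"]) simp
next
  case (6 w)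
  then have w: "w \<in> VZ r 0 j" "r > 0 \<Longrightarrow> \<exists>f\<in>VF r (Suc 0) j. vd V f = w" by (auto simp: Cyc_def)
  obtain f where f: "f \<in> VF (Suc r) 0 j" "apc r f = w" using apc_lift[OF w(1)] by blast
  \<comment> \<open>Removing its constant terms from a lift of \<open>w\<close> leaves a boundary,
    so the constants alone represent the class of \<open>w\<close>.\<close>
  define v where "v = (\<lambda>b. lk (f b {}) 0)"
  have v: "v \<in> TC r j" unfolding v_def by (rule const_part_TC[OF f(1)])
  have "\<exists>h\<in>VF (Suc r) (Suc 0) j. vd V h = f - cst v"
    by (rule VF_const_zero[OF VF_diff[OF f(1) cst_in[OF v]]]) (simp add: v_def cst_def lookup_minus)
  then obtain h where h: "h \<in> VF (Suc r) (Suc 0) j" "vd V h = f - cst v" by blast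
  have "w - apc r (cst v) = vd V (apc r h)" using h f by (simp add: vd_apc apc_diff)
  then have "w - apc r (cst v) \<in> Bd r 0 j" using apc_in[OF h(1)] by (auto simp: Bd_def)
  moreover have "td r v = 0" if r: "r > 0"
  proof
    fix c
    obtain g where "vd V g = w" using w(2)[OF r] by blast
    then show "td r v c = 0 c" using lookup_apc_0[of r f c] lookup_vd_0[of g c] by (simp add: f v_def)
  qed
  ultimately show ?case using 6 v by (auto simp: Tcyc_def)
next
  case 7
  have "0 \<in> TC r j" by (simp add: TC_def)
  then show ?case using Cyc_zero Bd_zero by (simp add: Tcyc_def td_zero)
next
  case (8 v w v' w')
  have eq: "(w - w') - apc r (cst (v - v')) = (w - apc r (cst v)) - (w' - apc r (cst v'))"
    by (simp add: cst_diff apc_diff)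
  show ?case unfolding eq using 8 by (blast intro: Cyc_diff Tcyc_diff Bd_diff)
next
  case (9 c v w)
  have eq: "vscale c w - apc r (cst (fun_scale c v)) = vscale c (w - apc r (cst v))"
    by (simp add: cst_scale apc_scale) (simp add: vscale_def fun_eq_iff algebra_simps)
  show ?case unfolding eq using 9 by (blast intro: Cyc_scale Tcyc_scale Bd_scale)
qed auto

lemma qdim_tor:
  "qdim vscale (Cyc 0 r j) (Bd 0 r j) n \<longleftrightarrow>
   n = vector_space.dim fun_scale (Tcyc r j) - vector_space.dim fun_scale (td (Suc r) ` TC (Suc r) j)"
proof -
  interpret W: vector_space "fun_scale :: 'k \<Rightarrow> _" by (rule vector_space_fun_scale)
  let ?B = "td (Suc r) ` TC (Suc r) j"
  have iso: "siso fun_scale (Tcyc r j) ?B vscale (Cyc 0 r j) (Bd 0 r j)"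
    by (rule siso_trans[OF siso_tor siso_Cyc])
  have subI: "W.subspace M" if "0 \<in> M" "\<And>x y. x \<in> M \<Longrightarrow> y \<in> M \<Longrightarrow> x - y \<in> M"
    "\<And>c x. x \<in> M \<Longrightarrow> fun_scale c x \<in> M" for M
  proof (rule W.subspaceI)
    fix x y assume "x \<in> M" "y \<in> M"
    then have "x - (0 - y) \<in> M" using that by blast
    then show "x + y \<in> M" by simp
  qed (use that in auto)
  have 0: "0 \<in> TC r j" for r by (simp add: TC_def)
  have Z: "W.subspace (Tcyc r j)"
    by (rule subI) (simp add: Tcyc_def 0 td_zero, erule (1) Tcyc_diff, erule Tcyc_scale)
  have B: "W.subspace ?B"
  proof (rule subI)
    show "0 \<in> ?B" using 0 td_zero by (metis image_eqI)
    fix x y assume "x \<in> ?B" "y \<in> ?B"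
    then obtain u v where "x = td (Suc r) u" "y = td (Suc r) v" "u \<in> TC (Suc r) j" "v \<in> TC (Suc r) j" by blast
    then show "x - y \<in> ?B" using TC_diff[of u "Suc r" j v] by (auto simp: td_diff[symmetric])
  next
    fix c x assume "x \<in> ?B"
    then obtain u where "x = td (Suc r) u" "u \<in> TC (Suc r) j" by blast
    then show "fun_scale c x \<in> ?B" using TC_scale[of u "Suc r" j c] by (auto simp: td_scale[symmetric])
  qed
  have BZ: "?B \<subseteq> Tcyc r j"
  proof
    fix x assume "x \<in> ?B"
    then obtain u where u: "x = td (Suc r) u" "u \<in> TC (Suc r) j" by blast
    note cu = apc_in[OF cst_in[OF u(2)]]
    have x: "x = (\<lambda>b. lk (apc (Suc r) (cst u) b {}) 0)"
      by (simp add: lookup_apc_0 const_part_cst u fun_eq_iff)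
    have "apc r (apc (Suc r) (cst u)) = 0" using apc_ker[OF VZ_VF[OF cu]] cu by blast
    then have "td r x c = 0" for c
      using lookup_apc_0[of r "apc (Suc r) (cst u)" c] by (simp add: x)
    then show "x \<in> Tcyc r j"
      using const_part_TC[OF VZ_VF[OF cu]] by (simp add: Tcyc_def x fun_eq_iff)
  qed
  let ?e = "\<lambda>b :: nat. \<lambda>c. if c = b then 1 else (0::'k)"
  let ?S = "?e ` {..<rk (Suc r)}"
  have "v \<in> W.span ?S" if v: "v \<in> Tcyc r j" for v
  proof -
    have "v = (\<Sum>b<rk (Suc r). fun_scale (v b) (?e b))"
    proof
      fix c
      have "(\<Sum>b<n. fun_scale (v b) (?e b)) c = (if c < n then v c else 0)" for n
        by (induction n) (auto simp: fun_scale_def less_Suc_eq)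
      then show "v c = (\<Sum>b<rk (Suc r). fun_scale (v b) (?e b)) c"
        using v by (auto simp: Tcyc_def TC_def)
    qed
    also have "\<dots> \<in> W.span ?S" by (intro W.span_sum W.span_scale W.span_base) auto
    finally show ?thesis .
  qed
  then have S: "Tcyc r j \<subseteq> W.span ?S" by blast
  have "qdim fun_scale (Tcyc r j) ?B n \<longleftrightarrow> n = W.dim (Tcyc r j) - W.dim ?B"
  proof
    show "n = W.dim (Tcyc r j) - W.dim ?B" if "qdim fun_scale (Tcyc r j) ?B n"
      by (rule W.qdim_unique[OF Z S _ B BZ that]) simp
    show "qdim fun_scale (Tcyc r j) ?B n" if "n = W.dim (Tcyc r j) - W.dim ?B"
      unfolding that by (rule W.qdim_dim[OF Z S _ B BZ]) simp
  qed
  moreover have "qdim vscale (Cyc 0 r j) (Bd 0 r j) n \<longleftrightarrow> qdim fun_scale (Tcyc r j) ?B n"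
    by (rule iffI) (erule siso_qdim[OF siso_sym[OF iso]], erule siso_qdim[OF iso])
  ultimately show ?thesis by simp
qed

end

section \<open>Existence of graded free resolutions\<close>

lemma nat_seq_incseq:
  fixes g :: "nat \<Rightarrow> nat"
  shows "\<exists>h. strict_mono h \<and> incseq (\<lambda>n. g (h n))"
proof -
  obtain f where f: "strict_mono f" "monoseq (\<lambda>n. g (f n))"
    using seq_monosub[of g] by blast
  show ?thesis
  proof (cases "incseq (\<lambda>n. g (f n))")
    case False
    then have dec: "g (f n) \<le> g (f m)" if "m \<le> n" for m n
      using f(2) that unfolding monoseq_def incseq_def by blast
    obtain N where N: "\<And>n. g (f N) \<le> g (f n)"
      using ex_has_least_nat[of "\<lambda>_. True" 0 "\<lambda>n. g (f n)"] by blast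
    have "g (f (N + n)) = g (f N)" for n using N dec[of N "N + n"] by (simp add: order_antisym)
    moreover have "strict_mono (\<lambda>n. f (N + n))"
      using f(1) by (simp add: strict_mono_def)
    ultimately show ?thesis by (intro exI[of _ "\<lambda>n. f (N + n)"]) (simp add: incseq_def)
  qed (use f in blast)
qed

text \<open>Subsequences are taken for one coordinate after another; monotonicity in the earlier
  coordinates survives.\<close>

lemma expo_seq_incseq:
  fixes f :: "nat \<Rightarrow> expo"
  assumes "finite V"
  shows "\<exists>h. strict_mono h \<and> (\<forall>i\<in>V. incseq (\<lambda>n. lk (f (h n)) i))"
  using assms
proof (induction V rule: finite_induct)
  case empty
  show ?case by (intro exI[of _ id]) (simp add: strict_mono_def)
next
  case (insert i V)
  then obtain h where h: "strict_mono h" "\<forall>i\<in>V. incseq (\<lambda>n. lk (f (h n)) i)" by blast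
  obtain k where k: "strict_mono k" "incseq (\<lambda>n. lk (f (h (k n))) i)"
    using nat_seq_incseq[of "\<lambda>n. lk (f (h n)) i"] by blast
  have "incseq (\<lambda>n. lk (f (h (k n))) j)" if "j \<in> V" for j
    using h(2) that strict_mono_mono[OF k(1)] unfolding incseq_def mono_def by blast
  moreover have "strict_mono (\<lambda>n. h (k n))"
    using h(1) k(1) by (simp add: strict_mono_def)
  ultimately show ?case using k(2) by (intro exI[of _ "\<lambda>n. h (k n)"]) auto
qed

text \<open>The minimal elements form an antichain. An infinite one would contain a sequence with a
  subsequence increasing in all coordinates, hence two comparable elements.\<close>

lemma dickson:
  assumes V: "finite V" and U: "\<And>u. u \<in> U \<Longrightarrow> ks u \<subseteq> V"
  shows "\<exists>D\<subseteq>U. finite D \<and> (\<forall>u\<in>U. \<exists>d\<in>D. d adds u)"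
proof -
  define D where "D = {u \<in> U. \<forall>w\<in>U. w adds u \<longrightarrow> w = u}"
  have "\<exists>d\<in>D. d adds u" if "u \<in> U" for u
    using that
  proof (induction "tdeg u" arbitrary: u rule: less_induct)
    case less
    show ?case
    proof (cases "u \<in> D")
      case False
      then obtain w where w: "w \<in> U" "w adds u" "w \<noteq> u" using less.prems by (auto simp: D_def)
      then have "tdeg w < tdeg u" using adds_tdeg adds_tdeg_eq by (metis le_neq_implies_less)
      then show ?thesis using less.hyps w adds_trans by blast
    qed (use adds_refl in blast)
  qed
  moreover have "finite D"
  proof (rule ccontr)
    assume "infinite D"
    then obtain f :: "nat \<Rightarrow> expo" where f: "inj f" "range f \<subseteq> D"
      using infinite_countable_subset by blast
    obtain h where h: "strict_mono h" "\<forall>i\<in>V. incseq (\<lambda>n. lk (f (h n)) i)"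
      using expo_seq_incseq[OF V] by blast
    have fU: "f n \<in> U" "ks (f n) \<subseteq> V" for n using f(2) U by (auto simp: D_def)
    have "f (h 0) adds f (h 1)"
      unfolding adds_def
    proof
      fix i show "lk (f (h 0)) i \<le> lk (f (h 1)) i"
      proof (cases "i \<in> V")
        case True
        then show ?thesis using h(2) by (simp add: incseq_def)
      next
        case False
        then have "lk (f (h 0)) i = 0" using fU(2) by (auto simp: in_keys_iff subset_iff)
        then show ?thesis by simp
      qed
    qed
    moreover have "f (h 1) \<in> D" using f(2) by blast
    ultimately have "f (h 0) = f (h 1)" using fU(1) by (auto simp: D_def)
    then have "h 0 = h 1" using f(1) by (simp add: inj_eq)
    then show False using h(1) by (simp add: strict_mono_eq)
  qed
  moreover have "D \<subseteq> U" by (auto simp: D_def)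
  ultimately show ?thesis by blast
qed

text \<open>Provides the termination measure for division by leading terms within one
  degree.\<close>

lemma finite_expo_tdeg:
  assumes V: "finite V"
  shows "finite {u. ks u \<subseteq> V \<and> tdeg u = e}"
proof -
  let ?f = "\<lambda>u. restrict (lk u) V"
  have le: "lk u i \<le> e" if "ks u \<subseteq> V" "tdeg u = e" "i \<in> V" for u i
  proof -
    have "lk u i \<le> sum (lk u) V" using V that(3) by (intro member_le_sum) auto
    then show ?thesis using tdeg_sum[OF V that(1)] that(2) by simp
  qed
  have "inj_on ?f {u. ks u \<subseteq> V \<and> tdeg u = e}"
  proof (rule inj_onI, rule poly_mapping_eqI)
    fix u w i assume a: "u \<in> {u. ks u \<subseteq> V \<and> tdeg u = e}" "w \<in> {u. ks u \<subseteq> V \<and> tdeg u = e}" "?f u = ?f w"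
    show "lk u i = lk w i"
    proof (cases "i \<in> V")
      case True
      then show ?thesis using fun_cong[OF a(3), of i] by simp
    next
      case False
      then have "i \<notin> ks u" "i \<notin> ks w" using a by auto
      then show ?thesis by (simp add: in_keys_iff)
    qed
  qed
  moreover have "?f ` {u. ks u \<subseteq> V \<and> tdeg u = e} \<subseteq> PiE V (\<lambda>_. {..e})"
    using le by auto
  moreover have "finite (PiE V (\<lambda>_. {..e}))" using V by (intro finite_PiE) auto
  ultimately show ?thesis using finite_imageD[of ?f] finite_subset by blast
qed

section \<open>Finite generation of graded ideals and graded submodules\<close>

definition graded_ideal :: "nat set \<Rightarrow> 'k::field mpoly set \<Rightarrow> bool" where
  "graded_ideal V Q \<longleftrightarrow> ideal Q (mpoly_ring V) \<and> (\<forall>p\<in>Q. \<forall>d. hcomp d p \<in> Q)"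

text \<open>Hilbert's basis theorem by leading exponents: Dickson's lemma gives finitely many
  homogeneous elements whose leading exponents divide all the others, and division by them leaves no
  remainder. Leading refers to the linear order on finitely supported maps, which is compatible with
  addition.\<close>

lemma graded_ideal_generators:
  assumes V: "finite V" and Q: "graded_ideal V (Q :: 'k::field mpoly set)"
  shows "\<exists>D g e. finite D \<and> (\<forall>d\<in>D. g d \<in> Q \<and> homogeneous (e d) (g d)) \<and>
    (\<forall>p\<in>Q. \<exists>a. (\<forall>d::expo. a d \<in> Pol V) \<and> p = (\<Sum>d\<in>D. a d * g d))"
proof -
  have id: "ideal Q (mpoly_ring V)" and hc: "\<And>p d. p \<in> Q \<Longrightarrow> hcomp d p \<in> Q"
    using Q by (auto simp: graded_ideal_def)
  note QD = ideal_mpoly_ringD[OF id]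
  define L where "L = {Max (ks p) | p. p \<in> Q \<and> p \<noteq> 0 \<and> (\<exists>d. homogeneous d p)}"
  have Max_ks: "Max (ks p) \<in> ks p" if "p \<noteq> 0" for p :: "'k mpoly"
    using that by (intro Max_in) auto
  have "ks u \<subseteq> V" if "u \<in> L" for u
  proof -
    obtain p where p: "p \<in> Q" "p \<noteq> 0" "u = Max (ks p)" using \<open>u \<in> L\<close> by (auto simp: L_def)
    have "u \<in> ks p" unfolding p(3) by (rule Max_ks[OF p(2)])
    moreover have "p \<in> Pol V" by (rule subsetD[OF QD(1) p(1)])
    ultimately show ?thesis unfolding Pol_iff by blast
  qed
  from dickson[of V L, OF V this] obtain D where D: "D \<subseteq> L" "finite D" "\<forall>u\<in>L. \<exists>d\<in>D. d adds u"
    by blast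
  have "\<forall>d\<in>D. \<exists>p e. p \<in> Q \<and> p \<noteq> 0 \<and> homogeneous e p \<and> Max (ks p) = d" using D(1) unfolding L_def by blast
  then obtain g e where g: "\<And>d. d \<in> D \<Longrightarrow> g d \<in> Q" "\<And>d. d \<in> D \<Longrightarrow> g d \<noteq> 0"
    "\<And>d. d \<in> D \<Longrightarrow> homogeneous (e d) (g d)" "\<And>d. d \<in> D \<Longrightarrow> Max (ks (g d)) = d" by metis
  define W where "W = {\<Sum>d\<in>D. a d * g d | a. \<forall>d. a d \<in> Pol V}"
  have W0: "0 \<in> W" unfolding W_def by (intro CollectI exI[of _ "\<lambda>_. 0"]) simp
  have W_add: "p + q \<in> W" if "p \<in> W" "q \<in> W" for p q
  proof -
    obtain a b where "\<forall>d. a d \<in> Pol V" "\<forall>d. b d \<in> Pol V" "p = (\<Sum>d\<in>D. a d * g d)" "q = (\<Sum>d\<in>D. b d * g d)"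
      using \<open>p \<in> W\<close> \<open>q \<in> W\<close> by (auto simp: W_def)
    then show ?thesis unfolding W_def
      by (intro CollectI exI[of _ "\<lambda>d. a d + b d"]) (auto simp: Pol_add distrib_right sum.distrib)
  qed
  have W_g: "a * g d \<in> W" if "d \<in> D" "a \<in> Pol V" for a d
    unfolding W_def
    by (intro CollectI exI[of _ "\<lambda>d'. if d' = d then a else 0"])
      (use that D(2) in \<open>auto simp: if_distrib[of "\<lambda>x. x * _"] cong: if_cong\<close>)
  have hom: "p \<in> W" if "p \<in> Q" "homogeneous (int n) p" for p n
    using that
  \<comment> \<open>Counts the exponents of degree \<open>n\<close> up to the leading one. The
    conjunct \<open>p \<noteq> 0\<close> gives the zero polynomial measure 0, where
    \<open>Max\<close> would be applied to the empty set.\<close>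
  proof (induction "card {w. ks w \<subseteq> V \<and> tdeg w = n \<and> (p \<noteq> 0 \<and> w \<le> Max (ks p))}" arbitrary: p rule: less_induct)
    case less
    show ?case
    proof (cases "p = 0")
      case False
      define u where "u = Max (ks p)"
      have u: "u \<in> ks p" "ks u \<subseteq> V" "tdeg u = n"
        using Max_ks[OF False] less.prems subsetD[OF QD(1) less.prems(1)]
        unfolding u_def Pol_iff homogeneous_iff by auto
      have "u \<in> L" using False less.prems by (auto simp: L_def u_def)
      then obtain d where d: "d \<in> D" "d adds u" using D(3) by blast
      have dk: "d \<in> ks (g d)" using Max_ks[OF g(2)[OF d(1)]] g(4)[OF d(1)] by simp
      define t where "t = u - d"
      have t: "t + d = u" using d by (simp add: t_def adds_minus')
      have tV: "ks t \<subseteq> V" using keys_minus_subset[of u d] u by (auto simp: t_def)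
      \<comment> \<open>Ratio of the leading coefficients, so that the leading term cancels in
        \<open>p - q\<close>.\<close>
      define c where "c = lk p u / lk (g d) d"
      define q where "q = sing t c * g d"
      have q: "q \<in> W" "q \<in> Q"
        using W_g[OF d(1)] QD(4)[OF g(1)[OF d(1)]] tV by (auto simp: q_def Pol_single)
      have "int (tdeg d) = e d" using g(3)[OF d(1)] dk by (simp add: homogeneous_iff)
      then have "int (tdeg t) + e d = int n" using t u(3) by (metis of_nat_add tdeg_add)
      moreover have "homogeneous (int (tdeg t) + e d) q"
        unfolding q_def by (rule homogeneous_mult[OF _ g(3)[OF d(1)]]) (simp add: homogeneous_single)
      ultimately have hq: "homogeneous (int n) q" by simp
      have q_le: "w \<le> u" if w: "w \<in> ks q" for w
      proof -
        obtain x y where xy: "x \<in> ks (sing t c)" "y \<in> ks (g d)" "w = x + y"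
          using keys_times_subset w unfolding q_def by blast
        then have "x = t" by (simp split: if_splits)
        moreover have "y \<le> d" using xy(2) g(4)[OF d(1)] Max_ge[OF finite_keys xy(2)] by simp
        ultimately show ?thesis using xy(3) t by (metis add_left_mono)
      qed
      have lq: "lk q u = lk p u"
        unfolding q_def lookup_mono_times using dk t
        by (auto simp: c_def t[symmetric] in_keys_iff)
      define p' where "p' = p - q"
      have p': "p' \<in> Q" "homogeneous (int n) p'"
        using QD(6) less.prems q hq by (auto simp: p'_def homogeneous_diff)
      have lt: "w < u" if w: "w \<in> ks p'" for w
      proof -
        have "w \<in> ks p \<or> w \<in> ks q" using w by (auto simp: p'_def in_keys_iff lookup_minus)
        then have "w \<le> u" using q_le Max_ge[of "ks p" w] by (auto simp: u_def)
        moreover have "w \<noteq> u" using w lq by (auto simp: p'_def in_keys_iff lookup_minus)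
        ultimately show ?thesis by simp
      qed
      have "p' \<in> W"
      proof (rule less.hyps[OF _ p'])
        let ?S = "\<lambda>p. {w. ks w \<subseteq> V \<and> tdeg w = n \<and> (p \<noteq> 0 \<and> w \<le> Max (ks p))}"
        have "finite (?S p)" by (rule finite_subset[OF _ finite_expo_tdeg[OF V, of n]]) auto
        moreover have "u \<in> ?S p" using u False by (auto simp: u_def)
        moreover have "?S p' \<subseteq> ?S p - {u}"
        proof
          fix w assume w: "w \<in> ?S p'"
          then have w': "p' \<noteq> 0" "w \<le> Max (ks p')" "ks w \<subseteq> V" "tdeg w = n" by auto
          have "Max (ks p') < u" by (rule lt[OF Max_ks[OF w'(1)]])
          with w'(2) have "w < u" by (rule order_le_less_trans)
          then have "w \<le> u" "w \<noteq> u" by simp_all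
          then have "w \<le> Max (ks p)" "w \<noteq> u" unfolding u_def by blast+
          then show "w \<in> ?S p - {u}" using w'(3,4) False by blast
        qed
        ultimately show "card (?S p') < card (?S p)"
          by (meson card_Diff1_less card_mono finite_Diff order_le_less_trans)
      qed
      then have "p' + q \<in> W" using W_add q by blast
      then show ?thesis by (simp add: p'_def)
    qed (use W0 in simp)
  qed
  have "p \<in> W" if p: "p \<in> Q" for p
  proof -
    have "(\<Sum>d\<in>(\<lambda>u. int (tdeg u)) ` ks p. hcomp d p) \<in> W"
    proof -
      have "(\<Sum>d\<in>A. hcomp d p) \<in> W" if "A \<subseteq> range int" "finite A" for A
        using that(2,1)
      proof (induction A rule: finite_induct)
        case (insert x A)
        then obtain n where "x = int n" by blast
        then have "hcomp x p \<in> W" using hom[OF hc[OF p]] homogeneous_hcomp by blast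
        then show ?case using insert W_add by simp
      qed (use W0 in simp)
      from this[of "(\<lambda>u. int (tdeg u)) ` ks p"] show ?thesis by (simp add: image_subset_iff)
    qed
    then show ?thesis using sum_hcomp[of p] by simp
  qed
  note gen = this
  show ?thesis
  proof (rule exI[of _ D], rule exI[of _ g], rule exI[of _ e], intro conjI ballI)
    fix p assume "p \<in> Q"
    from gen[OF this] show "\<exists>a. (\<forall>d. a d \<in> Pol V) \<and> p = (\<Sum>d\<in>D. a d * g d)"
      unfolding W_def mem_Collect_eq by (elim exE conjE) (intro exI conjI)
  qed (use D(2) g(1,3) in simp_all)
qed

definition gsub :: "nat set \<Rightarrow> nat \<Rightarrow> (nat \<Rightarrow> int) \<Rightarrow> (nat \<Rightarrow> 'k::field mpoly) set \<Rightarrow> bool" where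
  "gsub V m s M \<longleftrightarrow> submod V m M \<and> (\<forall>f\<in>M. \<forall>d. (\<lambda>b. hcomp (d - s b) (f b)) \<in> M)"

text \<open>Induction on the rank: the last coordinates form a graded ideal, and the vectors with
  last coordinate 0 form a graded submodule of smaller rank.\<close>

lemma gsub_generators:
  fixes M :: "(nat \<Rightarrow> 'k::field mpoly) set"
  assumes V: "finite V" and M: "gsub V m s M"
  shows "\<exists>p G t. (\<forall>k<p. G k \<in> M \<and> (\<forall>b. homogeneous (t k - s b) (G k b))) \<and>
    (\<forall>f\<in>M. \<exists>a\<in>free_module V p. f = (\<lambda>b. \<Sum>k<p. G k b * a k))"
  using M
proof (induction m arbitrary: M)
  case 0
  have "f = 0" if "f \<in> M" for f
    using that 0 by (auto simp: gsub_def submod_def free_module_iff fun_eq_iff subset_iff)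
  moreover have "(0 :: nat \<Rightarrow> 'k mpoly) \<in> free_module V 0" by (simp add: free_module_iff)
  ultimately show ?case by (intro exI[of _ "0::nat"]) (auto simp: fun_eq_iff)
next
  case (Suc m)
  have sub: "submod V (Suc m) M" and hc: "\<And>f d. f \<in> M \<Longrightarrow> (\<lambda>b. hcomp (d - s b) (f b)) \<in> M"
    using Suc.prems by (auto simp: gsub_def)
  note MD = submodD[OF sub]
  define Q where "Q = (\<lambda>f. f m) ` M"
  have "graded_ideal V Q"
    unfolding graded_ideal_def
  proof (intro conjI ballI allI ideal_mpoly_ringI)
    show "Q \<subseteq> Pol V" using MD(1) by (auto simp: Q_def free_module_iff)
    show "0 \<in> Q" unfolding Q_def using MD(2) by (intro image_eqI[of _ _ 0]) auto
    show "p + q \<in> Q" if "p \<in> Q" "q \<in> Q" for p q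
    proof -
      obtain f g where "f \<in> M" "g \<in> M" "p = f m" "q = g m" using \<open>p \<in> Q\<close> \<open>q \<in> Q\<close> by (auto simp: Q_def)
      then show ?thesis unfolding Q_def by (intro image_eqI[of _ _ "f + g"]) (auto intro: MD(3))
    qed
    show "a * p \<in> Q" if "p \<in> Q" "a \<in> Pol V" for p a
    proof -
      obtain f where "f \<in> M" "p = f m" using \<open>p \<in> Q\<close> by (auto simp: Q_def)
      then show ?thesis unfolding Q_def
        by (intro image_eqI[of _ _ "\<lambda>b. a * f b"]) (use that in \<open>auto intro: MD(4)\<close>)
    qed
    show "hcomp d p \<in> Q" if "p \<in> Q" for p d
    proof -
      obtain f where "f \<in> M" "p = f m" using \<open>p \<in> Q\<close> by (auto simp: Q_def)
      then show ?thesis unfolding Q_def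
        by (intro image_eqI[of _ _ "\<lambda>b. hcomp (d + s m - s b) (f b)"]) (auto intro: hc)
    qed
  qed
  from graded_ideal_generators[OF V this] obtain D :: "expo set" and g e where
    D: "finite D" and g: "\<And>d. d \<in> D \<Longrightarrow> g d \<in> Q" "\<And>d. d \<in> D \<Longrightarrow> homogeneous (e d) (g d)"
    and gen: "\<And>p. p \<in> Q \<Longrightarrow> \<exists>a. (\<forall>d. a d \<in> Pol V) \<and> p = (\<Sum>d\<in>D. a d * g d)" by blast
  obtain \<phi> l where \<phi>: "bij_betw \<phi> {..<l::nat} D"
    using ex_bij_betw_nat_finite[OF D] atLeast0LessThan by metis
  \<comment> \<open>A vector of degree \<open>t\<close> has degree \<open>t - s b\<close> in
    coordinate \<open>b\<close>; a last coordinate of degree \<open>e d\<close> forces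
    \<open>t = e d + s m\<close>.\<close>
  have "\<exists>f. f \<in> M \<and> f m = g d \<and> (\<forall>b. homogeneous (e d + s m - s b) (f b))" if d: "d \<in> D" for d
  proof -
    obtain f where "f \<in> M" "f m = g d" using g(1)[OF d] by (auto simp: Q_def)
    then show ?thesis
      by (intro exI[of _ "\<lambda>b. hcomp (e d + s m - s b) (f b)"])
        (use hc g(2)[OF d] in \<open>auto simp: homogeneous_hcomp hcomp_homogeneous\<close>)
  qed
  then obtain F where F: "\<And>d. d \<in> D \<Longrightarrow> F d \<in> M" "\<And>d. d \<in> D \<Longrightarrow> F d m = g d"
    "\<And>d b. d \<in> D \<Longrightarrow> homogeneous (e d + s m - s b) (F d b)" by metis
  define M' where "M' = {f \<in> M. f m = 0}"
  have "gsub V m s M'"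
    unfolding gsub_def submod_def
  proof (intro conjI ballI allI)
    show "M' \<subseteq> free_module V m"
    proof
      fix f assume f: "f \<in> M'"
      then have "f b = 0" if "b \<ge> m" for b
        using that MD(1) by (cases "b = m") (auto simp: M'_def free_module_iff subset_iff)
      then show "f \<in> free_module V m" using f MD(1) by (auto simp: M'_def free_module_iff)
    qed
  qed (use MD hc in \<open>auto simp: M'_def\<close>)
  from Suc.IH[OF this] obtain p G t where
    G: "\<And>k. k < p \<Longrightarrow> G k \<in> M'" "\<And>k b. k < p \<Longrightarrow> homogeneous (t k - s b) (G k b)"
    and gen': "\<And>f. f \<in> M' \<Longrightarrow> \<exists>a\<in>free_module V p. f = (\<lambda>b. \<Sum>k<p. G k b * a k)" by blast
  define H where "H k = (if k < p then G k else F (\<phi> (k - p)))" for k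
  define t' where "t' k = (if k < p then t k else e (\<phi> (k - p)) + s m)" for k
  have \<phi>D: "\<phi> k \<in> D" if "k < l" for k using \<phi> that by (auto simp: bij_betw_def)
  have "H k \<in> M \<and> (\<forall>b. homogeneous (t' k - s b) (H k b))" if "k < p + l" for k
    using that G F \<phi>D by (auto simp: H_def t'_def M'_def)
  moreover have "\<exists>a\<in>free_module V (p + l). f = (\<lambda>b. \<Sum>k<p + l. H k b * a k)" if f: "f \<in> M" for f
  proof -
    obtain a where a: "\<And>d. a d \<in> Pol V" "f m = (\<Sum>d\<in>D. a d * g d)"
      using gen[of "f m"] f by (auto simp: Q_def)
    \<comment> \<open>A combination of the lifts with the same last coordinate as \<open>f\<close>;
      the difference falls under the induction hypothesis.\<close>
    define h where "h = (\<lambda>b. \<Sum>d\<in>D. a d * F d b)"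
    have "h \<in> M" unfolding h_def by (rule submod_sum[OF sub]) (use a F in \<open>auto intro: MD(4)\<close>)
    moreover have "h m = f m" using a F by (simp add: h_def)
    ultimately have "f - h \<in> M'" using f MD(5) by (simp add: M'_def)
    from gen'[OF this] obtain c where c: "c \<in> free_module V p" "f - h = (\<lambda>b. \<Sum>k<p. G k b * c k)" by blast
    let ?a = "\<lambda>k. if k < p then c k else if k < p + l then a (\<phi> (k - p)) else 0"
    have "f b = (\<Sum>k<p + l. H k b * ?a k)" for b
    proof -
      have "h b = (\<Sum>k<l. a (\<phi> k) * F (\<phi> k) b)"
        unfolding h_def by (rule sum.reindex_bij_betw[OF \<phi>, symmetric])
      moreover have "f b = (\<Sum>k<p. G k b * c k) + h b"
        using fun_cong[OF c(2), of b] by (simp add: algebra_simps)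
      ultimately show ?thesis by (simp add: sum_lessThan_add H_def mult.commute)
    qed
    moreover have "?a \<in> free_module V (p + l)" using c(1) a(1) by (auto simp: free_module_iff)
    ultimately show ?thesis by (intro bexI[of _ ?a] ext)
  qed
  ultimately show ?case by blast
qed

text \<open>
  A homogeneous matrix \<open>(m, s, n, t, D)\<close>: \<open>D\<close> has \<open>m\<close> rows of degrees \<open>s\<close> and \<open>n\<close> columns of
  degrees \<open>t\<close>.
\<close>

type_synonym 'k hmatrix = "nat \<times> (nat \<Rightarrow> int) \<times> nat \<times> (nat \<Rightarrow> int) \<times> (nat \<Rightarrow> nat \<Rightarrow> 'k mpoly)"

definition hmat :: "nat set \<Rightarrow> 'k::field hmatrix \<Rightarrow> bool" where
  "hmat V x = (case x of (m, s, n, t, D) \<Rightarrow>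
     \<forall>c<m. \<forall>b<n. D c b \<in> Pol V \<and> homogeneous (t b - s c) (D c b))"

lemma hmat_onto:
  fixes M :: "(nat \<Rightarrow> 'k::field mpoly) set"
  assumes V: "finite V" and M: "gsub V m s M"
  shows "\<exists>n t D. hmat V (m, s, n, t, D) \<and> mat_apply m n D ` free_module V n = M"
proof -
  have sub: "submod V m M" using M by (simp add: gsub_def)
  note MD = submodD[OF sub]
  obtain n G t where G: "\<And>k. k < n \<Longrightarrow> G k \<in> M" "\<And>k b. k < n \<Longrightarrow> homogeneous (t k - s b) (G k b)"
    and gen: "\<And>f. f \<in> M \<Longrightarrow> \<exists>a\<in>free_module V n. f = (\<lambda>b. \<Sum>k<n. G k b * a k)"
    using gsub_generators[OF assms] by blast
  define D where "D c b = G b c" for c b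
  have app: "mat_apply m n D a = (\<lambda>c. \<Sum>k<n. G k c * a k)" if "a \<in> free_module V n" for a
  proof
    fix c
    have "G k c = 0" if "c \<ge> m" "k < n" for k
      using that MD(1) G(1)[of k] by (auto simp: free_module_iff)
    then show "mat_apply m n D a c = (\<Sum>k<n. G k c * a k)"
      by (auto simp: mat_apply_def D_def)
  qed
  have "hmat V (m, s, n, t, D)"
    using G MD(1) by (auto simp: hmat_def D_def free_module_iff subset_iff)
  moreover have "mat_apply m n D ` free_module V n = M"
  proof
    show "mat_apply m n D ` free_module V n \<subseteq> M"
    proof clarify
      fix a :: "nat \<Rightarrow> 'k mpoly" assume a: "a \<in> free_module V n"
      have "(\<lambda>c. \<Sum>k<n. a k * G k c) \<in> M"
        by (rule submod_sum[OF sub]) (use a G in \<open>auto intro: MD(4) simp: free_module_iff\<close>)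
      then show "mat_apply m n D a \<in> M" by (simp add: app[OF a] mult.commute)
    qed
    show "M \<subseteq> mat_apply m n D ` free_module V n"
    proof
      fix f assume "f \<in> M"
      then obtain a where "a \<in> free_module V n" "f = (\<lambda>b. \<Sum>k<n. G k b * a k)" using gen by blast
      then show "f \<in> mat_apply m n D ` free_module V n" by (intro image_eqI[of _ _ a]) (simp_all add: app)
    qed
  qed
  ultimately show ?thesis by blast
qed

lemma gsub_kernel:
  fixes D :: "nat \<Rightarrow> nat \<Rightarrow> 'k::field mpoly"
  assumes D: "hmat V (m, s, n, t, D)"
  shows "gsub V n t {a \<in> free_module V n. mat_apply m n D a = 0}"
proof -
  note F = submodD[OF submod_free[of V n]]
  have D': "homogeneous (t b - s c) (D c b)" if "c < m" "b < n" for b c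
    using D that by (simp add: hmat_def)
  have add: "mat_apply m n D (f + g) = mat_apply m n D f + mat_apply m n D g" for f g
    by (auto simp: mat_apply_def fun_eq_iff algebra_simps sum.distrib)
  have mult: "mat_apply m n D (\<lambda>b. p * f b) = (\<lambda>c. p * mat_apply m n D f c)" for f :: "nat \<Rightarrow> 'k mpoly" and p
    by (auto simp: mat_apply_def fun_eq_iff sum_distrib_left algebra_simps)
  have hc: "mat_apply m n D (\<lambda>b. hcomp (d - t b) (f b)) c = hcomp (d - s c) (mat_apply m n D f c)" for d f c
  proof (cases "c < m")
    case True
    have "D c b * hcomp (d - t b) (f b) = hcomp (d - s c) (D c b * f b)" if "b < n" for b
      using hcomp_mult[OF D'[OF True that], of "d - s c" "f b"] by simp
    then show ?thesis using True by (simp add: mat_apply_def hcomp_sum)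
  qed (simp add: mat_apply_def)
  show ?thesis
    unfolding gsub_def submod_def
  proof (intro conjI ballI allI)
    show "0 \<in> {a \<in> free_module V n. mat_apply m n D a = 0}"
      using F(2) by (auto simp: mat_apply_def fun_eq_iff)
  next
    fix f g assume "f \<in> {a \<in> free_module V n. mat_apply m n D a = 0}" "g \<in> {a \<in> free_module V n. mat_apply m n D a = 0}"
    then show "f + g \<in> {a \<in> free_module V n. mat_apply m n D a = 0}" using F(3) add by auto
  next
    fix f :: "nat \<Rightarrow> 'k mpoly" and p :: "'k mpoly" assume "f \<in> {a \<in> free_module V n. mat_apply m n D a = 0}" "p \<in> Pol V"
    then show "(\<lambda>b. p * f b) \<in> {a \<in> free_module V n. mat_apply m n D a = 0}"
      using F(4) mult by (auto simp: fun_eq_iff)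
  next
    fix f d assume f: "f \<in> {a \<in> free_module V n. mat_apply m n D a = 0}"
    then have "(\<lambda>b. hcomp (d - t b) (f b)) \<in> free_module V n"
      by (auto simp: free_module_iff intro: Pol_hcomp)
    moreover have "mat_apply m n D (\<lambda>b. hcomp (d - t b) (f b)) = 0"
      using f by (auto simp: hc fun_eq_iff)
    ultimately show "(\<lambda>b. hcomp (d - t b) (f b)) \<in> {a \<in> free_module V n. mat_apply m n D a = 0}" by simp
  qed auto
qed

text \<open>Kernels of homogeneous matrices are again graded submodules, so dependent choice covers
  them one after another.\<close>

lemma graded_free_resolution_exists:
  assumes V: "finite V" and I: "graded_ideal V (I :: 'k::field mpoly set)"
  shows "\<exists>F. graded_free_resolution V I F"
proof -
  have id: "ideal I (mpoly_ring V)" and hc: "\<And>p d. p \<in> I \<Longrightarrow> hcomp d p \<in> I"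
    using I by (auto simp: graded_ideal_def)
  note ID = ideal_mpoly_ringD[OF id]
  \<comment> \<open>The ideal as a submodule of a free module of rank 1, so that the augmentation is
    obtained like the later matrices.\<close>
  define M where "M = {a. a 0 \<in> I \<and> (\<forall>b\<ge>1. a (b::nat) = 0)}"
  have "gsub V 1 (\<lambda>_. 0) M"
    unfolding gsub_def submod_def
  proof (intro conjI ballI allI)
    show "M \<subseteq> free_module V 1"
    proof
      fix f assume f: "f \<in> M"
      have "f b \<in> Pol V" for b using f ID(1) by (cases "b = 0") (auto simp: M_def)
      then show "f \<in> free_module V 1" using f by (auto simp: M_def free_module_iff)
    qed
  qed (use ID hc in \<open>auto simp: M_def\<close>)
  from hmat_onto[OF V this] obtain n0 t0 D0 where
    0: "hmat V (1, \<lambda>_. 0, n0, t0, D0)" "mat_apply 1 n0 D0 ` free_module V n0 = M" by blast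
  define step :: "'k hmatrix \<Rightarrow> 'k hmatrix \<Rightarrow> bool" where
    "step x y = (case x of (m, s, n, t, D) \<Rightarrow> case y of (m', s', n', t', D') \<Rightarrow> m' = n \<and> s' = t \<and>
      {a \<in> free_module V n. mat_apply m n D a = 0} = mat_apply n n' D' ` free_module V n')" for x y
  have "\<exists>f. \<forall>r. (hmat V (f r) \<and> (r = 0 \<longrightarrow> f r = (1, \<lambda>_. 0, n0, t0, D0))) \<and> step (f r) (f (Suc r))"
  proof (rule dependent_nat_choice)
    show "\<exists>x. hmat V x \<and> (0 = 0 \<longrightarrow> x = (1, \<lambda>_. 0, n0, t0, D0))" using 0 by blast
    fix x :: "'k hmatrix" and r :: nat assume "hmat V x \<and> (r = 0 \<longrightarrow> x = (1, \<lambda>_. 0, n0, t0, D0))"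
    moreover obtain m s n t D where x: "x = (m, s, n, t, D)" by (cases x)
    ultimately obtain n' t' D' where "hmat V (n, t, n', t', D')"
      "mat_apply n n' D' ` free_module V n' = {a \<in> free_module V n. mat_apply m n D a = 0}"
      using hmat_onto[OF V gsub_kernel] by blast
    then show "\<exists>y. (hmat V y \<and> (Suc r = 0 \<longrightarrow> y = (1, \<lambda>_. 0, n0, t0, D0))) \<and> step x y"
      by (intro exI[of _ "(n, t, n', t', D')"]) (auto simp: step_def x)
  qed
  then obtain f where f: "\<And>r. hmat V (f r)" "f 0 = (1, \<lambda>_. 0, n0, t0, D0)" "\<And>r. step (f r) (f (Suc r))"
    by blast
  define rk where "rk r = fst (snd (snd (f r)))" for r
  define sh where "sh r = fst (snd (snd (snd (f r))))" for r
  define D where "D r = snd (snd (snd (snd (f r))))" for r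
  have f_Suc: "f (Suc r) = (rk r, sh r, rk (Suc r), sh (Suc r), D (Suc r))" for r
    using f(3)[of r] unfolding step_def rk_def sh_def D_def by (auto split: prod.splits)
  have rk0: "rk 0 = n0" "sh 0 = t0" "D 0 = D0" using f(2) by (simp_all add: rk_def sh_def D_def)
  have D_Suc: "D (Suc r) c b \<in> Pol V \<and> homogeneous (sh (Suc r) b - sh r c) (D (Suc r) c b)"
    if "c < rk r" "b < rk (Suc r)" for r c b
    using f(1)[of "Suc r"] that unfolding f_Suc hmat_def by simp
  have ex0: "{a \<in> free_module V n0. mat_apply 1 n0 D0 a = 0} = mat_apply (rk 0) (rk 1) (D 1) ` free_module V (rk 1)"
    using f(3)[of 0] f_Suc[of 0] by (simp add: f(2) step_def)
  have exS: "{a \<in> free_module V (rk (Suc r)). mat_apply (rk r) (rk (Suc r)) (D (Suc r)) a = 0} =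
      mat_apply (rk (Suc r)) (rk (Suc (Suc r))) (D (Suc (Suc r))) ` free_module V (rk (Suc (Suc r)))" for r
    using f(3)[of "Suc r"] by (simp add: f_Suc step_def)
  \<comment> \<open>The first matrix has a single row and becomes the augmentation; the
    differentials therefore start with the second one.\<close>
  define F where "F = \<lparr>free_rank = rk, shift = sh, augm = D0 0, diff = \<lambda>r. D (Suc r)\<rparr>"
  have aug: "mat_apply 1 n0 D0 a = (\<lambda>c. if c = 0 then augm_map F a else 0)" for a
    by (auto simp: mat_apply_def augm_map_def F_def rk0 fun_eq_iff)
  have aug0: "mat_apply 1 n0 D0 a = 0 \<longleftrightarrow> augm_map F a = 0" for a
    unfolding aug by (simp add: fun_eq_iff)
  have img: "augm_map F ` free_module V n0 = I"
  proof
    show "augm_map F ` free_module V n0 \<subseteq> I"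
    proof clarify
      fix a :: "nat \<Rightarrow> 'k mpoly" assume "a \<in> free_module V n0"
      then have "mat_apply 1 n0 D0 a \<in> M" using 0(2) by blast
      then show "augm_map F a \<in> I" unfolding aug M_def by simp
    qed
    show "I \<subseteq> augm_map F ` free_module V n0"
    proof
      fix p assume "p \<in> I"
      then have "(\<lambda>c. if c = 0 then p else 0) \<in> M" by (simp add: M_def)
      then obtain a where a: "a \<in> free_module V n0" "mat_apply 1 n0 D0 a = (\<lambda>c. if c = 0 then p else 0)"
        using 0(2) by (metis (no_types, lifting) imageE)
      have "augm_map F a = p" using fun_cong[OF a(2)[unfolded aug], of 0] by simp
      then show "p \<in> augm_map F ` free_module V n0"
        using a(1) by blast
    qed
  qed
  have "graded_free_resolution V I F"
    unfolding graded_free_resolution_def diff_map_def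
  proof (intro conjI allI impI)
    fix b assume "b < free_rank F 0"
    then show "augm F b \<in> Pol V" "homogeneous (shift F 0 b) (augm F b)"
      using 0(1) by (auto simp: F_def rk0 hmat_def)
  next
    fix r c b assume "c < free_rank F r" "b < free_rank F (Suc r)"
    then show "diff F r c b \<in> Pol V" "homogeneous (shift F (Suc r) b - shift F r c) (diff F r c b)"
      using D_Suc by (auto simp: F_def)
  next
    show "augm_map F ` free_module V (free_rank F 0) = I" using img by (simp add: F_def rk0)
  next
    show "{a \<in> free_module V (free_rank F 0). augm_map F a = 0} =
      mat_apply (free_rank F 0) (free_rank F (Suc 0)) (diff F 0) ` free_module V (free_rank F 1)"
      using ex0 unfolding aug0 by (simp add: F_def rk0)
  next
    fix r
    show "{a \<in> free_module V (free_rank F (Suc r)).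
       mat_apply (free_rank F r) (free_rank F (Suc r)) (diff F r) a = 0} =
      mat_apply (free_rank F (Suc r)) (free_rank F (Suc (Suc r))) (diff F (Suc r)) `
      free_module V (free_rank F (Suc (Suc r)))"
      using exS by (simp add: F_def)
  qed
  then show ?thesis by blast
qed

section \<open>Koszul homology of an ideal\<close>

definition KZ :: "nat set \<Rightarrow> 'k::field mpoly set \<Rightarrow> nat \<Rightarrow> int \<Rightarrow> (nat set \<Rightarrow> 'k mpoly) set" where
  "KZ V I q j = {z \<in> KK V I q j. kdm V z = 0}"

definition KB :: "nat set \<Rightarrow> 'k::field mpoly set \<Rightarrow> nat \<Rightarrow> int \<Rightarrow> (nat set \<Rightarrow> 'k mpoly) set" where
  "KB V I q j = kdm V ` KK V I (Suc q) j"

text \<open>As an equivalence it gives both a basis of the homology, for combining subquotients, and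
  the uniqueness that turns the combined dimension back into a Betti number.\<close>

lemma graded_betti_eq_koszul:
  fixes I :: "'k::field mpoly set"
  assumes V: "finite V" and I: "graded_ideal V I"
  shows "qdim fscale (KZ V I r j) (KB V I r j) n \<longleftrightarrow> n = graded_betti V (int r) j I"
proof -
  define F where "F = (SOME F. graded_free_resolution V I F)"
  have F: "graded_free_resolution V I F"
    unfolding F_def by (rule someI_ex[OF graded_free_resolution_exists[OF assms]])
  \<comment> \<open>The ring itself is prepended with one generator of degree 0, so index
    \<open>Suc r\<close> corresponds to homological degree \<open>r\<close> and \<open>Zs 0\<close>
    is the ideal.\<close>
  define rk where "rk r = (case r of 0 \<Rightarrow> 1 | Suc r \<Rightarrow> free_rank F r)" for r :: nat
  define sh where "sh r = (case r of 0 \<Rightarrow> (\<lambda>_. 0) | Suc r \<Rightarrow> shift F r)" for r :: nat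
  define D where "D r = (case r of 0 \<Rightarrow> (\<lambda>_. augm F) | Suc r \<Rightarrow> diff F r)" for r :: nat
  have aug: "mat_apply (rk 0) (rk (Suc 0)) (D 0) a = (\<lambda>c. if c = 0 then augm_map F a else 0)" for a
    by (auto simp: mat_apply_def augm_map_def rk_def D_def fun_eq_iff)
  have aug0: "mat_apply (rk 0) (rk (Suc 0)) (D 0) a = 0 \<longleftrightarrow> augm_map F a = 0" for a
    unfolding aug by (simp add: fun_eq_iff)
  interpret graded_resolution V rk sh D
  proof
    show "finite V" by fact
  next
    fix r c b assume cb: "c < rk r" "b < rk (Suc r)"
    show "D r c b \<in> Pol V"
      using F cb unfolding graded_free_resolution_def rk_def D_def by (cases r) simp_all
    show "homogeneous (sh (Suc r) b - sh r c) (D r c b)"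
      using F cb unfolding graded_free_resolution_def rk_def D_def sh_def by (cases r) simp_all
  next
    fix r
    show "{a \<in> free_module V (rk (Suc r)). mat_apply (rk r) (rk (Suc r)) (D r) a = 0} =
      mat_apply (rk (Suc r)) (rk (Suc (Suc r))) (D (Suc r)) ` free_module V (rk (Suc (Suc r)))"
    proof (cases r)
      case 0
      then show ?thesis
        using F unfolding graded_free_resolution_def diff_map_def 0 aug0 by (simp add: rk_def D_def)
    next
      case (Suc s)
      then show ?thesis
        using F unfolding graded_free_resolution_def diff_map_def Suc by (simp add: rk_def D_def)
    qed
  qed
  have Zs0: "Zs 0 = {a. a 0 \<in> I \<and> (\<forall>c>0. a c = 0)}"
  proof
    have img: "augm_map F ` free_module V (rk (Suc 0)) = I"
      using F unfolding graded_free_resolution_def by (simp add: rk_def)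
    then show "Zs 0 \<subseteq> {a. a 0 \<in> I \<and> (\<forall>c>0. a c = 0)}"
      by (auto simp: Zs_def app_def aug)
    show "{a. a 0 \<in> I \<and> (\<forall>c>0. a c = 0)} \<subseteq> Zs 0"
    proof clarify
      fix a :: "nat \<Rightarrow> 'k mpoly" assume a: "a 0 \<in> I" "\<forall>c>0. a c = 0"
      then obtain f where "f \<in> free_module V (rk (Suc 0))" "augm_map F f = a 0" using img by (metis imageE)
      moreover from this have "app 0 f = a" using a by (auto simp: app_def aug fun_eq_iff)
      ultimately show "a \<in> Zs 0" by (auto simp: Zs_def)
    qed
  qed
  have VZ0: "z \<in> VZ 0 q j \<longleftrightarrow> z 0 \<in> KK V I q j \<and> (\<forall>b>0. z b = 0)" for z q
  proof
    assume z: "z \<in> VZ 0 q j"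
    have "z b \<sigma> = 0" if "b > 0" for b \<sigma> using VKD(3)[OF z, of \<sigma>] that by (simp add: Zs0)
    then show "z 0 \<in> KK V I q j \<and> (\<forall>b>0. z b = 0)"
      using z by (auto simp: VK_def KK_def Zs0 sh_def fun_eq_iff)
  next
    assume z: "z 0 \<in> KK V I q j \<and> (\<forall>b>0. z b = 0)"
    show "z \<in> VZ 0 q j"
    proof (rule VKI)
      fix b \<sigma> assume "z b \<sigma> \<noteq> 0"
      then show "\<sigma> \<subseteq> V \<and> card \<sigma> = q" using z by (cases "b = 0") (auto simp: KK_def)
    next
      fix \<sigma> show "(\<lambda>b. z b \<sigma>) \<in> Zs 0" using z by (auto simp: Zs0 KK_def)
    next
      fix b \<sigma> show "homogeneous (j - int q - sh 0 b) (z b \<sigma>)"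
        using z by (cases "b = 0") (auto simp: KK_def sh_def)
    qed
  qed
  \<comment> \<open>Over \<open>Zs 0\<close> only coordinate 0 can be nonzero, which identifies
    these chains with chains over \<open>I\<close>.\<close>
  define lift :: "(nat set \<Rightarrow> 'k mpoly) \<Rightarrow> nat \<Rightarrow> nat set \<Rightarrow> 'k mpoly" where
    "lift w b = (if b = 0 then w else 0)" for w b
  have lift: "lift w \<in> VZ 0 q j" if "w \<in> KK V I q j" for w q
    using that by (simp add: VZ0 lift_def)
  have vd0: "vd V z 0 = kdm V (z 0)" for z by (simp add: vd_def)
  have vd_lift: "vd V z = lift (kdm V (z 0))" if "\<forall>b>0. z b = 0" for z :: "nat \<Rightarrow> nat set \<Rightarrow> 'k mpoly"
    using that by (auto simp: vd_def lift_def fun_eq_iff kd_def)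
  have Cyc0: "z \<in> Cyc 0 r j \<longleftrightarrow> z 0 \<in> KZ V I r j \<and> (\<forall>b>0. z b = 0)" for z
  proof -
    have "vd V z = 0 \<longleftrightarrow> kdm V (z 0) = 0" if "\<forall>b>0. z b = 0"
      unfolding vd_lift[OF that] by (simp add: lift_def fun_eq_iff)
    then show ?thesis unfolding Cyc_def KZ_def by (auto simp: VZ0)
  qed
  have Bd0: "z \<in> Bd 0 r j \<longleftrightarrow> z 0 \<in> KB V I r j \<and> (\<forall>b>0. z b = 0)" for z
  proof
    assume "z \<in> Bd 0 r j"
    then obtain y where y: "y \<in> VZ 0 (Suc r) j" "z = vd V y" by (auto simp: Bd_def)
    then show "z 0 \<in> KB V I r j \<and> (\<forall>b>0. z b = 0)"
      using VZ0[of y "Suc r"] vd_lift[of y] by (auto simp: KB_def vd0 lift_def)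
  next
    assume z: "z 0 \<in> KB V I r j \<and> (\<forall>b>0. z b = 0)"
    then obtain w where w: "w \<in> KK V I (Suc r) j" "z 0 = kdm V w" by (auto simp: KB_def)
    have "z = vd V (lift w)"
      using z w vd_lift[of "lift w"] by (auto simp: lift_def fun_eq_iff)
    then show "z \<in> Bd 0 r j" using lift[OF w(1)] by (auto simp: Bd_def)
  qed
  have iso: "siso vscale (Cyc 0 r j) (Bd 0 r j) fscale (KZ V I r j) (KB V I r j)"
  proof (rule sisoI[where R = "\<lambda>z w. z \<in> Cyc 0 r j \<and> w = z 0"], goal_cases)
    case (3 z w) then show ?case by (simp add: Bd0)
  next
    case (4 z w) then show ?case by (simp add: Bd0 Cyc0)
  next
    case (6 w) then show ?case by (intro exI[of _ "lift w"]) (simp add: Cyc0 lift_def)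
  next
    case (9 c z w)
    then show ?case using Cyc_scale by (auto simp: vscale_def fscale_def)
  qed (auto simp: Cyc0[symmetric] Cyc_diff Cyc_zero, auto simp: Cyc0)
  have TC: "tor_chains F r j = TC r j" for r j
    by (simp add: tor_chains_def TC_def rk_def sh_def)
  have td: "tor_diff F r = td (Suc r)" for r
    by (simp add: tor_diff_def td_def rk_def D_def)
  have "tor_cycles F r j = Tcyc r j"
    unfolding tor_cycles_def Tcyc_def TC td by (cases r) auto
  moreover have "tor_boundaries F r j = td (Suc r) ` TC (Suc r) j"
    by (simp add: tor_boundaries_def TC td)
  ultimately have "qdim vscale (Cyc 0 r j) (Bd 0 r j) n \<longleftrightarrow> n = graded_betti V (int r) j I"
    unfolding qdim_tor by (simp add: graded_betti_def F_def[symmetric] tor_dim_def)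
  moreover have "qdim fscale (KZ V I r j) (KB V I r j) n \<longleftrightarrow> qdim vscale (Cyc 0 r j) (Bd 0 r j) n"
    by (rule iffI) (erule siso_qdim[OF siso_sym[OF iso]], erule siso_qdim[OF iso])
  ultimately show ?thesis by simp
qed

section \<open>Betti splittings from linear Koszul homology\<close>

lemma KKD:
  assumes "z \<in> KK V I q j"
  shows "\<And>\<sigma>. z \<sigma> \<noteq> 0 \<Longrightarrow> \<sigma> \<subseteq> V" "\<And>\<sigma>. z \<sigma> \<noteq> 0 \<Longrightarrow> card \<sigma> = q" "\<And>\<sigma>. z \<sigma> \<in> I"
    "\<And>\<sigma>. homogeneous (j - int q) (z \<sigma>)"
  using assms unfolding KK_def by blast+

lemma KKI:
  assumes "\<And>\<sigma>. z \<sigma> \<noteq> 0 \<Longrightarrow> \<sigma> \<subseteq> V \<and> card \<sigma> = q" "\<And>\<sigma>. z \<sigma> \<in> I" "\<And>\<sigma>. homogeneous (j - int q) (z \<sigma>)"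
  shows "z \<in> KK V I q j"
  using assms unfolding KK_def by blast

lemma KK_zero: "0 \<in> I \<Longrightarrow> 0 \<in> KK V I q j"
  by (rule KKI) auto

lemma KK_mono: "I \<subseteq> J \<Longrightarrow> KK V I q j \<subseteq> KK V J q j"
  unfolding KK_def by blast

lemma KK_diff:
  assumes I: "ideal I (mpoly_ring V)" and zy: "z \<in> KK V I q j" "y \<in> KK V I q j"
  shows "z - y \<in> KK V I q j"
proof (rule KKI)
  fix \<sigma> assume "(z - y) \<sigma> \<noteq> 0"
  then have "z \<sigma> \<noteq> 0 \<or> y \<sigma> \<noteq> 0" by auto
  then show "\<sigma> \<subseteq> V \<and> card \<sigma> = q"
    using KKD(1,2)[OF zy(1), of \<sigma>] KKD(1,2)[OF zy(2), of \<sigma>] by blast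
next
  fix \<sigma> show "(z - y) \<sigma> \<in> I"
    using ideal_mpoly_ringD(6)[OF I KKD(3)[OF zy(1)] KKD(3)[OF zy(2)]] by simp
next
  fix \<sigma> show "homogeneous (j - int q) ((z - y) \<sigma>)"
    using homogeneous_diff[OF KKD(4)[OF zy(1)] KKD(4)[OF zy(2)]] by simp
qed

lemma KK_add:
  assumes I: "ideal I (mpoly_ring V)" and zy: "z \<in> KK V I q j" "y \<in> KK V I q j"
  shows "z + y \<in> KK V I q j"
proof -
  have "0 \<in> KK V I q j" by (rule KK_zero) (rule ideal_mpoly_ringD(2)[OF I])
  from KK_diff[OF I zy(1) KK_diff[OF I this zy(2)]] show ?thesis by simp
qed

lemma KK_scale:
  assumes I: "ideal I (mpoly_ring V)" and z: "z \<in> KK V I q j"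
  shows "fscale c z \<in> KK V I q j"
proof (rule KKI)
  fix \<sigma> assume "fscale c z \<sigma> \<noteq> 0"
  then show "\<sigma> \<subseteq> V \<and> card \<sigma> = q" using KKD(1,2)[OF z, of \<sigma>] by (auto simp: fscale_def)
next
  fix \<sigma> show "fscale c z \<sigma> \<in> I"
    unfolding fscale_def by (rule ideal_mpoly_ringD(4)[OF I KKD(3)[OF z]]) (simp add: Pol_single)
next
  fix \<sigma> show "homogeneous (j - int q) (fscale c z \<sigma>)"
    unfolding fscale_def by (rule homogeneous_scale[OF KKD(4)[OF z]])
qed

lemma kdm_0 [simp]: "kdm V 0 = 0"
  by (simp add: fun_eq_iff kd_def)

lemma kdm_diff: "kdm V (z - y) = kdm V z - kdm V y"
  by (simp add: fun_eq_iff fun_diff_def kd_diff)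

lemma kdm_add: "kdm V (z + y) = kdm V z + kdm V y"
  by (simp add: fun_eq_iff plus_fun_def kd_add)

lemma kdm_scale: "kdm V (fscale c z) = fscale c (kdm V z)"
  by (simp add: fun_eq_iff fscale_def kd_scale)

lemma ideal_kdm:
  assumes I: "ideal I (mpoly_ring V)" and z: "\<And>\<sigma>. z \<sigma> \<in> I"
  shows "kdm V z \<tau> \<in> I"
  unfolding kd_def
proof (rule ideal_mpoly_ring_sum[OF I])
  fix i assume i: "i \<in> V - \<tau>"
  show "ksgn i \<tau> * (mvar i * z (insert i \<tau>)) \<in> I"
    by (intro ideal_mpoly_ringD(4)[OF I] z) (use i in \<open>auto intro: Pol_mvar Pol_ksgn\<close>)
qed

lemma kdm_in_KK:
  assumes V: "finite V" and I: "ideal I (mpoly_ring V)" and z: "z \<in> KK V I (Suc q) j"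
  shows "kdm V z \<in> KK V I q j"
proof (rule KKI)
  fix \<sigma> assume "kdm V z \<sigma> \<noteq> 0"
  then obtain i where "i \<in> V - \<sigma>" "z (insert i \<sigma>) \<noteq> 0" using kd_nonzero by blast
  then show "\<sigma> \<subseteq> V \<and> card \<sigma> = q" using card_insert_chain[OF V] KKD(1,2)[OF z] by blast
next
  fix \<sigma> show "kdm V z \<sigma> \<in> I" by (rule ideal_kdm[OF I KKD(3)[OF z]])
next
  fix \<sigma> show "homogeneous (j - int q) (kdm V z \<sigma>)"
  proof (rule homogeneous_kdm)
    fix \<sigma>' show "homogeneous (j - int q - 1) (z \<sigma>')"
      using KKD(4)[OF z, of \<sigma>'] by (simp add: algebra_simps)
  qed
qed

lemma kdm_deg0:
  assumes V: "finite V" and z: "z \<in> KK V I 0 j"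
  shows "kdm V z = 0"
proof
  fix \<tau>
  have "z (insert i \<tau>) = 0" if "i \<in> V - \<tau>" for i
  proof (rule ccontr)
    assume "z (insert i \<tau>) \<noteq> 0"
    then have "insert i \<tau> \<subseteq> V" "card (insert i \<tau>) = 0" using KKD(1,2)[OF z] by blast+
    then show False using V by (metis card_0_eq finite_subset insert_not_empty)
  qed
  then have "kdm V z \<tau> = 0" by (rule kd_outside)
  then show "kdm V z \<tau> = 0 \<tau>" by simp
qed

lemma KB_subset_KZ:
  assumes "finite V" "ideal I (mpoly_ring V)"
  shows "KB V I q j \<subseteq> KZ V I q j"
proof
  fix z assume "z \<in> KB V I q j"
  then obtain y where y: "y \<in> KK V I (Suc q) j" "z = kdm V y" by (auto simp: KB_def)
  have "kdm V z \<tau> = 0" for \<tau>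
    unfolding y(2) by (rule kd_kd[OF assms(1)]) (rule KKD(1)[OF y(1)])
  then have "kdm V z = 0" by (intro ext) simp
  then show "z \<in> KZ V I q j" using kdm_in_KK[OF assms y(1)] y(2) by (simp add: KZ_def)
qed

lemma KZ_diff: "ideal I (mpoly_ring V) \<Longrightarrow> z \<in> KZ V I q j \<Longrightarrow> y \<in> KZ V I q j \<Longrightarrow> z - y \<in> KZ V I q j"
  by (auto simp: KZ_def KK_diff kdm_diff)

lemma KZ_add: "ideal I (mpoly_ring V) \<Longrightarrow> z \<in> KZ V I q j \<Longrightarrow> y \<in> KZ V I q j \<Longrightarrow> z + y \<in> KZ V I q j"
  by (auto simp: KZ_def KK_add kdm_add)

lemma fscale_zero [simp]: "fscale c 0 = 0"
  by (simp add: fscale_def fun_eq_iff)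

lemma KZ_scale: "ideal I (mpoly_ring V) \<Longrightarrow> z \<in> KZ V I q j \<Longrightarrow> fscale c z \<in> KZ V I q j"
  by (auto simp: KZ_def KK_scale kdm_scale)

lemma KZ_zero: "ideal I (mpoly_ring V) \<Longrightarrow> 0 \<in> KZ V I q j"
  by (simp add: KZ_def KK_zero ideal_mpoly_ringD(2))

lemma KB_add: "ideal I (mpoly_ring V) \<Longrightarrow> z \<in> KB V I q j \<Longrightarrow> y \<in> KB V I q j \<Longrightarrow> z + y \<in> KB V I q j"
  by (auto simp: KB_def kdm_add[symmetric] KK_add)

lemma KB_diff: "ideal I (mpoly_ring V) \<Longrightarrow> z \<in> KB V I q j \<Longrightarrow> y \<in> KB V I q j \<Longrightarrow> z - y \<in> KB V I q j"
  by (auto simp: KB_def kdm_diff[symmetric] KK_diff)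

lemma subspace_KZ:
  assumes "ideal I (mpoly_ring V)"
  shows "module.subspace fscale (KZ V I q j)"
proof -
  interpret W: vector_space "fscale :: 'a \<Rightarrow> (nat set \<Rightarrow> 'a mpoly) \<Rightarrow> _" by (rule vector_space_fscale)
  show ?thesis by (rule W.subspaceI) (simp_all add: KZ_zero KZ_add KZ_scale assms)
qed

lemma graded_ideal_mideal: "graded_ideal V (mideal V U)"
  unfolding graded_ideal_def
proof (intro conjI ballI allI)
  fix p :: "'a mpoly" and d assume "p \<in> mideal V U"
  then show "hcomp d p \<in> mideal V U"
    using keys_hcomp[of d p] by (auto simp: mideal_def intro: Pol_hcomp)
qed (rule ideal_mideal)

lemma graded_ideal_Int:
  assumes "graded_ideal V I" "graded_ideal V J"
  shows "graded_ideal V (I \<inter> J)"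
proof -
  have I: "ideal I (mpoly_ring V)" and J: "ideal J (mpoly_ring V)" using assms by (auto simp: graded_ideal_def)
  have "ideal (I \<inter> J) (mpoly_ring V)"
    by (rule ideal_mpoly_ringI)
      (use ideal_mpoly_ringD[OF I] ideal_mpoly_ringD[OF J] in auto)
  then show ?thesis using assms by (auto simp: graded_ideal_def)
qed

text \<open>Each coefficient is decomposed and its components of the right degree are kept. Where
  \<open>y\<close> vanishes both parts are chosen zero, so that the supports do not grow.\<close>

lemma KK_split:
  assumes A: "graded_ideal V A" and B: "graded_ideal V B"
    and I: "\<And>p. p \<in> I \<Longrightarrow> \<exists>a\<in>A. \<exists>b\<in>B. p = a + b" and y: "y \<in> KK V I q j"
  shows "\<exists>\<alpha>\<in>KK V A q j. \<exists>\<beta>\<in>KK V B q j. y = \<alpha> + \<beta>"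
proof -
  have 0: "0 \<in> A" "0 \<in> B" using A B by (auto simp: graded_ideal_def ideal_mpoly_ringD(2))
  have "\<exists>a b. a \<in> A \<and> b \<in> B \<and> homogeneous (j - int q) a \<and> homogeneous (j - int q) b \<and> y \<sigma> = a + b \<and>
      (y \<sigma> = 0 \<longrightarrow> a = 0 \<and> b = 0)" for \<sigma>
  proof (cases "y \<sigma> = 0")
    case False
    obtain a b where ab: "a \<in> A" "b \<in> B" "y \<sigma> = a + b" using I[OF KKD(3)[OF y]] by blast
    have "y \<sigma> = hcomp (j - int q) a + hcomp (j - int q) b"
      using hcomp_homogeneous[OF KKD(4)[OF y, of \<sigma>]] by (simp add: ab hcomp_add)
    then show ?thesis
      using ab A B False by (intro exI[of _ "hcomp (j - int q) a"] exI[of _ "hcomp (j - int q) b"])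
        (auto simp: graded_ideal_def homogeneous_hcomp)
  qed (use 0 in auto)
  then obtain \<alpha> \<beta> where *: "\<And>\<sigma>. \<alpha> \<sigma> \<in> A" "\<And>\<sigma>. \<beta> \<sigma> \<in> B" "\<And>\<sigma>. homogeneous (j - int q) (\<alpha> \<sigma>)"
    "\<And>\<sigma>. homogeneous (j - int q) (\<beta> \<sigma>)" "\<And>\<sigma>. y \<sigma> = \<alpha> \<sigma> + \<beta> \<sigma>"
    "\<And>\<sigma>. y \<sigma> = 0 \<Longrightarrow> \<alpha> \<sigma> = 0 \<and> \<beta> \<sigma> = 0" by metis
  have "\<alpha> \<in> KK V A q j"
  proof (rule KKI)
    fix \<sigma> assume "\<alpha> \<sigma> \<noteq> 0"
    then have "y \<sigma> \<noteq> 0" using *(6) by blast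
    then show "\<sigma> \<subseteq> V \<and> card \<sigma> = q" using KKD(1,2)[OF y] by blast
  qed (rule *)+
  moreover have "\<beta> \<in> KK V B q j"
  proof (rule KKI)
    fix \<sigma> assume "\<beta> \<sigma> \<noteq> 0"
    then have "y \<sigma> \<noteq> 0" using *(6) by blast
    then show "\<sigma> \<subseteq> V \<and> card \<sigma> = q" using KKD(1,2)[OF y] by blast
  qed (rule *)+
  moreover have "y = \<alpha> + \<beta>" using *(5) by (simp add: fun_eq_iff)
  ultimately show ?thesis by blast
qed

lemma KK_Int: "KK V (A \<inter> B) q j = KK V A q j \<inter> KK V B q j"
  by (auto simp: KK_def)

lemma KZ_Int: "KZ V (A \<inter> B) q j = KZ V A q j \<inter> KZ V B q j"
  by (auto simp: KZ_def KK_Int)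

text \<open>
  Long exact Koszul homology sequence of \<open>0 \<rightarrow> A \<inter> B \<rightarrow> A \<oplus> B \<rightarrow> I \<rightarrow> 0\<close>, cut into short exact
  sequences by the vanishing of \<open>H(A \<inter> B) \<rightarrow> H(A) \<oplus> H(B)\<close>.
\<close>

lemma graded_betti_additive:
  fixes A B I :: "'k::field mpoly set"
  assumes V: "finite V" and A: "graded_ideal V A" and B: "graded_ideal V B" and I: "graded_ideal V I"
    and sub: "A \<subseteq> I" "B \<subseteq> I" and sum: "\<And>p. p \<in> I \<Longrightarrow> \<exists>a\<in>A. \<exists>b\<in>B. p = a + b"
    and zero: "\<And>q. KZ V (A \<inter> B) q j \<subseteq> KB V A q j" "\<And>q. KZ V (A \<inter> B) q j \<subseteq> KB V B q j"
  shows "graded_betti V (int r) j I =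
    graded_betti V (int r) j A + graded_betti V (int r) j B + graded_betti V (int r - 1) j (A \<inter> B)"
proof -
  interpret W: vector_space "fscale :: 'k \<Rightarrow> (nat set \<Rightarrow> 'k mpoly) \<Rightarrow> _" by (rule vector_space_fscale)
  note AB = graded_ideal_Int[OF A B]
  have id: "ideal A (mpoly_ring V)" "ideal B (mpoly_ring V)" "ideal I (mpoly_ring V)" "ideal (A \<inter> B) (mpoly_ring V)"
    using A B I AB by (auto simp: graded_ideal_def)
  note KIdiff = KK_diff[OF id(3)]
  \<comment> \<open>Cycles representing the image of the homology of \<open>A\<close> and
    \<open>B\<close> in that of \<open>I\<close>.\<close>
  define Z' where "Z' = {a + b | a b. a \<in> KZ V A r j \<and> b \<in> KZ V B r j}"
  have KI: "KK V A q j \<subseteq> KK V I q j" "KK V B q j \<subseteq> KK V I q j" for q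
    using KK_mono sub by blast+
  have q1: "qdim fscale Z' (KB V I r j) (graded_betti V (int r) j A + graded_betti V (int r) j B)"
    unfolding Z'_def
  proof (rule W.qdim_sum)
    show "qdim fscale (KZ V A r j) (KB V A r j) (graded_betti V (int r) j A)"
      using graded_betti_eq_koszul[OF V A] by blast
    show "qdim fscale (KZ V B r j) (KB V B r j) (graded_betti V (int r) j B)"
      using graded_betti_eq_koszul[OF V B] by blast
    show "W.subspace (KZ V A r j)" "W.subspace (KZ V B r j)"
      using subspace_KZ id by blast+
    fix a b assume a: "a \<in> KZ V A r j" and b: "b \<in> KZ V B r j"
    show "a + b \<in> KB V I r j \<longleftrightarrow> a \<in> KB V A r j \<and> b \<in> KB V B r j"
    proof
      assume "a + b \<in> KB V I r j"
      then obtain y where y: "y \<in> KK V I (Suc r) j" "a + b = kdm V y" by (auto simp: KB_def)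
      obtain \<alpha> \<beta> where ab: "\<alpha> \<in> KK V A (Suc r) j" "\<beta> \<in> KK V B (Suc r) j" "y = \<alpha> + \<beta>"
        using KK_split[OF A B sum y(1)] by blast
      have ba: "kdm V \<alpha> \<in> KB V A r j" "kdm V \<beta> \<in> KB V B r j" using ab by (auto simp: KB_def)
      \<comment> \<open>Both sides agree and hence lie in \<open>A \<inter> B\<close>; by
        \<open>zero\<close> they are boundaries in \<open>A\<close> and in \<open>B\<close>.\<close>
      have eq: "a - kdm V \<alpha> = kdm V \<beta> - b" using y(2) ab(3) by (simp add: kdm_add algebra_simps)
      have "a - kdm V \<alpha> \<in> KZ V A r j"
        using a ba KB_subset_KZ[OF V id(1)] by (intro KZ_diff[OF id(1)]) auto
      moreover have "kdm V \<beta> - b \<in> KZ V B r j"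
        using b ba KB_subset_KZ[OF V id(2)] by (intro KZ_diff[OF id(2)]) auto
      ultimately have "a - kdm V \<alpha> \<in> KZ V (A \<inter> B) r j" "kdm V \<beta> - b \<in> KZ V (A \<inter> B) r j"
        using eq by (auto simp: KZ_Int)
      then have "a - kdm V \<alpha> \<in> KB V A r j" "kdm V \<beta> - b \<in> KB V B r j" using zero by blast+
      then have "(a - kdm V \<alpha>) + kdm V \<alpha> \<in> KB V A r j" "kdm V \<beta> - (kdm V \<beta> - b) \<in> KB V B r j"
        using ba KB_add[OF id(1)] KB_diff[OF id(2)] by blast+
      then show "a \<in> KB V A r j \<and> b \<in> KB V B r j" by simp
    next
      assume "a \<in> KB V A r j \<and> b \<in> KB V B r j"
      then have "a \<in> KB V I r j" "b \<in> KB V I r j" using KI unfolding KB_def by blast+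
      then show "a + b \<in> KB V I r j" by (rule KB_add[OF id(3)])
    qed
  qed
  have "qdim fscale (KZ V I r j) (KB V I r j)
    (graded_betti V (int r) j A + graded_betti V (int r) j B + graded_betti V (int r - 1) j (A \<inter> B))"
  proof (cases r)
    \<comment> \<open>In degree 0 every chain is a cycle, so a decomposed cycle has cycles as parts;
      the Betti number at -1 is 0 by convention.\<close>
    case 0
    have "KZ V I 0 j \<subseteq> Z'"
    proof
      fix z assume "z \<in> KZ V I 0 j"
      then obtain \<alpha> \<beta> where ab: "\<alpha> \<in> KK V A 0 j" "\<beta> \<in> KK V B 0 j" "z = \<alpha> + \<beta>"
        using KK_split[of V A B I, OF A B sum] unfolding KZ_def by blast
      then have "kdm V \<alpha> = 0" "kdm V \<beta> = 0" using kdm_deg0[OF V] by blast+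
      then show "z \<in> Z'"
        using ab unfolding Z'_def KZ_def 0 by (intro CollectI exI[of _ \<alpha>] exI[of _ \<beta>]) simp
    qed
    moreover have "Z' \<subseteq> KZ V I r j"
      using KI[of r] KZ_add[OF id(3), of _ r j] unfolding Z'_def KZ_def by fastforce
    ultimately have "KZ V I r j = Z'" using 0 by blast
    then show ?thesis using q1 0 by (simp add: graded_betti_def[of V "- 1"])
  next
    case (Suc q)
    \<comment> \<open>The connecting homomorphism: \<open>w\<close> is linked to
      \<open>a - b\<close> whenever it bounds \<open>a\<close> in \<open>A\<close> and
      \<open>b\<close> in \<open>B\<close>. Such \<open>a\<close> and \<open>b\<close> exist by
      \<open>zero\<close>.\<close>
    have "siso fscale (KZ V (A \<inter> B) q j) (KB V (A \<inter> B) q j) fscale (KZ V I (Suc q) j) Z'"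
    proof (rule sisoI[where R = "\<lambda>w z. w \<in> KZ V (A \<inter> B) q j \<and> z \<in> KZ V I (Suc q) j \<and>
        (\<exists>a\<in>KK V A (Suc q) j. \<exists>b\<in>KK V B (Suc q) j. z = a - b \<and> kdm V a = w \<and> kdm V b = w)"], goal_cases)
      case (3 w z)
      then obtain t a b where t: "t \<in> KK V (A \<inter> B) (Suc q) j" "w = kdm V t"
        and ab: "a \<in> KK V A (Suc q) j" "b \<in> KK V B (Suc q) j" "z = a - b" "kdm V a = w" "kdm V b = w"
        by (auto simp: KB_def)
      have "a - t \<in> KZ V A (Suc q) j" "t - b \<in> KZ V B (Suc q) j"
        using t ab by (auto simp: KZ_def KK_Int kdm_diff intro: KK_diff id)
      then show ?case unfolding Z'_def Suc
        by (intro CollectI exI[of _ "a - t"] exI[of _ "t - b"]) (simp add: ab)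
    next
      case (4 w z)
      then obtain za zb a b where zz: "za \<in> KZ V A (Suc q) j" "zb \<in> KZ V B (Suc q) j" "z = za + zb"
        and ab: "a \<in> KK V A (Suc q) j" "b \<in> KK V B (Suc q) j" "z = a - b" "kdm V a = w" "kdm V b = w"
        by (auto simp: Z'_def Suc)
      have "a - za = b + zb" using zz ab by (simp add: algebra_simps)
      moreover have "a - za \<in> KK V A (Suc q) j" "b + zb \<in> KK V B (Suc q) j"
        using zz ab by (auto simp: KZ_def intro: KK_diff KK_add id)
      ultimately have "a - za \<in> KK V (A \<inter> B) (Suc q) j" by (auto simp: KK_Int)
      moreover have "kdm V (a - za) = w" using zz ab by (simp add: kdm_diff KZ_def)
      ultimately show ?case by (auto simp: KB_def)
    next
      case (5 w)
      then obtain a b where ab: "a \<in> KK V A (Suc q) j" "kdm V a = w" "b \<in> KK V B (Suc q) j" "kdm V b = w"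
        using subsetD[OF zero(1) 5] subsetD[OF zero(2) 5] unfolding KB_def by auto
      then have "a - b \<in> KZ V I (Suc q) j"
        using KIdiff[OF subsetD[OF KI(1) ab(1)] subsetD[OF KI(2) ab(3)]] by (simp add: KZ_def kdm_diff)
      then show ?case using 5 ab by blast
    next
      case (6 z)
      then obtain a b where ab: "a \<in> KK V A (Suc q) j" "b \<in> KK V B (Suc q) j" "z = a + b"
        using KK_split[of V A B I, OF A B sum] unfolding KZ_def by blast
      have b': "0 - b \<in> KK V B (Suc q) j" "kdm V (0 - b) = - kdm V b"
        using ab KK_diff[OF id(2) KK_zero] ideal_mpoly_ringD(2)[OF id(2)] kdm_diff[of V 0 b] by auto
      have eq: "kdm V a = kdm V (0 - b)"
        using 6 ab b'(2) by (simp add: KZ_def kdm_add add_eq_0_iff2)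
      have "kdm V a \<in> KZ V A q j" "kdm V (0 - b) \<in> KZ V B q j"
        using KB_subset_KZ[OF V id(1)] KB_subset_KZ[OF V id(2)] ab(1) b'(1) unfolding KB_def by blast+
      then have "kdm V a \<in> KZ V (A \<inter> B) q j" using eq by (simp add: KZ_Int)
      then show ?case
        using 6 ab b' eq by (intro exI[of _ "kdm V a"] conjI bexI[of _ a] bexI[of _ "0 - b"]) auto
    next
      case 7
      have "0 \<in> KK V A (Suc q) j" "0 \<in> KK V B (Suc q) j"
        using KK_zero ideal_mpoly_ringD(2) id by blast+
      then show ?case using KZ_zero id(3,4) by (intro conjI bexI[of _ 0]) auto
    next
      case (8 w z w' z')
      then obtain a b a' b' where "a \<in> KK V A (Suc q) j" "b \<in> KK V B (Suc q) j" "z = a - b" "kdm V a = w" "kdm V b = w"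
        "a' \<in> KK V A (Suc q) j" "b' \<in> KK V B (Suc q) j" "z' = a' - b'" "kdm V a' = w'" "kdm V b' = w'" by blast
      then have "a - a' \<in> KK V A (Suc q) j \<and> b - b' \<in> KK V B (Suc q) j \<and> z - z' = (a - a') - (b - b') \<and>
         kdm V (a - a') = w - w' \<and> kdm V (b - b') = w - w'"
        by (simp add: KK_diff id kdm_diff)
      then show ?case using 8 KZ_diff[OF id(4)] KZ_diff[OF id(3)] by blast
    next
      case (9 c w z)
      then obtain a b where "a \<in> KK V A (Suc q) j" "b \<in> KK V B (Suc q) j" "z = a - b" "kdm V a = w" "kdm V b = w" by blast
      then have "fscale c a \<in> KK V A (Suc q) j \<and> fscale c b \<in> KK V B (Suc q) j \<and>
         fscale c z = fscale c a - fscale c b \<and> kdm V (fscale c a) = fscale c w \<and> kdm V (fscale c b) = fscale c w"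
        by (simp add: KK_scale id kdm_scale W.scale_right_diff_distrib)
      then show ?case using 9 KZ_scale[OF id(4)] KZ_scale[OF id(3)] by blast
    qed auto
    moreover have "qdim fscale (KZ V (A \<inter> B) q j) (KB V (A \<inter> B) q j) (graded_betti V (int q) j (A \<inter> B))"
      using graded_betti_eq_koszul[OF V AB] by blast
    ultimately have q2: "qdim fscale (KZ V I r j) Z' (graded_betti V (int q) j (A \<inter> B))"
      unfolding Suc by (rule siso_qdim)
    have "KZ V A r j \<subseteq> KZ V I r j" "KZ V B r j \<subseteq> KZ V I r j" using KI by (auto simp: KZ_def)
    then have Z'I: "Z' \<subseteq> KZ V I r j" using KZ_add[OF id(3)] unfolding Z'_def by blast
    have BZ': "KB V I r j \<subseteq> Z'"
    proof
      fix z assume "z \<in> KB V I r j"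
      then obtain y where y: "y \<in> KK V I (Suc r) j" "z = kdm V y" by (auto simp: KB_def)
      obtain \<alpha> \<beta> where ab: "\<alpha> \<in> KK V A (Suc r) j" "\<beta> \<in> KK V B (Suc r) j" "y = \<alpha> + \<beta>"
        using KK_split[OF A B sum y(1)] by blast
      have "kdm V \<alpha> \<in> KZ V A r j" "kdm V \<beta> \<in> KZ V B r j"
        using ab KB_subset_KZ[OF V] id unfolding KB_def by blast+
      then show "z \<in> Z'" using y ab by (auto simp: Z'_def kdm_add)
    qed
    have "W.subspace Z'"
      unfolding Z'_def by (rule W.subspace_sums) (use subspace_KZ id in blast)+
    \<comment> \<open>The filtration of the cycles of \<open>I\<close> by boundaries and
      \<open>Z'\<close> adds the image of \<open>A\<close> and \<open>B\<close> to the contribution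
      of \<open>A \<inter> B\<close>.\<close>
    from W.qdim_trans[OF q1 q2 this Z'I BZ'] show ?thesis by (simp add: Suc)
  qed
  then show ?thesis using graded_betti_eq_koszul[OF V I] by metis
qed

lemma keys_mvar_times: "u \<in> ks (mvar v * p) \<longleftrightarrow> v \<in> ks u \<and> u - sing v 1 \<in> ks (p :: 'k::field mpoly)"
  by (simp add: in_keys_iff lookup_mvar_times)

lemma mvar_nonzero [simp]: "mvar v \<noteq> (0 :: 'k::field mpoly)"
  unfolding mvar_def by (metis lookup_single_eq lookup_zero zero_neq_one)

text \<open>
  A cycle \<open>w\<close> of \<open>A \<inter> B\<close> is \<open>x\<^sub>v z\<close> for a cycle \<open>z\<close> of \<open>B\<close>, and \<open>x\<^sub>v z\<close> is the boundary of the
  exterior product of the \<open>v\<close>-th basis vector with \<open>z\<close>.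
\<close>

lemma KZ_Int_subset_KB:
  fixes U1 U2 :: "expo set"
  assumes V: "finite V" and v: "v \<in> V" and U1: "\<And>u. u \<in> U1 \<Longrightarrow> v \<in> ks u" and U2: "\<And>u. u \<in> U2 \<Longrightarrow> v \<notin> ks u"
  shows "KZ V (mideal V U1 \<inter> mideal V U2 :: 'k::field mpoly set) q j \<subseteq> KB V (mideal V U2) q j"
proof
  fix w :: "nat set \<Rightarrow> 'k mpoly" assume w: "w \<in> KZ V (mideal V U1 \<inter> mideal V U2) q j"
  then have wK: "w \<in> KK V (mideal V U1 \<inter> mideal V U2) q j" and cyc: "kdm V w = 0" by (auto simp: KZ_def)
  note wD = KKD[OF wK]
  let ?x = "sing v (1::nat)"
  have "\<exists>p. w \<sigma> = mvar v * p" for \<sigma>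
  proof -
    have "w \<sigma> = (\<Sum>u\<in>ks (w \<sigma>). mvar v * sing (u - ?x) (lk (w \<sigma>) u))"
    proof (subst poly_eq_sum_single, rule sum.cong[OF refl])
      fix u assume "u \<in> ks (w \<sigma>)"
      then obtain g where "g \<in> U1" "g adds u" using wD(3)[of \<sigma>] by (auto simp: mideal_def)
      then have "?x adds u" using U1 adds_keys single_adds_iff by blast
      then show "sing u (lk (w \<sigma>) u) = mvar v * sing (u - ?x) (lk (w \<sigma>) u)"
        by (simp add: mvar_def mult_single adds_minus del: One_nat_def)
    qed
    also have "\<dots> = mvar v * (\<Sum>u\<in>ks (w \<sigma>). sing (u - ?x) (lk (w \<sigma>) u))"
      by (rule sum_distrib_left[symmetric])
    finally have "w \<sigma> = mvar v * (\<Sum>u\<in>ks (w \<sigma>). sing (u - ?x) (lk (w \<sigma>) u))" .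
    then show ?thesis by blast
  qed
  then obtain z where z: "\<And>\<sigma>. w \<sigma> = mvar v * z \<sigma>" by metis
  have supp: "\<sigma> \<subseteq> V" "card \<sigma> = q" if "z \<sigma> \<noteq> 0" for \<sigma> using wD(1,2)[of \<sigma>] that by (auto simp: z)
  have key: "u + ?x \<in> ks (w \<sigma>)" if "u \<in> ks (z \<sigma>)" for u \<sigma>
    using that by (simp add: z keys_mvar_times keys_add_expo del: One_nat_def)
  have zB: "z \<sigma> \<in> mideal V U2" for \<sigma>
    unfolding mideal_def
  proof (intro CollectI conjI ballI)
    show "z \<sigma> \<in> Pol V"
      using key wD(3)[of \<sigma>] by (force simp: Pol_iff mideal_def keys_add_expo)
    fix u assume "u \<in> ks (z \<sigma>)"
    then obtain g where g: "g \<in> U2" "g adds u + ?x" using key wD(3)[of \<sigma>] by (fastforce simp: mideal_def)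
    \<comment> \<open>The generator \<open>g\<close> does not involve \<open>v\<close>, so dividing
      by the variable does not affect divisibility by \<open>g\<close>.\<close>
    have "g adds u"
      unfolding adds_def
    proof
      fix i show "lk g i \<le> lk u i"
        using g(2)[unfolded adds_def, rule_format, of i] U2[OF g(1)]
        by (cases "i = v") (auto simp: lookup_add lookup_single in_keys_iff when_def)
    qed
    then show "\<exists>g\<in>U2. g adds u" using g(1) by blast
  qed
  have zhom: "homogeneous (j - int (Suc q)) (z \<sigma>)" for \<sigma>
    unfolding homogeneous_iff
  proof
    fix u assume "u \<in> ks (z \<sigma>)"
    then have "int (tdeg (u + ?x)) = j - int q" using key wD(4) unfolding homogeneous_iff by blast
    then show "int (tdeg u) = j - int (Suc q)" by simp
  qed
  have zcyc: "kdm V z \<tau> = 0" for \<tau>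
  proof -
    have "kdm V w = kdm V (\<lambda>\<sigma>. mvar v * z \<sigma>)" by (rule arg_cong[of _ _ "kdm V"]) (use z in blast)
    then have "mvar v * kdm V z \<tau> = kdm V w \<tau>" by (simp only: kd_scale)
    then show ?thesis using cyc by simp
  qed
  have "ke v z \<in> KK V (mideal V U2) (Suc q) j"
  proof (rule KKI)
    fix \<sigma> assume "ke v z \<sigma> \<noteq> 0"
    then have "v \<in> \<sigma>" "z (\<sigma> - {v}) \<noteq> 0" using ke_nonzero by blast+
    then have s: "\<sigma> - {v} \<subseteq> V" "card (\<sigma> - {v}) = q" using supp by blast+
    then have "\<sigma> \<subseteq> V" using v by blast
    moreover from this have "card \<sigma> = Suc q"
      using card.remove[OF finite_subset[OF _ V] \<open>v \<in> \<sigma>\<close>] s(2) by simp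
    ultimately show "\<sigma> \<subseteq> V \<and> card \<sigma> = Suc q" by blast
  next
    fix \<sigma> show "ke v z \<sigma> \<in> mideal V U2"
      using ideal_mpoly_ringD(4)[OF ideal_mideal zB Pol_ksgn] ideal_mpoly_ringD(2)[OF ideal_mideal]
      by (auto simp: ke_def)
  next
    fix \<sigma> show "homogeneous (j - int (Suc q)) (ke v z \<sigma>)"
      using homogeneous_mult[OF homogeneous_ksgn zhom] by (simp add: ke_def)
  qed
  moreover have "kdm V (ke v z) = w"
  proof
    fix \<tau>
    have "kdm V (ke v z) \<tau> + ke v (kdm V z) \<tau> = mvar v * z \<tau>" by (rule kd_ke[OF V supp(1) v])
    moreover have "ke v (kdm V z) \<tau> = 0" unfolding ke_def zcyc by simp
    ultimately show "kdm V (ke v z) \<tau> = w \<tau>" by (simp add: z)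
  qed
  ultimately show "w \<in> KB V (mideal V U2) q j" unfolding KB_def by blast
qed

text \<open>For \<open>j = q + e\<close> the coefficients of chains over the intersection have
  degree \<open>e\<close>. A term of degree \<open>e\<close> would equal a generator from each part,
  so there are no nonzero chains. For other \<open>j\<close> the linearity hypothesis
  applies.\<close>

lemma admits_splitting_of_linear:
  fixes U :: "expo set"
  assumes V: "finite V" and v: "v \<in> V" and U: "\<And>u. u \<in> U \<Longrightarrow> ks u \<subseteq> V" and e: "\<And>u. u \<in> U \<Longrightarrow> tdeg u = e"
    and lin: "\<And>q j. j \<noteq> int q + int e \<Longrightarrow> KZ V (mideal V {u\<in>U. v \<in> ks u} :: 'k::field mpoly set) q j
      \<subseteq> KB V (mideal V {u\<in>U. v \<in> ks u}) q j"
  shows "admits_splitting V v (mideal V U :: 'k mpoly set)"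
proof (rule admits_splitting_mideal[OF v U])
  fix u w assume "u \<in> U" "w \<in> U" "u adds w"
  then show "u = w" using e adds_tdeg_eq by simp
next
  let ?U1 = "{u\<in>U. v \<in> ks u}" and ?U2 = "{u\<in>U. v \<notin> ks u}"
  let ?A = "mideal V ?U1 :: 'k mpoly set" and ?B = "mideal V ?U2 :: 'k mpoly set"
  fix r j :: nat
  have UU: "U = ?U1 \<union> ?U2" by blast
  show "graded_betti V (int r) (int j) (mideal V U :: 'k mpoly set) =
    graded_betti V (int r) (int j) ?A + graded_betti V (int r) (int j) ?B +
    graded_betti V (int r - 1) (int j) (?A \<inter> ?B)"
  proof (rule graded_betti_additive[OF V graded_ideal_mideal graded_ideal_mideal graded_ideal_mideal])
    show "?A \<subseteq> mideal V U" "?B \<subseteq> mideal V U" by (auto simp: mideal_def)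
    show "\<exists>a\<in>?A. \<exists>b\<in>?B. p = a + b" if "p \<in> mideal V U" for p :: "'k mpoly"
    proof -
      have "mideal V U = ?A <+>\<^bsub>mpoly_ring V\<^esub> ?B" using mideal_Un[of V ?U1 ?U2] UU by simp
      then have "p \<in> ?A <+>\<^bsub>mpoly_ring V\<^esub> ?B" using that by simp
      then show ?thesis unfolding set_add_def' by auto
    qed
    show "KZ V (?A \<inter> ?B) q (int j) \<subseteq> KB V ?B q (int j)" for q
      by (rule KZ_Int_subset_KB[OF V v]) auto
    show "KZ V (?A \<inter> ?B) q (int j) \<subseteq> KB V ?A q (int j)" for q
    proof (cases "int j = int q + int e")
      case False
      then show ?thesis using lin[OF False] by (auto simp: KZ_Int)
    next
      case True
      show ?thesis
      proof
        fix w assume "w \<in> KZ V (?A \<inter> ?B) q (int j)"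
        then have w: "w \<in> KK V (?A \<inter> ?B) q (int j)" by (simp add: KZ_def)
        have "w \<sigma> = 0" for \<sigma>
        proof (rule ccontr)
          assume "w \<sigma> \<noteq> 0"
          then have "ks (w \<sigma>) \<noteq> {}" by simp
          then obtain u where u: "u \<in> ks (w \<sigma>)" by blast
          then obtain g h where g: "g \<in> ?U1" "g adds u" and h: "h \<in> ?U2" "h adds u"
            using KKD(3)[OF w, of \<sigma>] by (fastforce simp: mideal_def)
          have "tdeg u = e" using KKD(4)[OF w, of \<sigma>] u True by (simp add: homogeneous_iff)
          then have "g = u" "h = u" using g h e adds_tdeg_eq by auto
          then show False using g h by blast
        qed
        then have "w = kdm V 0" by (simp add: fun_eq_iff)
        then show "w \<in> KB V ?A q (int j)"
          unfolding KB_def using KK_zero[OF ideal_mpoly_ringD(2)[OF ideal_mideal]] by blast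
      qed
    qed
  qed
qed

section \<open>Linear Koszul homology of Alexander dual ideals\<close>

lemma sd_ambient:
  assumes V: "finite V" "V' \<subseteq> V" and c: "\<And>\<sigma>. c \<sigma> \<noteq> 0 \<Longrightarrow> \<sigma> \<subseteq> V'"
  shows "sd V c = sd V' c"
  unfolding kd_def
proof (intro ext sum.mono_neutral_right ballI)
  fix \<tau> i assume "i \<in> V - \<tau> - (V' - \<tau>)"
  then have "c (insert i \<tau>) = 0" using c by blast
  then show "ksgn i \<tau> * (1 * c (insert i \<tau>)) = 0" by simp
qed (use V in auto)

text \<open>The Cohen-Macaulay hypothesis lives on the ground set without \<open>v\<close>, the dual
  ideal on all of \<open>V\<close>; the boundary of a chain does not notice vertices outside its
  support.\<close>

lemma acyclic_at_ambient:
  assumes V: "finite V" "V' \<subseteq> V" and D: "D \<subseteq> Pow V'" and ac: "acyclic_at TYPE('k::field) V' D q"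
  shows "acyclic_at TYPE('k) V D q"
  unfolding acyclic_at_def
proof (intro allI impI)
  fix c :: "nat set \<Rightarrow> 'k"
  assume c: "\<forall>\<sigma>. c \<sigma> \<noteq> 0 \<longrightarrow> \<sigma> \<in> D \<and> card \<sigma> = q" "\<forall>\<tau>. sd V c \<tau> = 0"
  have "sd V c = sd V' c" by (rule sd_ambient[OF V]) (use c D in blast)
  then obtain b where b: "\<And>\<sigma>. b \<sigma> \<noteq> 0 \<Longrightarrow> \<sigma> \<in> D \<and> card \<sigma> = Suc q" "sd V' b = c"
    using acyclic_atD[OF ac, of c] c by metis
  have "sd V b = sd V' b" by (rule sd_ambient[OF V]) (use b D in blast)
  then show "\<exists>b. (\<forall>\<sigma>. b \<sigma> \<noteq> 0 \<longrightarrow> \<sigma> \<in> D \<and> card \<sigma> = Suc q) \<and> sd V b = c" using b by metis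
qed

text \<open>
  Induction over \<open>G\<close>: a cycle \<open>c\<close> of the link of \<open>g\<close> bounds some \<open>b\<close> in the complex on \<open>W\<close>, and
  \<open>g \<and> c - b\<close> is then a cycle of the complex on \<open>W \<union> {g}\<close>; the part divisible by \<open>g\<close> of a
  chain bounded by it bounds \<open>c\<close> up to sign.
\<close>

lemma acyclic_at_link:
  assumes V: "finite V" and down: "\<And>F H. F \<in> \<Delta> \<Longrightarrow> H \<subseteq> F \<Longrightarrow> H \<in> \<Delta>"
    and base: "\<And>W q. W \<subseteq> V \<Longrightarrow> q + N < card W + d \<Longrightarrow>
      acyclic_at TYPE('k::field) V {\<sigma>. \<sigma> \<subseteq> W \<and> \<sigma> \<in> \<Delta>} q"
    and G: "finite G" "G \<subseteq> V" and W: "W \<subseteq> V - G" "q + N < card W + d"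
  shows "acyclic_at TYPE('k) V {\<sigma>. \<sigma> \<subseteq> W \<and> \<sigma> \<union> G \<in> \<Delta>} q"
  using G W
proof (induction G arbitrary: W q rule: finite_induct)
  case empty
  then show ?case using base[of W q] by simp
next
  case (insert g G)
  let ?L = "\<lambda>W. {\<sigma>. \<sigma> \<subseteq> W \<and> \<sigma> \<union> G \<in> \<Delta>}"
  have g: "g \<in> V" "g \<notin> W" "W \<subseteq> V" using insert.prems by auto
  have cW: "card (insert g W) = Suc (card W)" using g V by (simp add: finite_subset)
  show ?case
    unfolding acyclic_at_def
  proof (intro allI impI)
    fix c :: "nat set \<Rightarrow> 'k"
    assume c: "\<forall>\<sigma>. c \<sigma> \<noteq> 0 \<longrightarrow> \<sigma> \<in> {\<sigma>. \<sigma> \<subseteq> W \<and> \<sigma> \<union> insert g G \<in> \<Delta>} \<and> card \<sigma> = q" "\<forall>\<tau>. sd V c \<tau> = 0"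
    have cW': "\<sigma> \<subseteq> W" "\<sigma> \<union> insert g G \<in> \<Delta>" "card \<sigma> = q" if "c \<sigma> \<noteq> 0" for \<sigma> using c(1) that by auto
    \<comment> \<open>The induction hypothesis serves twice, here and below for
      \<open>insert g W\<close> and \<open>Suc q\<close>; raising both sides by one preserves the
      bound.\<close>
    have "acyclic_at TYPE('k) V (?L W) q" by (rule insert.IH) (use insert.prems in auto)
    then obtain b where b: "\<And>\<sigma>. b \<sigma> \<noteq> 0 \<Longrightarrow> \<sigma> \<in> ?L W \<and> card \<sigma> = Suc q" "sd V b = c"
    proof (rule acyclic_atD)
      fix \<sigma> assume "c \<sigma> \<noteq> 0"
      from cW'[OF this] show "\<sigma> \<in> ?L W \<and> card \<sigma> = q" using down[of "\<sigma> \<union> insert g G" "\<sigma> \<union> G"] by blast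
    qed (use c in auto)
    define t where "t \<sigma> = ke g c \<sigma> - b \<sigma>" for \<sigma>
    have t_supp: "\<sigma> \<in> ?L (insert g W) \<and> card \<sigma> = Suc q" if "t \<sigma> \<noteq> 0" for \<sigma>
    proof (cases "b \<sigma> = 0")
      case True
      then have "g \<in> \<sigma>" "c (\<sigma> - {g}) \<noteq> 0" using ke_nonzero[of g c \<sigma>] that by (auto simp: t_def)
      note s = cW'[OF this(2)]
      have "\<sigma> \<subseteq> insert g W" using s(1) by blast
      then have fin: "finite \<sigma>" using finite_subset[of \<sigma> "insert g W"] finite_subset[OF g(3) V] by simp
      have "\<sigma> \<union> G \<in> \<Delta>" by (rule down[OF s(2)]) auto
      then show ?thesis using \<open>\<sigma> \<subseteq> insert g W\<close> s(3) card.remove[OF fin \<open>g \<in> \<sigma>\<close>] by simp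
    qed (use b(1)[of \<sigma>] in auto)
    have t_cyc: "sd V t \<tau> = 0" for \<tau>
    proof -
      have "sd V (ke g c) \<tau> + ke g (sd V c) \<tau> = 1 * c \<tau>"
        by (rule kd_ke[OF V]) (use cW' g in blast)+
      moreover have "ke g (sd V c) \<tau> = 0" using c(2) by (simp add: ke_def)
      ultimately show ?thesis unfolding t_def kd_diff b(2) by simp
    qed
    have ac: "acyclic_at TYPE('k) V (?L (insert g W)) (Suc q)"
      by (rule insert.IH) (use insert.prems insert.hyps g cW in auto)
    obtain h where h: "\<And>\<sigma>. h \<sigma> \<noteq> 0 \<Longrightarrow> \<sigma> \<in> ?L (insert g W) \<and> card \<sigma> = Suc (Suc q)" "sd V h = t"
      using acyclic_atD[OF ac t_supp t_cyc] by blast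
    \<comment> \<open>The part of \<open>h\<close> divisible by \<open>g\<close>, with
      \<open>g\<close> removed. The minus sign arises because the boundary anticommutes with
      multiplication by \<open>g\<close>, up to a term without \<open>g\<close>.\<close>
    define h1 where "h1 \<tau> = (if g \<notin> \<tau> then - (ksgn g \<tau> * h (insert g \<tau>)) else 0)" for \<tau>
    have h1: "\<tau> \<in> {\<sigma>. \<sigma> \<subseteq> W \<and> \<sigma> \<union> insert g G \<in> \<Delta>} \<and> card \<tau> = Suc q" if "h1 \<tau> \<noteq> 0" for \<tau>
    proof -
      have gt: "g \<notin> \<tau>" "h (insert g \<tau>) \<noteq> 0" using that by (auto simp: h1_def split: if_splits)
      have hh: "insert g \<tau> \<subseteq> insert g W" "insert g \<tau> \<union> G \<in> \<Delta>" "card (insert g \<tau>) = Suc (Suc q)"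
        using h(1)[OF gt(2)] by auto
      then have "\<tau> \<subseteq> W" using gt(1) by blast
      moreover have "finite \<tau>" by (rule finite_subset[OF \<open>\<tau> \<subseteq> W\<close> finite_subset[OF g(3) V]])
      ultimately show ?thesis using hh gt by simp
    qed
    have "sd V h1 \<tau> = c \<tau>" for \<tau>
    proof (cases "\<tau> \<subseteq> V \<and> g \<notin> \<tau>")
      case False
      have "c \<tau> = 0" using cW'(1)[of \<tau>] False g by blast
      moreover have "sd V h1 \<tau> = 0"
      proof (rule kd_outside)
        fix j
        show "h1 (insert j \<tau>) = 0"
        proof (rule ccontr)
          assume 0: "h1 (insert j \<tau>) \<noteq> 0"
          then have "g \<notin> insert j \<tau>" by (auto simp: h1_def)
          moreover have "insert j \<tau> \<subseteq> W" using h1[OF 0] by blast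
          ultimately show False using False g(3) by blast
        qed
      qed
      ultimately show ?thesis by simp
    next
      case True
      then have fin: "finite \<tau>" using V finite_subset by blast
      have "b (insert g \<tau>) = 0" using b(1)[of "insert g \<tau>"] g by blast
      then have "t (insert g \<tau>) = ksgn g \<tau> * c \<tau>" using True by (simp add: t_def ke_def)
      then have eq: "sd V h (insert g \<tau>) = ksgn g \<tau> * c \<tau>" by (simp add: h(2))
      have "sd V h1 \<tau> = (\<Sum>j\<in>V - insert g \<tau>. ksgn j \<tau> * h1 (insert j \<tau>))"
        unfolding kd_def mult_1_left
        by (rule sum.mono_neutral_right) (use V in \<open>auto simp: h1_def\<close>)
      also have "\<dots> = (\<Sum>j\<in>V - insert g \<tau>. ksgn g \<tau> * (ksgn j (insert g \<tau>) * (1 * h (insert j (insert g \<tau>)))))"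
      proof (rule sum.cong[OF refl])
        fix j assume j: "j \<in> V - insert g \<tau>"
        then show "ksgn j \<tau> * h1 (insert j \<tau>) = ksgn g \<tau> * (ksgn j (insert g \<tau>) * (1 * h (insert j (insert g \<tau>))))"
          using True fin by (auto simp: h1_def ksgn_insert insert_commute)
      qed
      also have "\<dots> = ksgn g \<tau> * sd V h (insert g \<tau>)" by (simp add: kd_def sum_distrib_left)
      also have "\<dots> = c \<tau>" unfolding eq by (rule ksgn_square)
      finally show ?thesis .
    qed
    then show "\<exists>b. (\<forall>\<sigma>. b \<sigma> \<noteq> 0 \<longrightarrow> \<sigma> \<in> {\<sigma>. \<sigma> \<subseteq> W \<and> \<sigma> \<union> insert g G \<in> \<Delta>} \<and> card \<sigma> = Suc q) \<and> sd V b = c"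
      using h1 by (intro exI[of _ h1]) blast
  qed
qed

text \<open>Removing the marked element matches a set with a chosen member to a set with a chosen
  outsider. This is the adjointness of boundary and coboundary.\<close>

lemma sum_Pow_swap:
  fixes f :: "nat set \<Rightarrow> nat \<Rightarrow> nat set \<Rightarrow> 'a::comm_monoid_add"
  assumes "finite V"
  shows "(\<Sum>\<sigma>\<in>Pow V. \<Sum>j\<in>\<sigma>. f (\<sigma> - {j}) j \<sigma>) = (\<Sum>\<tau>\<in>Pow V. \<Sum>j\<in>V - \<tau>. f \<tau> j (insert j \<tau>))"
proof -
  have "(\<Sum>\<sigma>\<in>Pow V. \<Sum>j\<in>\<sigma>. f (\<sigma> - {j}) j \<sigma>) = (\<Sum>(\<sigma>, j)\<in>Sigma (Pow V) (\<lambda>\<sigma>. \<sigma>). f (\<sigma> - {j}) j \<sigma>)"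
    by (rule sum.Sigma) (use assms in \<open>auto intro: finite_subset\<close>)
  also have "\<dots> = (\<Sum>(\<tau>, j)\<in>Sigma (Pow V) (\<lambda>\<tau>. V - \<tau>). f \<tau> j (insert j \<tau>))"
    by (rule sum.reindex_bij_witness[where i = "\<lambda>(\<tau>, j). (insert j \<tau>, j)" and j = "\<lambda>(\<sigma>, j). (\<sigma> - {j}, j)"])
      (auto simp: insert_absorb)
  also have "\<dots> = (\<Sum>\<tau>\<in>Pow V. \<Sum>j\<in>V - \<tau>. f \<tau> j (insert j \<tau>))"
    by (rule sum.Sigma[symmetric]) (use assms in auto)
  finally show ?thesis .
qed

lemma vector_space_pointwise: "vector_space (\<lambda>(a::'k::field) (x :: 'i \<Rightarrow> 'k) i. a * x i)"
  by unfold_locales (auto simp: fun_eq_iff algebra_simps)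

text \<open>
  A cycle that is no boundary is detected by a linear functional vanishing on the boundaries,
  that is by a cocycle; if this is a coboundary it vanishes on all cycles.
\<close>

lemma acyclic_at_dual:
  assumes V: "finite V" and D: "D \<subseteq> Pow V" and down: "\<And>F H. F \<in> D \<Longrightarrow> H \<subseteq> F \<Longrightarrow> H \<in> D"
    and co: "\<And>\<phi>::nat set \<Rightarrow> 'k::field. (\<And>\<sigma>. \<phi> \<sigma> \<noteq> 0 \<Longrightarrow> \<sigma> \<in> D \<and> card \<sigma> = q) \<Longrightarrow>
      (\<And>\<rho>. \<rho> \<in> D \<Longrightarrow> card \<rho> = Suc q \<Longrightarrow> (\<Sum>j\<in>\<rho>. ksgn j (\<rho> - {j}) * \<phi> (\<rho> - {j})) = 0) \<Longrightarrow>
      \<exists>\<psi>. \<forall>\<rho>\<in>D. card \<rho> = q \<longrightarrow> \<phi> \<rho> = (\<Sum>j\<in>\<rho>. ksgn j (\<rho> - {j}) * \<psi> (\<rho> - {j}))"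
  shows "acyclic_at TYPE('k) V D q"
  unfolding acyclic_at_def
proof (intro allI impI)
  fix c :: "nat set \<Rightarrow> 'k"
  assume c: "\<forall>\<sigma>. c \<sigma> \<noteq> 0 \<longrightarrow> \<sigma> \<in> D \<and> card \<sigma> = q" "\<forall>\<tau>. sd V c \<tau> = 0"
  let ?s = "\<lambda>(a::'k) (x :: nat set \<Rightarrow> 'k) i. a * x i"
  interpret W: vector_space ?s by (rule vector_space_pointwise)
  interpret P: vector_space_pair ?s "(*) :: 'k \<Rightarrow> 'k \<Rightarrow> 'k"
    by (intro vector_space_pair.intro vector_space_pointwise) (unfold_locales, auto simp: algebra_simps)
  define S :: "(nat set \<Rightarrow> 'k) set" where "S = {sd V b | b. \<forall>\<sigma>. b \<sigma> \<noteq> 0 \<longrightarrow> \<sigma> \<in> D \<and> card \<sigma> = Suc q}"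
  have "c \<in> S"
  proof (rule ccontr)
    assume cS: "c \<notin> S"
    have subS: "W.subspace S"
    proof (rule W.subspaceI)
      show "0 \<in> S" unfolding S_def by (intro CollectI exI[of _ "\<lambda>_. 0"]) (simp add: fun_eq_iff)
    next
      fix x y assume "x \<in> S" "y \<in> S"
      then obtain a b where "x = sd V a" "\<forall>\<sigma>. a \<sigma> \<noteq> 0 \<longrightarrow> \<sigma> \<in> D \<and> card \<sigma> = Suc q"
        "y = sd V b" "\<forall>\<sigma>. b \<sigma> \<noteq> 0 \<longrightarrow> \<sigma> \<in> D \<and> card \<sigma> = Suc q" by (auto simp: S_def)
      then show "x + y \<in> S" unfolding S_def
        by (intro CollectI exI[of _ "\<lambda>\<sigma>. a \<sigma> + b \<sigma>"]) (auto simp: kd_add fun_eq_iff, (metis add_0)+)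
    next
      fix a x assume "x \<in> S"
      then obtain b where "x = sd V b" "\<forall>\<sigma>. b \<sigma> \<noteq> 0 \<longrightarrow> \<sigma> \<in> D \<and> card \<sigma> = Suc q" by (auto simp: S_def)
      then show "?s a x \<in> S" unfolding S_def
        by (intro CollectI exI[of _ "\<lambda>\<sigma>. a * b \<sigma>"]) (auto simp: kd_scale fun_eq_iff)
    qed
    obtain B where B: "B \<subseteq> S" "W.independent B" "S \<subseteq> W.span B" by (rule W.basis_exists)
    have sB: "W.span B = S" using B subS W.span_minimal by blast
    have "W.independent (insert c B)" using B cS sB by (intro W.independent_insertI) auto
    from P.linear_independent_extend[OF this, of "\<lambda>x. if x = c then 1 else 0"]
    obtain g where g: "Vector_Spaces.linear ?s (*) g" "\<forall>x\<in>insert c B. g x = (if x = c then 1 else 0)"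
      by blast
    interpret g: Vector_Spaces.linear ?s "(*) :: 'k \<Rightarrow> 'k \<Rightarrow> 'k" g by (rule g(1))
    have gc: "g c = 1" using g(2) by simp
    have gB: "g x = 0" if "x \<in> B" for x using g(2) that cS B(1) by auto
    have gS: "g x = 0" if "x \<in> S" for x
      by (rule P.linear_eq_0_on_span[OF g(1) gB]) (use that sB in auto)
    define e where "e \<sigma> = (\<lambda>\<tau>. if \<tau> = \<sigma> then 1 else (0::'k))" for \<sigma> :: "nat set"
    \<comment> \<open>The functional in coordinates, cut off to a cochain on the members of
      \<open>D\<close> of cardinality \<open>q\<close>.\<close>
    define \<phi> where "\<phi> \<sigma> = (if \<sigma> \<in> D \<and> card \<sigma> = q then g (e \<sigma>) else 0)" for \<sigma>
    have g_eq: "g x = (\<Sum>\<sigma>\<in>Pow V. x \<sigma> * \<phi> \<sigma>)" if x: "\<And>\<sigma>. x \<sigma> \<noteq> 0 \<Longrightarrow> \<sigma> \<in> D \<and> card \<sigma> = q" for x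
    proof -
      have "x = (\<Sum>\<sigma>\<in>Pow V. ?s (x \<sigma>) (e \<sigma>))"
      proof
        fix \<tau>
        have "(\<Sum>\<sigma>\<in>A. ?s (x \<sigma>) (e \<sigma>)) \<tau> = (if \<tau> \<in> A then x \<tau> else 0)" if "finite A" for A
          using that by (induction A rule: finite_induct) (auto simp: e_def)
        then show "x \<tau> = (\<Sum>\<sigma>\<in>Pow V. ?s (x \<sigma>) (e \<sigma>)) \<tau>" using V x[of \<tau>] D by auto
      qed
      then have "g x = g (\<Sum>\<sigma>\<in>Pow V. ?s (x \<sigma>) (e \<sigma>))" by (rule arg_cong)
      also have "\<dots> = (\<Sum>\<sigma>\<in>Pow V. x \<sigma> * g (e \<sigma>))" by (simp only: g.sum g.scale)
      also have "\<dots> = (\<Sum>\<sigma>\<in>Pow V. x \<sigma> * \<phi> \<sigma>)"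
      proof (rule sum.cong[OF refl])
        fix \<sigma> show "x \<sigma> * g (e \<sigma>) = x \<sigma> * \<phi> \<sigma>" using x[of \<sigma>] by (cases "x \<sigma> = 0") (auto simp: \<phi>_def)
      qed
      finally show ?thesis .
    qed
    have "\<exists>\<psi>. \<forall>\<rho>\<in>D. card \<rho> = q \<longrightarrow> \<phi> \<rho> = (\<Sum>j\<in>\<rho>. ksgn j (\<rho> - {j}) * \<psi> (\<rho> - {j}))"
    proof (rule co)
      fix \<sigma> assume "\<phi> \<sigma> \<noteq> 0" then show "\<sigma> \<in> D \<and> card \<sigma> = q" by (auto simp: \<phi>_def split: if_splits)
    next
      fix \<rho> assume \<rho>: "\<rho> \<in> D" "card \<rho> = Suc q"
      have "sd V (e \<rho>) \<in> S" unfolding S_def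
        by (intro CollectI exI[of _ "e \<rho>"]) (use \<rho> in \<open>auto simp: e_def\<close>)
      \<comment> \<open>Its value on the boundary of a single face is the coboundary of \<phi> at
        that face.\<close>
      then have "0 = g (sd V (e \<rho>))" using gS by simp
      also have "\<dots> = (\<Sum>\<sigma>\<in>Pow V. sd V (e \<rho>) \<sigma> * \<phi> \<sigma>)"
      proof (rule g_eq)
        fix \<sigma> assume "sd V (e \<rho>) \<sigma> \<noteq> 0"
        then obtain j where j: "j \<in> V - \<sigma>" "e \<rho> (insert j \<sigma>) \<noteq> 0" using kd_nonzero by blast
        then have "insert j \<sigma> = \<rho>" by (auto simp: e_def split: if_splits)
        moreover from this have "finite \<sigma>" using \<rho> D V by (metis PowD finite_insert finite_subset subsetD)
        ultimately show "\<sigma> \<in> D \<and> card \<sigma> = q" using j \<rho> down[of \<rho> \<sigma>] by auto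
      qed
      also have "\<dots> = (\<Sum>\<sigma>\<in>Pow V. \<Sum>j\<in>V - \<sigma>. ksgn j \<sigma> * e \<rho> (insert j \<sigma>) * \<phi> \<sigma>)"
        by (simp add: kd_def sum_distrib_right)
      also have "\<dots> = (\<Sum>\<sigma>\<in>Pow V. \<Sum>j\<in>\<sigma>. ksgn j (\<sigma> - {j}) * e \<rho> \<sigma> * \<phi> (\<sigma> - {j}))"
        by (rule sum_Pow_swap[OF V, symmetric])
      also have "\<dots> = (\<Sum>\<sigma>\<in>{\<rho>}. \<Sum>j\<in>\<sigma>. ksgn j (\<sigma> - {j}) * e \<rho> \<sigma> * \<phi> (\<sigma> - {j}))"
        by (rule sum.mono_neutral_right) (use V \<rho> D in \<open>auto simp: e_def\<close>)
      also have "\<dots> = (\<Sum>j\<in>\<rho>. ksgn j (\<rho> - {j}) * \<phi> (\<rho> - {j}))" by (simp add: e_def)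
      finally show "(\<Sum>j\<in>\<rho>. ksgn j (\<rho> - {j}) * \<phi> (\<rho> - {j})) = 0" by simp
    qed
    then obtain \<psi> where \<psi>: "\<And>\<rho>. \<rho> \<in> D \<Longrightarrow> card \<rho> = q \<Longrightarrow> \<phi> \<rho> = (\<Sum>j\<in>\<rho>. ksgn j (\<rho> - {j}) * \<psi> (\<rho> - {j}))"
      by blast
    \<comment> \<open>By adjointness the pairing of \<open>c\<close> with the coboundary of \<psi>
      is that of the boundary of \<open>c\<close> with \<psi>, hence 0, although
      \<open>g c = 1\<close>.\<close>
    have "g c = (\<Sum>\<sigma>\<in>Pow V. c \<sigma> * \<phi> \<sigma>)" by (rule g_eq) (use c in blast)
    also have "\<dots> = (\<Sum>\<sigma>\<in>Pow V. \<Sum>j\<in>\<sigma>. c \<sigma> * (ksgn j (\<sigma> - {j}) * \<psi> (\<sigma> - {j})))"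
    proof (rule sum.cong[OF refl])
      fix \<sigma>
      show "c \<sigma> * \<phi> \<sigma> = (\<Sum>j\<in>\<sigma>. c \<sigma> * (ksgn j (\<sigma> - {j}) * \<psi> (\<sigma> - {j})))"
        using \<psi>[of \<sigma>] c(1) by (cases "c \<sigma> = 0") (auto simp: sum_distrib_left)
    qed
    also have "\<dots> = (\<Sum>\<tau>\<in>Pow V. \<Sum>j\<in>V - \<tau>. c (insert j \<tau>) * (ksgn j \<tau> * \<psi> \<tau>))"
      by (rule sum_Pow_swap[OF V])
    also have "\<dots> = (\<Sum>\<tau>\<in>Pow V. sd V c \<tau> * \<psi> \<tau>)"
    proof (rule sum.cong[OF refl])
      fix \<tau>
      have "c (insert j \<tau>) * (ksgn j \<tau> * \<psi> \<tau>) = ksgn j \<tau> * (1 * c (insert j \<tau>)) * \<psi> \<tau>" for j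
        by simp
      then show "(\<Sum>j\<in>V - \<tau>. c (insert j \<tau>) * (ksgn j \<tau> * \<psi> \<tau>)) = sd V c \<tau> * \<psi> \<tau>"
        unfolding kd_def sum_distrib_right by (rule sum.cong[OF refl])
    qed
    also have "\<dots> = 0" using c(2) by simp
    finally show False using gc by simp
  qed
  then show "\<exists>b. (\<forall>\<sigma>. b \<sigma> \<noteq> 0 \<longrightarrow> \<sigma> \<in> D \<and> card \<sigma> = Suc q) \<and> sd V b = c" by (auto simp: S_def)
qed

text \<open>Vanishing of the \<open>i\<close>-th Koszul homology of the residue ring of \<open>Q\<close>.\<close>

definition kexact :: "nat set \<Rightarrow> 'k::field mpoly set \<Rightarrow> nat \<Rightarrow> bool" where
  "kexact V Q i \<longleftrightarrow> (\<forall>z. (\<forall>\<sigma>. z \<sigma> \<noteq> 0 \<longrightarrow> \<sigma> \<subseteq> V \<and> card \<sigma> = i) \<longrightarrow> (\<forall>\<sigma>. z \<sigma> \<in> Pol V) \<longrightarrow>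
     (\<forall>\<tau>. kdm V z \<tau> \<in> Q) \<longrightarrow>
     (\<exists>y. (\<forall>\<sigma>. y \<sigma> \<noteq> 0 \<longrightarrow> \<sigma> \<subseteq> V \<and> card \<sigma> = Suc i) \<and> (\<forall>\<sigma>. y \<sigma> \<in> Pol V) \<and>
       (\<forall>\<sigma>. z \<sigma> - kdm V y \<sigma> \<in> Q)))"

lemma kexactD:
  assumes "kexact V Q i" "\<And>\<sigma>. z \<sigma> \<noteq> 0 \<Longrightarrow> \<sigma> \<subseteq> V \<and> card \<sigma> = i" "\<And>\<sigma>. z \<sigma> \<in> Pol V" "\<And>\<tau>. kdm V z \<tau> \<in> Q"
  shows "\<exists>y. (\<forall>\<sigma>. y \<sigma> \<noteq> 0 \<longrightarrow> \<sigma> \<subseteq> V \<and> card \<sigma> = Suc i) \<and> (\<forall>\<sigma>. y \<sigma> \<in> Pol V) \<and> (\<forall>\<sigma>. z \<sigma> - kdm V y \<sigma> \<in> Q)"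
  using assms unfolding kexact_def by blast

text \<open>The elements of \<open>W\<close> below \<open>j\<close> are split between
  \<open>W - \<rho>\<close> and \<open>\<rho> - {j}\<close>, and signs are their own inverses. This
  relates Koszul signs on complements to coboundary signs.\<close>

lemma ksgn_Diff:
  assumes "finite W" "\<rho> \<subseteq> W" "j \<in> \<rho>"
  shows "ksgn j (W - \<rho>) = ksgn j W * ksgn j (\<rho> - {j})"
proof -
  have fin: "finite \<rho>" using assms finite_subset by blast
  have "ksgn j W = ksgn j ((W - \<rho>) \<union> \<rho>)" using assms by (simp add: Un_absorb2)
  also have "\<dots> = ksgn j (W - \<rho>) * ksgn j \<rho>" by (rule ksgn_Un) (use assms fin in auto)
  also have "ksgn j \<rho> = ksgn j (insert j (\<rho> - {j}))" using assms by (simp add: insert_absorb)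
  also have "\<dots> = ksgn j (\<rho> - {j})" using fin by (subst ksgn_insert) auto
  finally show ?thesis using ksgn_square[of j "\<rho> - {j}" "ksgn j (W - \<rho>)"] by (metis mult.commute)
qed

text \<open>
  The multidegree \<open>W\<close> part of the Koszul complex of the Stanley-Reisner ring is the cochain
  complex of the restriction to \<open>W\<close>, with \<open>\<sigma>\<close> corresponding to \<open>W - \<sigma>\<close>.
\<close>

lemma acyclic_at_restriction:
  fixes \<Delta> :: "nat set set"
  assumes V: "finite V" and W: "W \<subseteq> V" and down: "\<And>F H. F \<in> \<Delta> \<Longrightarrow> H \<subseteq> F \<Longrightarrow> H \<in> \<Delta>"
    and ex: "kexact V (mideal V (chi ` {N. N \<subseteq> V \<and> N \<notin> \<Delta>}) :: 'k::field mpoly set) i" and i: "i + q = card W"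
  shows "acyclic_at TYPE('k) V {\<sigma>. \<sigma> \<subseteq> W \<and> \<sigma> \<in> \<Delta>} q"
proof (rule acyclic_at_dual[OF V])
  show "{\<sigma>. \<sigma> \<subseteq> W \<and> \<sigma> \<in> \<Delta>} \<subseteq> Pow V" using W by auto
  show "H \<in> {\<sigma>. \<sigma> \<subseteq> W \<and> \<sigma> \<in> \<Delta>}" if "F \<in> {\<sigma>. \<sigma> \<subseteq> W \<and> \<sigma> \<in> \<Delta>}" "H \<subseteq> F" for F H
    using that down by auto
  fix \<phi> :: "nat set \<Rightarrow> 'k"
  assume \<phi>: "\<And>\<sigma>. \<phi> \<sigma> \<noteq> 0 \<Longrightarrow> \<sigma> \<in> {\<sigma>. \<sigma> \<subseteq> W \<and> \<sigma> \<in> \<Delta>} \<and> card \<sigma> = q"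
    and cocyc: "\<And>\<rho>. \<rho> \<in> {\<sigma>. \<sigma> \<subseteq> W \<and> \<sigma> \<in> \<Delta>} \<Longrightarrow> card \<rho> = Suc q \<Longrightarrow>
      (\<Sum>j\<in>\<rho>. ksgn j (\<rho> - {j}) * \<phi> (\<rho> - {j})) = 0"
  have fW: "finite W" using V W finite_subset by blast
  let ?I = "mideal V (chi ` {N. N \<subseteq> V \<and> N \<notin> \<Delta>}) :: 'k mpoly set"
  \<comment> \<open>Passing to complements costs a factor \<open>ksgn j W\<close> for each element;
    \<eta> collects these factors, so that complementation commutes with the differentials.\<close>
  define \<eta> :: "nat set \<Rightarrow> 'k" where "\<eta> \<rho> = (\<Prod>j\<in>\<rho>. ksgn j W)" for \<rho>
  have \<eta>2: "\<eta> \<rho> * (\<eta> \<rho> * a) = a" for \<rho> a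
  proof -
    have "\<eta> \<rho> * \<eta> \<rho> = (\<Prod>j\<in>\<rho>. ksgn j W * (ksgn j W * 1))" by (simp add: \<eta>_def prod.distrib)
    also have "\<dots> = 1" by (simp only: ksgn_square) simp
    finally show ?thesis by (simp add: mult.assoc[symmetric])
  qed
  have \<eta>_sgn: "ksgn j (W - \<rho>) * \<eta> (\<rho> - {j}) = \<eta> \<rho> * ksgn j (\<rho> - {j})" if "\<rho> \<subseteq> W" "j \<in> \<rho>" for \<rho> j
  proof -
    have "\<eta> \<rho> = ksgn j W * \<eta> (\<rho> - {j})"
      unfolding \<eta>_def using that fW by (intro prod.remove) (auto intro: finite_subset)
    then show ?thesis using ksgn_Diff[OF fW that, where 'a = 'k] by (simp add: algebra_simps)
  qed
  \<comment> \<open>The cochain \<phi> as a Koszul chain of multidegree \<open>chi W\<close>: on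
    \<sigma> the monomial must be the one on \<open>W - \<sigma>\<close>.\<close>
  define z where "z \<sigma> = (if \<sigma> \<subseteq> W then sing (chi (W - \<sigma>)) (\<eta> (W - \<sigma>) * \<phi> (W - \<sigma>)) else 0)" for \<sigma>
  have ksgn_single: "ksgn j \<tau> * (sing u c :: 'k mpoly) = sing u (ksgn j \<tau> * c)" for j \<tau> u and c :: 'k
    by (rule poly_mapping_eqI) (simp add: lookup_ksgn_times lookup_single when_def)
  have "\<exists>y. (\<forall>\<sigma>. y \<sigma> \<noteq> 0 \<longrightarrow> \<sigma> \<subseteq> V \<and> card \<sigma> = Suc i) \<and> (\<forall>\<sigma>. y \<sigma> \<in> Pol V) \<and> (\<forall>\<sigma>. z \<sigma> - kdm V y \<sigma> \<in> ?I)"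
  proof (rule kexactD[OF ex])
    fix \<sigma> assume "z \<sigma> \<noteq> 0"
    then have s: "\<sigma> \<subseteq> W" "\<phi> (W - \<sigma>) \<noteq> 0" by (auto simp: z_def split: if_splits)
    then have "card (W - \<sigma>) = q" using \<phi> by blast
    then have "card \<sigma> = i" using s(1) fW i card_Diff_subset[of \<sigma> W] card_mono[of W \<sigma>]
      by (simp add: finite_subset)
    then show "\<sigma> \<subseteq> V \<and> card \<sigma> = i" using s W by auto
  next
    fix \<sigma> show "z \<sigma> \<in> Pol V" using W fW by (auto simp: z_def Pol_single keys_chi)
  next
    fix \<tau>
    show "kdm V z \<tau> \<in> ?I"
    proof (cases "\<tau> \<subseteq> W")
      case False
      then have "kdm V z \<tau> = 0" by (intro kd_outside) (auto simp: z_def)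
      then show ?thesis using ideal_mpoly_ringD(2)[OF ideal_mideal] by simp
    next
      case True
      define \<rho> where "\<rho> = W - \<tau>"
      have \<rho>: "\<rho> \<subseteq> W" "W - \<rho> = \<tau>" "finite \<rho>" using True fW by (auto simp: \<rho>_def)
      have "kdm V z \<tau> = (\<Sum>j\<in>\<rho>. ksgn j \<tau> * (mvar j * z (insert j \<tau>)))"
        unfolding kd_def by (rule sum.mono_neutral_right) (use V W in \<open>auto simp: \<rho>_def z_def\<close>)
      also have "\<dots> = (\<Sum>j\<in>\<rho>. sing (chi \<rho>) (\<eta> \<rho> * (ksgn j (\<rho> - {j}) * \<phi> (\<rho> - {j}))))"
      proof (rule sum.cong[OF refl])
        fix j assume j: "j \<in> \<rho>"
        have e: "W - insert j \<tau> = \<rho> - {j}" "insert j \<tau> \<subseteq> W" using j True by (auto simp: \<rho>_def)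
        have "chi \<rho> = sing j 1 + chi (\<rho> - {j})"
          using chi_insert[of "\<rho> - {j}" j] j \<rho>(3) by (simp add: insert_absorb)
        then have "mvar j * z (insert j \<tau>) = sing (chi \<rho>) (\<eta> (\<rho> - {j}) * \<phi> (\<rho> - {j}))"
          using e by (simp add: z_def mvar_def mult_single)
        then show "ksgn j \<tau> * (mvar j * z (insert j \<tau>)) = sing (chi \<rho>) (\<eta> \<rho> * (ksgn j (\<rho> - {j}) * \<phi> (\<rho> - {j})))"
          using \<eta>_sgn[OF \<rho>(1) j] unfolding \<rho>(2) by (simp add: ksgn_single mult.assoc[symmetric])
      qed
      also have "\<dots> = sing (chi \<rho>) (\<eta> \<rho> * (\<Sum>j\<in>\<rho>. ksgn j (\<rho> - {j}) * \<phi> (\<rho> - {j})))"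
        by (rule poly_mapping_eqI) (simp add: lookup_sum lookup_single when_def sum_distrib_left)
      finally have eq: "kdm V z \<tau> = sing (chi \<rho>) (\<eta> \<rho> * (\<Sum>j\<in>\<rho>. ksgn j (\<rho> - {j}) * \<phi> (\<rho> - {j})))" .
      show ?thesis
      \<comment> \<open>On a face the coefficient vanishes by the cocycle condition; on a nonface
        the monomial already lies in the ideal.\<close>
      proof (cases "\<rho> \<in> \<Delta>")
        case True
        have "(\<Sum>j\<in>\<rho>. ksgn j (\<rho> - {j}) * \<phi> (\<rho> - {j})) = 0"
        proof (cases "card \<rho> = Suc q")
          case False
          have "\<phi> (\<rho> - {j}) = 0" if "j \<in> \<rho>" for j
            using \<phi>[of "\<rho> - {j}"] False card.remove[OF \<rho>(3) that] by auto
          then show ?thesis by simp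
        qed (use cocyc True \<rho> in auto)
        then show ?thesis using eq ideal_mpoly_ringD(2)[OF ideal_mideal] by simp
      next
        case False
        then have "chi \<rho> \<in> chi ` {N. N \<subseteq> V \<and> N \<notin> \<Delta>}" using \<rho> W by blast
        then show ?thesis unfolding eq
          by (rule single_in_mideal[OF _ adds_refl]) (use \<rho> W keys_chi in auto)
      qed
    qed
  qed
  then obtain y where y: "\<And>\<sigma>. z \<sigma> - kdm V y \<sigma> \<in> ?I" by blast
  \<comment> \<open>The part of \<open>y\<close> in multidegree \<open>chi W\<close>, carried back
    to complements.\<close>
  define \<psi> where "\<psi> \<rho> = \<eta> \<rho> * lk (y (W - \<rho>)) (chi \<rho>)" for \<rho>
  have "\<phi> \<rho> = (\<Sum>j\<in>\<rho>. ksgn j (\<rho> - {j}) * \<psi> (\<rho> - {j}))" if \<rho>: "\<rho> \<subseteq> W" "\<rho> \<in> \<Delta>" for \<rho>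
  proof -
    define \<sigma> where "\<sigma> = W - \<rho>"
    have fr: "finite \<rho>" using \<rho> fW finite_subset by blast
    have \<sigma>: "\<sigma> \<subseteq> W" "W - \<sigma> = \<rho>" using \<rho> by (auto simp: \<sigma>_def)
    \<comment> \<open>The support of each term in the ideal contains a nonface, so on faces
      congruence modulo the ideal is equality of coefficients.\<close>
    have "lk (z \<sigma> - kdm V y \<sigma>) (chi \<rho>) = 0"
    proof (rule ccontr)
      assume "lk (z \<sigma> - kdm V y \<sigma>) (chi \<rho>) \<noteq> 0"
      then have "chi \<rho> \<in> ks (z \<sigma> - kdm V y \<sigma>)" by (simp only: in_keys_iff not_False_eq_True)
      then obtain N where N: "N \<subseteq> V" "N \<notin> \<Delta>" "chi N adds chi \<rho>" using y[of \<sigma>] by (auto simp: mideal_def)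
      then have "N \<subseteq> \<rho>" using V fr by (simp add: chi_adds_iff keys_chi finite_subset)
      then show False using N(2) \<rho>(2) down by blast
    qed
    then have "lk (z \<sigma>) (chi \<rho>) = lk (kdm V y \<sigma>) (chi \<rho>)" by (simp add: lookup_minus)
    moreover have "lk (z \<sigma>) (chi \<rho>) = \<eta> \<rho> * \<phi> \<rho>" using \<sigma> by (simp add: z_def)
    moreover have "lk (kdm V y \<sigma>) (chi \<rho>) =
        (\<Sum>j\<in>V - \<sigma>. ksgn j \<sigma> * (if j \<in> \<rho> then lk (y (insert j \<sigma>)) (chi \<rho> - sing j 1) else 0))"
      by (simp add: kd_def lookup_sum lookup_ksgn_times lookup_mvar_times keys_chi fr del: One_nat_def)
    moreover have "\<dots> = (\<Sum>j\<in>\<rho>. ksgn j \<sigma> * (if j \<in> \<rho> then lk (y (insert j \<sigma>)) (chi \<rho> - sing j 1) else 0))"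
      by (rule sum.mono_neutral_right) (use V W \<sigma> in auto)
    moreover have "\<dots> = (\<Sum>j\<in>\<rho>. \<eta> \<rho> * (ksgn j (\<rho> - {j}) * \<psi> (\<rho> - {j})))"
    proof (rule sum.cong[OF refl])
      fix j assume j: "j \<in> \<rho>"
      have e: "insert j \<sigma> = W - (\<rho> - {j})" using j \<rho> by (auto simp: \<sigma>_def)
      have "chi \<rho> - sing j 1 = chi (\<rho> - {j})"
        using chi_Diff[of \<rho> "{j}"] j fr by (simp add: chi_def)
      then have "(if j \<in> \<rho> then lk (y (insert j \<sigma>)) (chi \<rho> - sing j 1) else 0) = \<eta> (\<rho> - {j}) * \<psi> (\<rho> - {j})"
        using j by (simp add: \<psi>_def \<eta>2 e del: One_nat_def)
      then show "ksgn j \<sigma> * (if j \<in> \<rho> then lk (y (insert j \<sigma>)) (chi \<rho> - sing j 1) else 0) =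
          \<eta> \<rho> * (ksgn j (\<rho> - {j}) * \<psi> (\<rho> - {j}))"
        using \<eta>_sgn[OF \<rho>(1) j] by (simp add: \<sigma>_def mult.assoc[symmetric])
    qed
    ultimately have "\<eta> \<rho> * \<phi> \<rho> = \<eta> \<rho> * (\<Sum>j\<in>\<rho>. ksgn j (\<rho> - {j}) * \<psi> (\<rho> - {j}))"
      by (simp add: sum_distrib_left)
    then show ?thesis using \<eta>2 by metis
  qed
  then show "\<exists>\<psi>. \<forall>\<rho>\<in>{\<sigma>. \<sigma> \<subseteq> W \<and> \<sigma> \<in> \<Delta>}. card \<rho> = q \<longrightarrow> \<phi> \<rho> = (\<Sum>j\<in>\<rho>. ksgn j (\<rho> - {j}) * \<psi> (\<rho> - {j}))"
    by blast
qed

text \<open>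
  In a squarefree multidegree \<open>W\<close> the Koszul complex of the dual ideal is the chain complex of
  the link of the complement of \<open>W\<close>; in the other multidegrees it is a cone.
\<close>

lemma alexander_dual_linear:
  fixes \<F> :: "nat set set"
  assumes V: "finite V" and F: "\<And>F. F \<in> \<F> \<Longrightarrow> F \<subseteq> V \<and> card F = d" and e: "e + d = card V"
    and ac: "\<And>G q. G \<subseteq> V \<Longrightarrow> q + card G < d \<Longrightarrow>
      acyclic_at TYPE('k::field) V {\<sigma>. \<sigma> \<subseteq> V - G \<and> (\<exists>F\<in>\<F>. \<sigma> \<union> G \<subseteq> F)} q"
    and j: "j \<noteq> int q + int e"
  shows "KZ V (mideal V ((\<lambda>F. chi (V - F)) ` \<F>) :: 'k mpoly set) q j
    \<subseteq> KB V (mideal V ((\<lambda>F. chi (V - F)) ` \<F>)) q j"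
proof
  let ?U = "(\<lambda>F. chi (V - F)) ` \<F>"
  fix z :: "nat set \<Rightarrow> 'k mpoly" assume "z \<in> KZ V (mideal V ?U) q j"
  then have z: "z \<in> KK V (mideal V ?U) q j" and cyc: "kdm V z = 0" by (auto simp: KZ_def)
  have "\<exists>y\<in>KK V (mideal V ?U) (Suc q) j. kdm V y = z"
  proof (rule KK_mideal_exact[OF V z])
    show "kdm V z \<tau> = 0" for \<tau> using cyc by simp
    fix u assume u: "int (tdeg u) = j" "ks u \<subseteq> V" "\<exists>\<sigma>. slice u z \<sigma> \<noteq> 0"
    let ?D = "{\<sigma>. \<sigma> \<subseteq> ks u \<and> (\<exists>g\<in>?U. g adds u - chi \<sigma>)}"
    obtain \<sigma> where \<sigma>: "slice u z \<sigma> \<noteq> 0" using u(3) by blast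
    then have k: "u - chi \<sigma> \<in> ks (z \<sigma>)" by (auto simp: slice_def in_keys_iff split: if_splits)
    then obtain F0 where F0: "F0 \<in> \<F>" "chi (V - F0) adds u - chi \<sigma>"
      using KKD(3)[OF z, of \<sigma>] by (auto simp: mideal_def)
    have "tdeg (chi (V - F0)) = e"
      using F[OF F0(1)] V e card_Diff_subset[of F0 V] finite_subset[of F0 V] by (simp add: tdeg_chi)
    then have "e \<le> tdeg (u - chi \<sigma>)" using adds_tdeg[OF F0(2)] by simp
    moreover have "int (tdeg (u - chi \<sigma>)) = j - int q" using KKD(4)[OF z, of \<sigma>] k by (simp add: homogeneous_iff)
    ultimately have ju: "q + e < tdeg u" using j u(1) by linarith
    show "acyclic_at TYPE('k) V ?D q"
    proof (cases "\<exists>i. lk u i \<ge> 2")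
      case True
      then obtain i where i: "lk u i \<ge> 2" by blast
      then have iu: "i \<in> ks u" by (simp add: in_keys_iff)
      show ?thesis
      proof (rule acyclic_at_cone[OF V, of _ i])
        show "?D \<subseteq> Pow V" using u(2) by auto
        show "i \<in> V" using iu u(2) by blast
        fix \<sigma> assume "\<sigma> \<in> ?D"
        then obtain F where s: "\<sigma> \<subseteq> ks u" "F \<in> \<F>" "chi (V - F) adds u - chi \<sigma>" by blast
        have fin: "finite \<sigma>" by (rule finite_subset[OF s(1)]) simp
        \<comment> \<open>The generators are squarefree, and the exponent of \<open>i\<close> stays
          at least 1 when \<open>i\<close> is inserted; so \<open>i\<close> is an apex.\<close>
        have "chi (V - F) adds u - chi (insert i \<sigma>)"
          unfolding adds_def
        proof
          fix k show "lk (chi (V - F)) k \<le> lk (u - chi (insert i \<sigma>)) k"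
            using s(3)[unfolded adds_def, rule_format, of k] i V fin
            by (cases "k = i") (auto simp: lookup_minus lookup_chi)
        qed
        then show "insert i \<sigma> \<in> ?D" using s iu by blast
      qed
    next
      case False
      then have u1: "lk u i \<le> 1" for i by (simp add: not_le less_Suc_eq_le numeral_2_eq_2)
      define G where "G = V - ks u"
      have uc: "u = chi (ks u)"
      proof (rule poly_mapping_eqI)
        fix i show "lk u i = lk (chi (ks u)) i"
          using u1[of i] by (auto simp: lookup_chi in_keys_iff)
      qed
      then have tu: "tdeg u = card (ks u)" by (metis finite_keys tdeg_chi)
      have "card G = card V - card (ks u)"
        using u(2) V by (simp add: G_def card_Diff_subset)
      moreover have "card (ks u) \<le> card V" using u(2) V card_mono by blast
      \<comment> \<open>As \<open>card G = card V - tdeg u\<close> and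
        \<open>e + d = card V\<close>, this is the bound \<open>q + e < tdeg u\<close>.\<close>
      ultimately have "q + card G < d" using ju tu e by linarith
      moreover have "?D = {\<sigma>. \<sigma> \<subseteq> V - G \<and> (\<exists>F\<in>\<F>. \<sigma> \<union> G \<subseteq> F)}"
      proof -
        have "V - G = ks u" using u(2) by (auto simp: G_def)
        moreover have iff: "chi (V - F) adds u - chi \<sigma> \<longleftrightarrow> \<sigma> \<union> G \<subseteq> F" if "\<sigma> \<subseteq> ks u" "F \<in> \<F>" for \<sigma> F
        proof -
          have "u - chi \<sigma> = chi (ks u - \<sigma>)" using chi_Diff[OF finite_keys that(1)] uc by metis
          then have "chi (V - F) adds u - chi \<sigma> \<longleftrightarrow> V - F \<subseteq> ks u - \<sigma>"
            using V by (simp add: chi_adds_iff keys_chi)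
          also have "\<dots> \<longleftrightarrow> \<sigma> \<union> G \<subseteq> F" using that F[OF that(2)] u(2) by (auto simp: G_def)
          finally show ?thesis .
        qed
        ultimately show ?thesis by (intro Collect_cong conj_cong) (simp_all add: iff)
      qed
      ultimately show ?thesis using ac[of G q] by (simp add: G_def)
    qed
  qed
  then show "z \<in> KB V (mideal V ?U) q j" by (auto simp: KB_def)
qed

section \<open>Koszul homology of Cohen-Macaulay residue rings\<close>

text \<open>Each term is divisible by some variable; the terms are grouped by a chosen one.\<close>

lemma constant_free_decomposition:
  fixes a :: "'k::field mpoly"
  assumes V: "finite V" and a: "a \<in> Pol V" "lk a 0 = 0"
  shows "\<exists>b. (\<forall>j. b j \<in> Pol V) \<and> a = (\<Sum>j\<in>V. mvar j * b j)"
proof -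
  have "\<forall>u\<in>ks a. \<exists>j. j \<in> ks u"
  proof
    fix u assume "u \<in> ks a"
    then have "u \<noteq> 0" using a(2) by (auto simp: in_keys_iff)
    then have "ks u \<noteq> {}" by simp
    then show "\<exists>j. j \<in> ks u" by blast
  qed
  then obtain i where i: "\<And>u. u \<in> ks a \<Longrightarrow> i u \<in> ks u" by metis
  have iV: "i ` ks a \<subseteq> V" using i a(1) by (auto simp: Pol_iff)
  define b where "b j = (\<Sum>u\<in>{u\<in>ks a. i u = j}. sing (u - sing j 1) (lk a u))" for j
  have "b j \<in> Pol V" for j
    unfolding b_def
  proof (rule Pol_sum)
    fix u assume "u \<in> {u \<in> ks a. i u = j}"
    then show "sing (u - sing j 1) (lk a u) \<in> Pol V"
      using a(1) keys_minus_subset[of u "sing j 1"] by (auto simp: Pol_single Pol_iff)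
  qed
  moreover have "mvar j * b j = (\<Sum>u\<in>{u\<in>ks a. i u = j}. sing u (lk a u))" for j
    unfolding b_def sum_distrib_left
  proof (rule sum.cong[OF refl])
    fix u assume "u \<in> {u \<in> ks a. i u = j}"
    then have "sing j 1 adds u" using i single_adds_iff by blast
    then show "mvar j * sing (u - sing j 1) (lk a u) = sing u (lk a u)"
      by (simp add: mvar_def mult_single adds_minus del: One_nat_def)
  qed
  moreover have "(\<Sum>j\<in>V. \<Sum>u\<in>{u\<in>ks a. i u = j}. sing u (lk a u)) = (\<Sum>u\<in>ks a. sing u (lk a u))"
    by (rule sum.group) (use V iV in auto)
  ultimately show ?thesis using poly_eq_sum_single[of a] by (intro exI[of _ b]) simp
qed

text \<open>
  Multiplication by \<open>a\<close> is null-homotopic on the Koszul complex; a cycle \<open>z\<close> modulo \<open>Q\<close> thus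
  gives \<open>a z = \<partial>w\<close>, and \<open>w\<close> is a cycle modulo \<open>Q' = Q + (a)\<close>.
\<close>

lemma kexact_step:
  fixes Q Q' :: "'k::field mpoly set"
  assumes V: "finite V" and Q: "ideal Q (mpoly_ring V)" and Q': "ideal Q' (mpoly_ring V)" "Q \<subseteq> Q'"
    and a: "a \<in> Q'" "lk a 0 = 0"
    and reg: "\<And>p. p \<in> Pol V \<Longrightarrow> a * p \<in> Q \<Longrightarrow> p \<in> Q"
    and gen: "\<And>p. p \<in> Q' \<Longrightarrow> \<exists>s\<in>Pol V. p - a * s \<in> Q"
    and ex: "kexact V Q' (Suc i)"
  shows "kexact V Q i"
  unfolding kexact_def
proof (intro allI impI)
  fix z :: "nat set \<Rightarrow> 'k mpoly"
  assume supp: "\<forall>\<sigma>. z \<sigma> \<noteq> 0 \<longrightarrow> \<sigma> \<subseteq> V \<and> card \<sigma> = i" and zP: "\<forall>\<sigma>. z \<sigma> \<in> Pol V" and cyc: "\<forall>\<tau>. kdm V z \<tau> \<in> Q"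
  note QD = ideal_mpoly_ringD[OF Q] and QD' = ideal_mpoly_ringD[OF Q'(1)]
  have aP: "a \<in> Pol V" using QD'(1) a(1) by blast
  obtain b where b: "\<And>j. b j \<in> Pol V" "a = (\<Sum>j\<in>V. mvar j * b j)"
    using constant_free_decomposition[OF V aP a(2)] by blast
  have keP: "ke j y \<sigma> \<in> J" if J: "ideal J (mpoly_ring V)" and "\<And>\<sigma>. y \<sigma> \<in> J" for j y \<sigma> and J :: "'k mpoly set"
    using ideal_mpoly_ringD(4)[OF J that(2) Pol_ksgn] ideal_mpoly_ringD(2)[OF J] by (simp add: ke_def)
  \<comment> \<open>The null homotopies for the variables, weighted by \<open>b j\<close>, add up to
    one for multiplication by \<open>a\<close>.\<close>
  define w where "w \<sigma> = (\<Sum>j\<in>V. b j * ke j z \<sigma>)" for \<sigma>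
  have PI: "ideal (Pol V) (mpoly_ring V :: 'k mpoly ring)" unfolding Pol_eq_mideal by (rule ideal_mideal)
  have wP: "w \<sigma> \<in> Pol V" for \<sigma>
    unfolding w_def by (intro Pol_sum Pol_mult b keP[OF PI]) (use zP in blast)
  have ke_supp: "\<sigma> \<subseteq> V \<and> card \<sigma> = Suc i" if "j \<in> V" "ke j z \<sigma> \<noteq> 0" for j \<sigma>
  proof -
    have j: "j \<in> \<sigma>" "z (\<sigma> - {j}) \<noteq> 0" using ke_nonzero[OF that(2)] by auto
    then have s: "\<sigma> - {j} \<subseteq> V" "card (\<sigma> - {j}) = i" using supp by blast+
    then have "\<sigma> \<subseteq> V" using that(1) by blast
    then show ?thesis using card.remove[OF finite_subset[OF _ V] j(1)] s(2) by simp
  qed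
  have w_supp: "\<sigma> \<subseteq> V \<and> card \<sigma> = Suc i" if "w \<sigma> \<noteq> 0" for \<sigma>
  proof -
    obtain j where "j \<in> V" "b j * ke j z \<sigma> \<noteq> 0" using \<open>w \<sigma> \<noteq> 0\<close> unfolding w_def by (meson sum.neutral)
    then show ?thesis using ke_supp by force
  qed
  have "kdm V w \<tau> = a * z \<tau> - (\<Sum>j\<in>V. b j * ke j (kdm V z) \<tau>)" for \<tau>
  proof -
    have "kdm V w \<tau> = (\<Sum>j\<in>V. b j * kdm V (ke j z) \<tau>)" unfolding w_def kd_sum kd_scale ..
    also have "\<dots> = (\<Sum>j\<in>V. mvar j * b j * z \<tau> - b j * ke j (kdm V z) \<tau>)"
    proof (rule sum.cong[OF refl])
      fix j assume j: "j \<in> V"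
      have "kdm V (ke j z) \<tau> + ke j (kdm V z) \<tau> = mvar j * z \<tau>"
        by (rule kd_ke[OF V _ j]) (use supp in blast)
      then have eq: "kdm V (ke j z) \<tau> = mvar j * z \<tau> - ke j (kdm V z) \<tau>" by (simp add: eq_diff_eq)
      show "b j * kdm V (ke j z) \<tau> = mvar j * b j * z \<tau> - b j * ke j (kdm V z) \<tau>"
        unfolding eq by (simp add: right_diff_distrib ac_simps)
    qed
    also have "\<dots> = a * z \<tau> - (\<Sum>j\<in>V. b j * ke j (kdm V z) \<tau>)"
      unfolding b(2) sum_subtractf sum_distrib_right ..
    finally show ?thesis .
  qed
  moreover have "(\<Sum>j\<in>V. b j * ke j (kdm V z) \<tau>) \<in> Q" for \<tau>
    by (rule ideal_mpoly_ring_sum[OF Q], rule QD(4)[OF keP[OF Q] b(1)]) (use cyc in blast)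
  ultimately have aw: "a * z \<tau> - kdm V w \<tau> \<in> Q" for \<tau> by simp
  have wcyc: "kdm V w \<tau> \<in> Q'" for \<tau>
  proof -
    have "z \<tau> * a \<in> Q'" using QD'(4)[OF a(1)] zP by blast
    then have "a * z \<tau> - (a * z \<tau> - kdm V w \<tau>) \<in> Q'"
      using aw Q'(2) by (rule_tac QD'(6)) (auto simp: mult.commute)
    then show ?thesis by simp
  qed
  obtain y where y: "\<And>\<sigma>. y \<sigma> \<noteq> 0 \<Longrightarrow> \<sigma> \<subseteq> V \<and> card \<sigma> = Suc (Suc i)" "\<And>\<sigma>. y \<sigma> \<in> Pol V"
    "\<And>\<sigma>. w \<sigma> - kdm V y \<sigma> \<in> Q'"
    using kexactD[OF ex w_supp wP wcyc] by blast
  \<comment> \<open>The last clause keeps \<open>s\<close> supported on sets of cardinality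
    \<open>Suc i\<close>.\<close>
  have "\<exists>s. s \<in> Pol V \<and> w \<sigma> - kdm V y \<sigma> - a * s \<in> Q \<and> (w \<sigma> - kdm V y \<sigma> = 0 \<longrightarrow> s = 0)" for \<sigma>
  proof (cases "w \<sigma> - kdm V y \<sigma> = 0")
    case True
    then show ?thesis using QD(2) by (intro exI[of _ 0]) simp
  next
    case False
    then show ?thesis using gen[OF y(3)] by blast
  qed
  then obtain s where s: "\<And>\<sigma>. s \<sigma> \<in> Pol V" "\<And>\<sigma>. w \<sigma> - kdm V y \<sigma> - a * s \<sigma> \<in> Q"
    "\<And>\<sigma>. w \<sigma> - kdm V y \<sigma> = 0 \<Longrightarrow> s \<sigma> = 0" by metis
  have s_supp: "\<sigma> \<subseteq> V \<and> card \<sigma> = Suc i" if "s \<sigma> \<noteq> 0" for \<sigma>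
  proof (cases "w \<sigma> = 0")
    case True
    then have "kdm V y \<sigma> \<noteq> 0" using s(3)[of \<sigma>] that by auto
    then obtain j where "j \<in> V - \<sigma>" "y (insert j \<sigma>) \<noteq> 0" using kd_nonzero by blast
    then show ?thesis using card_insert_chain[OF V] y(1) by blast
  qed (rule w_supp)
  have "z \<sigma> - kdm V s \<sigma> \<in> Q" for \<sigma>
  \<comment> \<open>Modulo \<open>Q\<close>, \<open>a z\<close> is the boundary of \<open>w\<close>,
    which is \<open>a\<close> times the boundary of \<open>s\<close>; regularity cancels
    \<open>a\<close>.\<close>
  proof (rule reg)
    show "z \<sigma> - kdm V s \<sigma> \<in> Pol V"
      using zP ideal_kdm[OF PI s(1)] by (intro Pol_diff) auto
    have "kdm V (\<lambda>\<sigma>. w \<sigma> - kdm V y \<sigma> - a * s \<sigma>) \<sigma> \<in> Q" by (rule ideal_kdm[OF Q s(2)])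
    moreover have "kdm V (kdm V y) \<sigma> = 0" by (rule kd_kd[OF V]) (use y(1) in blast)
    ultimately have "kdm V w \<sigma> - a * kdm V s \<sigma> \<in> Q" by (simp add: kd_diff kd_scale)
    from QD(3)[OF aw[of \<sigma>] this] show "a * (z \<sigma> - kdm V s \<sigma>) \<in> Q" by (simp add: algebra_simps)
  qed
  then show "\<exists>y. (\<forall>\<sigma>. y \<sigma> \<noteq> 0 \<longrightarrow> \<sigma> \<subseteq> V \<and> card \<sigma> = Suc i) \<and> (\<forall>\<sigma>. y \<sigma> \<in> Pol V) \<and> (\<forall>\<sigma>. z \<sigma> - kdm V y \<sigma> \<in> Q)"
    using s(1) s_supp by blast
qed

lemma kexact_above_card:
  assumes V: "finite V" and Q: "ideal Q (mpoly_ring V)" and i: "card V < i"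
  shows "kexact V Q i"
  unfolding kexact_def
proof (intro allI impI)
  fix z :: "nat set \<Rightarrow> 'a mpoly" assume z: "\<forall>\<sigma>. z \<sigma> \<noteq> 0 \<longrightarrow> \<sigma> \<subseteq> V \<and> card \<sigma> = i"
  have "z \<sigma> = 0" for \<sigma> using z i card_mono[OF V, of \<sigma>] by force
  then show "\<exists>y. (\<forall>\<sigma>. y \<sigma> \<noteq> 0 \<longrightarrow> \<sigma> \<subseteq> V \<and> card \<sigma> = Suc i) \<and> (\<forall>\<sigma>. y \<sigma> \<in> Pol V) \<and> (\<forall>\<sigma>. z \<sigma> - kdm V y \<sigma> \<in> Q)"
    using ideal_mpoly_ringD(2)[OF Q] by (intro exI[of _ "\<lambda>_. 0"]) simp
qed

section \<open>Residue rings and regular sequences\<close>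

locale residue_ring_of =
  fixes V :: "nat set" and I :: "'k::field mpoly set"
  assumes finite_V: "finite V" and ideal_I: "ideal I (mpoly_ring V)"
begin

abbreviation "S \<equiv> mpoly_ring V :: 'k mpoly ring"
abbreviation "R \<equiv> S Quot I"

definition h :: "'k mpoly \<Rightarrow> 'k mpoly set" where "h p = I +>\<^bsub>S\<^esub> p"

sublocale S: cring S by (rule cring_mpoly_ring)

sublocale R: cring R by (rule ideal.quotient_is_cring[OF ideal_I S.is_cring])

sublocale hom: ring_hom_ring S R h
  unfolding h_def[abs_def] by (rule ideal.rcos_ring_hom_ring[OF ideal_I])

lemma h_mult: "p \<in> Pol V \<Longrightarrow> q \<in> Pol V \<Longrightarrow> h (p * q) = h p \<otimes>\<^bsub>R\<^esub> h q"
  using hom.hom_mult[of p q] by simp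

lemma h_one: "h 1 = \<one>\<^bsub>R\<^esub>"
  using hom.hom_one by simp

lemma h_add: "p \<in> Pol V \<Longrightarrow> q \<in> Pol V \<Longrightarrow> h (p + q) = h p \<oplus>\<^bsub>R\<^esub> h q"
  using hom.hom_add[of p q] by simp

lemma carrier_R: "carrier R = h ` Pol V"
  by (auto simp: FactRing_def A_RCOSETS_def' h_def)

lemma h_closed: "p \<in> Pol V \<Longrightarrow> h p \<in> carrier R"
  by (simp add: carrier_R)

lemma h_eq_iff:
  assumes "p \<in> Pol V" "q \<in> Pol V"
  shows "h p = h q \<longleftrightarrow> p - q \<in> I"
proof -
  note D = ideal_mpoly_ringD[OF ideal_I]
  have coset: "h x = (\<lambda>i. i + x) ` I" for x by (auto simp: h_def a_r_coset_def')
  show ?thesis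
  proof
    assume "h p = h q"
    moreover have "p \<in> h p" unfolding coset by (rule rev_image_eqI[OF D(2)]) simp
    ultimately have "p \<in> (\<lambda>i. i + q) ` I" by (simp only: coset)
    then obtain i where "p = i + q" "i \<in> I" by blast
    then show "p - q \<in> I" by simp
  next
    assume pq: "p - q \<in> I"
    have "i + p \<in> (\<lambda>i. i + q) ` I" if "i \<in> I" for i
      using D(3)[OF that pq] by (rule rev_image_eqI) simp
    moreover have "i + q \<in> (\<lambda>i. i + p) ` I" if "i \<in> I" for i
      using D(6)[OF that pq] by (rule rev_image_eqI) simp
    ultimately show "h p = h q" unfolding coset by (intro equalityI image_subsetI) simp_all
  qed
qed

lemma h_in_image_iff:
  assumes J: "ideal J S" "I \<subseteq> J" and p: "p \<in> Pol V"
  shows "h p \<in> h ` J \<longleftrightarrow> p \<in> J"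
proof
  assume "h p \<in> h ` J"
  then obtain q where q: "q \<in> J" "h p = h q" by auto
  then have "p - q \<in> J" using h_eq_iff[OF p] J ideal_mpoly_ringD(1) by blast
  then have "(p - q) + q \<in> J" using ideal_mpoly_ringD(3)[OF J(1)] q by blast
  then show "p \<in> J" by simp
qed simp

lemma ideal_image: "ideal J S \<Longrightarrow> ideal (h ` J) R"
  unfolding h_def[abs_def] by (rule S.ring_ideal_imp_quot_ideal[OF ideal_I])

lemma prime_image:
  assumes J: "ideal J S" "I \<subseteq> J" and one: "1 \<notin> J"
    and prime: "\<And>p q. p \<in> Pol V \<Longrightarrow> q \<in> Pol V \<Longrightarrow> p * q \<in> J \<Longrightarrow> p \<in> J \<or> q \<in> J"
  shows "primeideal (h ` J) R"
proof (rule primeidealI[OF ideal_image[OF J(1)] R.is_cring])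
  show "carrier R \<noteq> h ` J"
  proof
    assume eq: "carrier R = h ` J"
    have "h 1 \<in> h ` J" using h_closed[OF Pol_one] unfolding eq .
    then show False using h_in_image_iff[OF J Pol_one] one by blast
  qed
  fix x y assume "x \<in> carrier R" "y \<in> carrier R" and xy: "x \<otimes>\<^bsub>R\<^esub> y \<in> h ` J"
  then obtain p q where pq: "x = h p" "y = h q" "p \<in> Pol V" "q \<in> Pol V" by (auto simp: carrier_R)
  then have "h (p * q) \<in> h ` J" using xy by (simp add: h_mult)
  then have "p * q \<in> J" using h_in_image_iff[OF J] pq Pol_mult by blast
  then show "x \<in> h ` J \<or> y \<in> h ` J" using prime pq by blast
qed

text \<open>Beyond degree \<open>card V\<close> there are no chains, so all is exact modulo the full
  sequence; each element dropped from its end lowers the bound by one through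
  \<open>kexact_step\<close>.\<close>

lemma kexact_of_regular_sequence:
  assumes xs: "regular_sequence R xs" and m: "set xs \<subseteq> h ` {p \<in> Pol V. lk p 0 = 0}"
    and i: "card V < i + length xs"
  shows "kexact V I i"
proof -
  define J where "J t = Idl\<^bsub>R\<^esub> (set (take t xs))" for t
  define Q where "Q t = {p \<in> Pol V. h p \<in> J t}" for t
  have xsR: "set xs \<subseteq> carrier R" using xs by (simp add: regular_sequence_def)
  then have tR: "set (take t xs) \<subseteq> carrier R" for t using set_take_subset by fast
  have J: "ideal (J t) R" for t unfolding J_def by (rule R.genideal_ideal[OF tR])
  have Q: "ideal (Q t) S" for t
    using hom.ideal_vimage[OF J] unfolding Q_def .
  have Q0: "Q 0 = I"
  proof -
    have z: "\<zero>\<^bsub>R\<^esub> = h 0" using hom.hom_zero by simp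
    have "J 0 \<subseteq> {\<zero>\<^bsub>R\<^esub>}" unfolding J_def by (rule R.genideal_minimal[OF R.zeroideal]) simp
    moreover have "\<zero>\<^bsub>R\<^esub> \<in> J 0" using additive_subgroup.zero_closed[OF ideal.axioms(1)[OF J]] .
    ultimately have "J 0 = {h 0}" using z by auto
    then have "Q 0 = {p \<in> Pol V. p - 0 \<in> I}" unfolding Q_def using h_eq_iff[of _ 0] by auto
    then show ?thesis using ideal_mpoly_ringD(1)[OF ideal_I] by auto
  qed
  have J_mono: "J t \<subseteq> J (Suc t)" for t
    unfolding J_def
  proof (rule R.genideal_minimal)
    show "ideal (Idl\<^bsub>R\<^esub> (set (take (Suc t) xs))) R" by (rule R.genideal_ideal[OF tR])
    show "set (take t xs) \<subseteq> Idl\<^bsub>R\<^esub> (set (take (Suc t) xs))"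
      using R.genideal_self[OF tR, of "Suc t"] set_take_subset_set_take[of t "Suc t" xs] by auto
  qed
  have IQ: "I \<subseteq> Q t" for t
  proof (induction t)
    case (Suc t)
    then show ?case using J_mono[of t] by (auto simp: Q_def)
  qed (simp add: Q0)
  have step: "kexact V (Q t) i" if t: "t < length xs" and ex: "kexact V (Q (Suc t)) (Suc i)" for t i
  proof -
    have "xs ! t \<in> h ` {p \<in> Pol V. lk p 0 = 0}" using m t nth_mem by blast
    then obtain a where a: "a \<in> Pol V" "lk a 0 = 0" "xs ! t = h a" by auto
    have "xs ! t \<in> set (take (Suc t) xs)" using t by (simp add: take_Suc_conv_app_nth)
    then have aQ: "a \<in> Q (Suc t)"
      using a R.genideal_self[OF tR, of "Suc t"] by (auto simp: Q_def J_def)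
    show ?thesis
    proof (rule kexact_step[OF finite_V Q Q _ aQ a(2) _ _ ex])
      show "Q t \<subseteq> Q (Suc t)" using J_mono by (auto simp: Q_def)
    next
      fix p assume p: "p \<in> Pol V" "a * p \<in> Q t"
      then have "xs ! t \<otimes>\<^bsub>R\<^esub> h p \<in> J t" using a h_mult by (auto simp: Q_def)
      then have "h p \<in> J t" using xs t h_closed[OF p(1)] unfolding regular_sequence_def J_def by blast
      then show "p \<in> Q t" using p by (simp add: Q_def)
    next
      fix p assume p: "p \<in> Q (Suc t)"
      note QD = ideal_mpoly_ringD[OF Q[of t]]
      \<comment> \<open>The elements congruent modulo \<open>Q t\<close> to multiples of
        \<open>a\<close> form an ideal whose image contains all generators of
        \<open>J (Suc t)\<close>.\<close>
      define T where "T = {p \<in> Pol V. \<exists>s\<in>Pol V. p - a * s \<in> Q t}"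
      have T: "ideal T S"
      proof (rule ideal_mpoly_ringI)
        show "T \<subseteq> Pol V" by (auto simp: T_def)
        show "0 \<in> T" unfolding T_def using QD(2) by (intro CollectI conjI bexI[of _ 0]) auto
        fix x assume "x \<in> T"
        then obtain s where s: "x \<in> Pol V" "s \<in> Pol V" "x - a * s \<in> Q t" by (auto simp: T_def)
        show "x + y \<in> T" if "y \<in> T" for y
        proof -
          obtain r where r: "y \<in> Pol V" "r \<in> Pol V" "y - a * r \<in> Q t" using \<open>y \<in> T\<close> by (auto simp: T_def)
          have "(x + y) - a * (s + r) \<in> Q t" using QD(3)[OF s(3) r(3)] by (simp add: algebra_simps)
          then show ?thesis unfolding T_def using s r by (auto intro!: Pol_add bexI[of _ "s + r"])
        qed
        show "c * x \<in> T" if c: "c \<in> Pol V" for c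
        proof -
          have "c * x - a * (c * s) \<in> Q t" using QD(4)[OF s(3) c] by (simp add: algebra_simps)
          then show ?thesis unfolding T_def using s c by (auto intro!: Pol_mult bexI[of _ "c * s"])
        qed
      qed
      have QT: "Q t \<subseteq> T" unfolding T_def Q_def using Pol_zero by (auto intro!: bexI[of _ 0])
      have "J (Suc t) \<subseteq> h ` T"
        unfolding J_def
      proof (rule R.genideal_minimal[OF ideal_image[OF T]])
        have "a - a * 1 \<in> Q t" using QD(2) by simp
        then have "a \<in> T" unfolding T_def using a by (auto intro!: bexI[of _ 1])
        moreover have "set (take t xs) \<subseteq> h ` Q t"
        proof
          fix x assume x: "x \<in> set (take t xs)"
          then have "x \<in> J t" using R.genideal_self[OF tR, of t] by (auto simp: J_def)
          moreover obtain q where "x = h q" "q \<in> Pol V" using x tR[of t] carrier_R by auto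
          ultimately show "x \<in> h ` Q t" by (auto simp: Q_def)
        qed
        ultimately show "set (take (Suc t) xs) \<subseteq> h ` T"
          using QT t a(3) by (auto simp: take_Suc_conv_app_nth)
      qed
      then have "h p \<in> h ` T" using p by (auto simp: Q_def)
      then have "p \<in> T" using h_in_image_iff[OF T] IQ QT p by (auto simp: Q_def)
      then show "\<exists>s\<in>Pol V. p - a * s \<in> Q t" by (simp add: T_def)
    qed
  qed
  have "kexact V (Q (length xs - k)) i" if "k \<le> length xs" "card V < i + k" for k i
    using that
  proof (induction k arbitrary: i)
    case 0
    then show ?case by (intro kexact_above_card[OF finite_V Q]) simp
  next
    case (Suc k)
    have "kexact V (Q (length xs - k)) (Suc i)" using Suc by simp
    moreover have "length xs - k = Suc (length xs - Suc k)" using Suc.prems by simp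
    ultimately show ?case using step[of "length xs - Suc k" i] Suc.prems by simp
  qed
  from this[of "length xs" i] show ?thesis using i Q0 by simp
qed

text \<open>The prime ideal generated by the variables in \<open>V - G\<close>, described by
  supports.\<close>

definition PG :: "nat set \<Rightarrow> 'k mpoly set" where
  "PG G = {p \<in> Pol V. \<forall>u\<in>ks p. \<not> ks u \<subseteq> G}"

lemma ideal_PG: "ideal (PG G) S"
proof (rule ideal_mpoly_ringI)
  fix p q :: "'k mpoly" assume "p \<in> PG G" "q \<in> PG G"
  then show "p + q \<in> PG G"
    unfolding PG_def using Poly_Mapping.keys_add[of p q] by (auto intro: Pol_add)
next
  fix p a :: "'k mpoly" assume pa: "p \<in> PG G" "a \<in> Pol V"
  show "a * p \<in> PG G"
    unfolding PG_def
  proof (intro CollectI conjI ballI)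
    fix u assume "u \<in> ks (a * p)"
    then obtain x y where "y \<in> ks p" "u = x + y" using keys_times_subset by blast
    then show "\<not> ks u \<subseteq> G" using pa(1) by (auto simp: PG_def keys_add_expo)
  qed (use pa in \<open>auto simp: PG_def intro: Pol_mult\<close>)
qed (auto simp: PG_def)

text \<open>\<open>r\<close> sets the variables outside \<open>G\<close> to zero. The product of the
  two images has all its exponents inside \<open>G\<close> and lies in \<open>PG G\<close>, so it is
  0 in a domain.\<close>

lemma prime_PG:
  assumes pq: "p \<in> Pol V" "q \<in> Pol V" "p * q \<in> PG G"
  shows "p \<in> PG G \<or> q \<in> PG G"
proof -
  define r where "r x = (\<Sum>u\<in>{u\<in>ks x. ks u \<subseteq> G}. sing u (lk x u))" for x :: "'k mpoly"
  have lk_r: "lk (r x) u = (if ks u \<subseteq> G then lk x u else 0)" for x u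
    by (auto simp: r_def lookup_sum lookup_single when_def in_keys_iff)
  have rP: "r x \<in> Pol V" if "x \<in> Pol V" for x
    using that by (auto simp: Pol_iff in_keys_iff lk_r split: if_splits)
  have diff: "x - r x \<in> PG G" if "x \<in> Pol V" for x
    using that rP[OF that] by (auto simp: PG_def in_keys_iff lookup_minus lk_r intro: Pol_diff)
  note D = ideal_mpoly_ringD[OF ideal_PG[of G]]
  have "r p * r q = p * q - (q * (p - r p) + r p * (q - r q))" by (simp add: algebra_simps)
  also have "\<dots> \<in> PG G"
    by (intro D(6)[OF pq(3)] D(3) D(4)[OF diff] pq rP)
  finally have *: "r p * r q \<in> PG G" .
  have "r p * r q = 0"
  proof (rule ccontr)
    assume "r p * r q \<noteq> 0"
    then have "ks (r p * r q) \<noteq> {}" by simp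
    then obtain u where u: "u \<in> ks (r p * r q)" by blast
    then obtain x y where "x \<in> ks (r p)" "y \<in> ks (r q)" "u = x + y" using keys_times_subset by blast
    then have "ks u \<subseteq> G" by (auto simp: keys_add_expo in_keys_iff lk_r split: if_splits)
    then show False using * u by (auto simp: PG_def)
  qed
  then have "r p = 0 \<or> r q = 0" by simp
  then show ?thesis using diff pq by fastforce
qed

lemma PG_less:
  assumes "H \<subset> G" "G \<subseteq> V"
  shows "PG G \<subset> PG H"
proof -
  obtain g where g: "g \<in> G" "g \<notin> H" using assms by blast
  have "mvar g \<in> PG H" "mvar g \<notin> PG G" using g assms by (auto simp: PG_def Pol_iff mvar_def)
  moreover have "PG G \<subseteq> PG H" using assms unfolding PG_def by blast
  ultimately show ?thesis by blast
qed

lemma PG_empty: "PG {} = {p \<in> Pol V. lk p 0 = 0}"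
  unfolding PG_def by (auto simp: in_keys_iff)

text \<open>A polynomial outside has nonzero constant term \<open>c\<close>, and its multiple by
  \<open>1 / c\<close> is congruent to 1 modulo \<open>PG {}\<close>.\<close>

lemma maximal_PG_empty:
  assumes I: "I \<subseteq> PG {}"
  shows "maximalideal (h ` PG {}) R"
proof (rule maximalidealI[OF ideal_image[OF ideal_PG]])
  have one: "1 \<notin> PG {}" by (simp add: PG_def)
  show "carrier R \<noteq> h ` PG {}"
  proof
    assume eq: "carrier R = h ` PG {}"
    have "h 1 \<in> h ` PG {}" using h_closed[OF Pol_one] unfolding eq .
    then show False using h_in_image_iff[OF ideal_PG I Pol_one] one by blast
  qed
  fix J assume J: "ideal J R" "h ` PG {} \<subseteq> J" "J \<subseteq> carrier R"
  interpret J: ideal J R by fact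
  show "J = h ` PG {} \<or> J = carrier R"
  proof (rule disjCI)
    assume "J \<noteq> carrier R"
    show "J = h ` PG {}"
    proof (rule ccontr)
      assume "J \<noteq> h ` PG {}"
      then obtain x where x: "x \<in> J" "x \<notin> h ` PG {}" using J by blast
      then obtain p where p: "x = h p" "p \<in> Pol V" using J carrier_R by auto
      define c where "c = lk p 0"
      have c: "c \<noteq> 0" using x p by (auto simp: c_def PG_empty)
      let ?c = "sing 0 (1 / c) :: 'k mpoly"
      have cP: "?c \<in> Pol V" by (simp add: Pol_single)
      have "1 - ?c * p \<in> PG {}"
        using c cP p by (auto simp: PG_empty lookup_minus lookup_one c_def intro: Pol_diff Pol_mult)
      then have 1: "h (1 - ?c * p) \<in> J" using J by blast
      have 2: "h (?c * p) \<in> J" using J.I_l_closed[OF x(1) h_closed[OF cP]] p cP by (simp add: h_mult)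
      have "h ((1 - ?c * p) + ?c * p) \<in> J"
        unfolding h_add[OF Pol_diff[OF Pol_one Pol_mult[OF cP p(2)]] Pol_mult[OF cP p(2)]]
        using additive_subgroup.a_closed[OF J.additive_subgroup_axioms 1 2] .
      then have "\<one>\<^bsub>R\<^esub> \<in> J" by (simp add: h_one)
      then show False using J.one_imp_carrier \<open>J \<noteq> carrier R\<close> by blast
    qed
  qed
qed

text \<open>Removing the elements of \<open>F\<close> one at a time enlarges the prime strictly,
  which yields a chain of \<open>card F + 1\<close> primes from \<open>PG F\<close> up to
  \<open>PG {}\<close>.\<close>

lemma prime_height_PG:
  assumes F: "F \<subseteq> V" and I: "I \<subseteq> PG F"
  shows "enat (card F) \<le> prime_height R (h ` PG {})"
proof -
  define fs where "fs = sorted_list_of_set F"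
  have fF: "finite F" using F finite_V finite_subset by blast
  have fs: "set fs = F" "distinct fs" "length fs = card F" using fF by (auto simp: fs_def)
  define G where "G k = set (drop k fs)" for k
  have GF: "G k \<subseteq> F" for k using fs(1) set_drop_subset by (force simp: G_def)
  have G_less: "G l \<subset> G k" if "k < l" "l \<le> card F" for k l
  proof
    show "G l \<subseteq> G k" unfolding G_def using that by (simp add: set_drop_subset_set_drop)
    have "fs ! k \<in> G k" unfolding G_def using that fs(3) by (metis Cons_nth_drop_Suc list.set_intros(1) order_less_le_trans)
    moreover have "fs ! k \<notin> G l"
    proof
      assume "fs ! k \<in> G l"
      then obtain i where "i < length fs - l" "fs ! (l + i) = fs ! k" by (auto simp: G_def in_set_conv_nth)
      then have "l + i = k" using nth_eq_iff_index_eq[OF fs(2), of "l + i" k] that fs(3) by simp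
      then show False using that by simp
    qed
    ultimately show "G l \<noteq> G k" by blast
  qed
  have PG_mono: "PG F \<subseteq> PG (G k)" for k using GF[of k] unfolding PG_def by blast
  define Ps where "Ps = map (\<lambda>k. h ` PG (G k)) [0..<Suc (card F)]"
  have "prime_chain R Ps"
    unfolding prime_chain_def
  proof
    show "\<forall>P\<in>set Ps. primeideal P R"
    proof
      fix P assume "P \<in> set Ps"
      then obtain k where P: "P = h ` PG (G k)" by (auto simp: Ps_def)
      show "primeideal P R"
        unfolding P
      proof (rule prime_image[OF ideal_PG])
        show "I \<subseteq> PG (G k)" using I PG_mono by blast
        show "1 \<notin> PG (G k)" by (simp add: PG_def)
      qed (rule prime_PG)
    qed
    show "sorted_wrt (\<subset>) Ps"
      unfolding sorted_wrt_iff_nth_less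
    proof (intro allI impI)
      fix k l assume kl: "k < l" "l < length Ps"
      then have l: "l \<le> card F" by (simp add: Ps_def)
      have nth: "Ps ! i = h ` PG (G i)" if "i \<le> card F" for i
        using that unfolding Ps_def by (subst nth_map) (auto simp del: upt_Suc)
      have less: "PG (G k) \<subset> PG (G l)" by (rule PG_less[OF G_less[OF kl(1) l]]) (use GF F in blast)
      then obtain p where p: "p \<in> PG (G l)" "p \<notin> PG (G k)" by blast
      then have "p \<in> Pol V" by (simp add: PG_def)
      then have "h p \<notin> h ` PG (G k)"
        using h_in_image_iff[OF ideal_PG, of "G k" p] I PG_mono[of k] p by blast
      then show "Ps ! k \<subset> Ps ! l" using p less nth[OF l] nth[of k] kl l by auto
    qed
  qed
  moreover have "Ps \<noteq> []" by (simp add: Ps_def)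
  moreover have "last Ps = h ` PG {}" using fs(3) by (simp add: Ps_def G_def)
  ultimately have "enat (length Ps - 1) \<le> prime_height R (h ` PG {})"
    unfolding prime_height_def by (intro SUP_upper) simp
  then show ?thesis by (simp add: Ps_def)
qed

text \<open>At the irrelevant maximal ideal the depth equals the height, which is at least
  \<open>card F\<close>.\<close>

lemma kexact_of_cohen_macaulay:
  assumes cm: "cohen_macaulay_ring R" and F: "F \<subseteq> V" and I: "I \<subseteq> PG F" and i: "card V < i + card F"
  shows "kexact V I i"
proof (cases "card F")
  case 0
  then show ?thesis using i by (intro kexact_above_card[OF finite_V ideal_I]) simp
next
  case (Suc d)
  have "PG F \<subseteq> PG {}" by (auto simp: PG_def)
  then have "maximalideal (h ` PG {}) R" using I by (intro maximal_PG_empty) blast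
  then have "ideal_depth R (h ` PG {}) = prime_height R (h ` PG {})"
    using cm by (simp add: cohen_macaulay_ring_def)
  then have "enat (Suc d) \<le> ideal_depth R (h ` PG {})"
    using prime_height_PG[OF F I] Suc by simp
  \<comment> \<open>The depth is a supremum in \<open>enat\<close>. A strict lower bound yields an
    actual regular sequence, even if the supremum is infinite.\<close>
  then have "enat d < ideal_depth R (h ` PG {})" by (simp add: Suc_ile_eq)
  then obtain xs where "regular_sequence R xs" "set xs \<subseteq> h ` PG {}" "d < length xs"
    unfolding ideal_depth_def less_SUP_iff by auto
  then show ?thesis using i Suc by (intro kexact_of_regular_sequence[of xs]) (auto simp: PG_empty)
qed

end

lemma stanley_reisner_ideal_eq:
  assumes "finite V"
  shows "stanley_reisner_ideal V \<Delta> = (mideal V (chi ` {N. N \<subseteq> V \<and> N \<notin> \<Delta>}) :: 'k::field mpoly set)"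
proof -
  have fin: "finite N" if "N \<subseteq> V" for N using that assms finite_subset by blast
  have "(sqfree_monomial :: nat set \<Rightarrow> 'k mpoly) ` {N. N \<subseteq> V \<and> N \<notin> \<Delta>} =
      (\<lambda>u. sing u 1) ` chi ` {N. N \<subseteq> V \<and> N \<notin> \<Delta>}"
    using fin by (auto simp: image_image sqfree_monomial_eq intro!: image_cong)
  moreover have "Idl\<^bsub>mpoly_ring V\<^esub> ((\<lambda>u. sing u (1::'k)) ` chi ` {N. N \<subseteq> V \<and> N \<notin> \<Delta>}) =
      mideal V (chi ` {N. N \<subseteq> V \<and> N \<notin> \<Delta>})"
    by (rule Idl_monomials) (use fin keys_chi in auto)
  ultimately show ?thesis unfolding stanley_reisner_ideal_def by simp
qed

text \<open>A nonface is never contained in the face \<open>F\<close>, so the prime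
  \<open>PG F\<close> contains the Stanley-Reisner ideal.\<close>

lemma cohen_macaulay_complex_kexact:
  assumes V: "finite V" and \<Delta>: "simplicial_complex V \<Delta>" and F: "F \<in> \<Delta>"
    and cm: "cohen_macaulay_complex TYPE('k::field) V \<Delta>" and i: "card V < i + card F"
  shows "kexact V (mideal V (chi ` {N. N \<subseteq> V \<and> N \<notin> \<Delta>}) :: 'k mpoly set) i"
proof -
  let ?I = "mideal V (chi ` {N. N \<subseteq> V \<and> N \<notin> \<Delta>}) :: 'k mpoly set"
  interpret residue_ring_of V ?I by (rule residue_ring_of.intro[OF V ideal_mideal])
  have FV: "F \<subseteq> V" using \<Delta> F by (simp add: simplicial_complex_def)
  have "?I \<subseteq> PG F"
  proof
    fix p :: "'k mpoly" assume p: "p \<in> ?I"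
    have "\<not> ks u \<subseteq> F" if "u \<in> ks p" for u
    proof
      assume u: "ks u \<subseteq> F"
      obtain N where N: "N \<subseteq> V" "N \<notin> \<Delta>" "chi N adds u"
        using p \<open>u \<in> ks p\<close> by (auto simp: mideal_def)
      have "N \<subseteq> ks u" using N(1,3) V by (simp add: chi_adds_iff finite_subset)
      then show False using N(2) u \<Delta> F unfolding simplicial_complex_def by blast
    qed
    then show "p \<in> PG F" using p by (auto simp: PG_def mideal_def)
  qed
  then show ?thesis
    using kexact_of_cohen_macaulay[OF _ FV _ i] cm
    unfolding cohen_macaulay_complex_def stanley_reisner_ring_def stanley_reisner_ideal_eq[OF V] by blast
qed

section \<open>Weakly vertex decomposable complexes\<close>

lemma face_subset_facet:
  assumes fin: "finite \<Delta>" "\<And>F. F \<in> \<Delta> \<Longrightarrow> finite F" and F: "F \<in> \<Delta>"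
  shows "\<exists>H\<in>facets \<Delta>. F \<subseteq> H"
proof -
  let ?A = "{H \<in> \<Delta>. F \<subseteq> H}"
  obtain H where H: "H \<in> ?A" "\<And>K. K \<in> ?A \<Longrightarrow> card K \<le> card H"
    using ex_has_greatest_nat[of "\<lambda>K. K \<in> ?A" F card "Suc (Max (card ` \<Delta>))"] F fin(1)
    by (auto simp: less_Suc_eq_le)
  have "K = H" if "K \<in> \<Delta>" "H \<subseteq> K" for K
    using card_seteq[OF fin(2)[OF that(1)] that(2)] H that by auto
  then show ?thesis using H(1) by (auto simp: facets_def)
qed

lemma alexander_dual_ideal_eq:
  assumes "finite V"
  shows "alexander_dual_ideal V \<Delta> = (mideal V ((\<lambda>F. chi (V - F)) ` facets \<Delta>) :: 'k::field mpoly set)"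
proof -
  have "(\<lambda>F. sqfree_monomial (V - F) :: 'k mpoly) ` facets \<Delta> = (\<lambda>u. sing u 1) ` (\<lambda>F. chi (V - F)) ` facets \<Delta>"
    using assms by (simp add: image_image sqfree_monomial_eq)
  moreover have "Idl\<^bsub>mpoly_ring V\<^esub> ((\<lambda>u. sing u (1::'k)) ` (\<lambda>F. chi (V - F)) ` facets \<Delta>) =
      mideal V ((\<lambda>F. chi (V - F)) ` facets \<Delta>)"
    by (rule Idl_monomials) (use assms keys_chi in auto)
  ultimately show ?thesis unfolding alexander_dual_ideal_def by simp
qed

lemma complex_dim_eq:
  assumes fin: "finite \<Delta>" and F: "F \<in> \<Delta>" "\<And>H. H \<in> \<Delta> \<Longrightarrow> card H \<le> card F"
  shows "complex_dim \<Delta> = int (card F) - 1"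
  unfolding complex_dim_def
proof (rule Max_eqI)
  fix y assume "y \<in> (\<lambda>F. int (card F) - 1) ` \<Delta>"
  then obtain H where "H \<in> \<Delta>" "y = int (card H) - 1" by blast
  then show "y \<le> int (card F) - 1" using F(2)[of H] by simp
qed (use assms in auto)

lemma acyclic_at_empty: "acyclic_at TYPE('k::field) V {} q"
  unfolding acyclic_at_def by (intro allI impI exI[of _ "\<lambda>_. 0"]) (auto simp: fun_eq_iff)

text \<open>The link of a facet consists of the empty face only. The chain concentrated there is a
  cycle of degree 0 and no boundary, so a facet with fewer than \<open>d\<close> elements is
  impossible.\<close>

lemma pure_of_links_acyclic:
  assumes fin: "finite V" and \<Delta>: "\<And>F. F \<in> \<Delta> \<Longrightarrow> F \<subseteq> V \<and> card F \<le> d"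
    and ac: "\<And>G. G \<subseteq> V \<Longrightarrow> card G < d \<Longrightarrow> acyclic_at TYPE('k::field) V {\<sigma>. \<sigma> \<subseteq> V - G \<and> \<sigma> \<union> G \<in> \<Delta>} 0"
    and H: "H \<in> facets \<Delta>"
  shows "card H = d"
proof (rule ccontr)
  assume "card H \<noteq> d"
  have H': "H \<in> \<Delta>" "\<And>K. K \<in> \<Delta> \<Longrightarrow> H \<subseteq> K \<Longrightarrow> K = H" using H by (auto simp: facets_def)
  let ?D = "{\<sigma>. \<sigma> \<subseteq> V - H \<and> \<sigma> \<union> H \<in> \<Delta>}"
  have D: "?D \<subseteq> {{}}" using H'(2) by blast
  let ?c = "\<lambda>\<sigma> :: nat set. if \<sigma> = {} then 1 else (0 :: 'k)"
  have "acyclic_at TYPE('k) V ?D 0" by (rule ac) (use \<Delta>[OF H'(1)] \<open>card H \<noteq> d\<close> in auto)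
  note ac0 = this
  have c: "\<sigma> \<in> ?D \<and> card \<sigma> = 0" if "?c \<sigma> \<noteq> 0" for \<sigma>
    using H'(1) that by (auto split: if_splits)
  have cyc: "sd V ?c \<tau> = 0" for \<tau> by (rule kd_outside) simp
  have "\<exists>b. (\<forall>\<sigma>. b \<sigma> \<noteq> 0 \<longrightarrow> \<sigma> \<in> ?D \<and> card \<sigma> = Suc 0) \<and> sd V b = ?c"
    by (rule ac0[unfolded acyclic_at_def, THEN spec, THEN mp, THEN mp])
      (intro allI impI, erule c, intro allI, rule cyc)
  then obtain b where b: "\<forall>\<sigma>. b \<sigma> \<noteq> 0 \<longrightarrow> \<sigma> \<in> ?D \<and> card \<sigma> = Suc 0" "sd V b = ?c"
    by (elim exE conjE)
  have "b \<sigma> = 0" for \<sigma>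
  proof (rule ccontr)
    assume "b \<sigma> \<noteq> 0"
    with b(1) have \<sigma>: "\<sigma> \<in> ?D \<and> card \<sigma> = Suc 0" by (elim allE[of _ \<sigma>] impE)
    then have "\<sigma> = {}" using D by blast
    then show False using \<sigma> by simp
  qed
  then have "sd V b {} = 0" by (intro kd_outside) simp
  then show False using b(2) by (simp add: fun_eq_iff)
qed

theorem proposition4p4:
  fixes n :: nat and \<Delta> :: "nat set set"
  assumes "simplicial_complex {1..n} \<Delta>"
    and "weakly_vertex_decomposable TYPE('k::field) {1..n} \<Delta>"
    and "\<exists>v. is_vertex v \<Delta>"
  shows "\<exists>i. is_vertex i \<Delta> \<and>
           admits_splitting {1..n} i (alexander_dual_ideal {1..n} \<Delta> :: 'k mpoly set)"
proof -
  define V where "V = {1..n}"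
  have V: "finite V" by (simp add: V_def)
  have sc: "simplicial_complex V \<Delta>" using assms(1) by (simp add: V_def)
  then have face: "\<And>F. F \<in> \<Delta> \<Longrightarrow> F \<subseteq> V" and down: "\<And>F H. F \<in> \<Delta> \<Longrightarrow> H \<subseteq> F \<Longrightarrow> H \<in> \<Delta>"
    unfolding simplicial_complex_def by blast+
  have fin: "finite \<Delta>" "\<And>F. F \<in> \<Delta> \<Longrightarrow> finite F"
    using face V finite_subset[of \<Delta> "Pow V"] finite_subset by blast+
  have "\<Delta> \<noteq> {{}}" using assms(3) by (auto simp: is_vertex_def)
  then obtain v where v: "v \<in> V" "is_vertex v \<Delta>" and pure: "pure_complex \<Delta>"
    and xor: "(weakly_vertex_decomposable TYPE('k) (V - {v}) (del \<Delta> v) \<and> is_cone \<Delta> v) \<noteq>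
         (weakly_vertex_decomposable TYPE('k) (V - {v}) (link \<Delta> v) \<and>
          cohen_macaulay_complex TYPE('k) (V - {v}) (del \<Delta> v) \<and>
          complex_dim (del \<Delta> v) = complex_dim \<Delta>)"
    using assms(2) unfolding weakly_vertex_decomposable.simps[of "TYPE('k)" "{1..n}" \<Delta>] V_def by blast
  obtain F0 where F0: "F0 \<in> facets \<Delta>" using face_subset_facet[OF fin] v(2) by (auto simp: is_vertex_def)
  define d where "d = card F0"
  define e where "e = card V - d"
  have cardF: "card F = d" if "F \<in> facets \<Delta>" for F
    using pure F0 that unfolding pure_complex_def d_def by blast
  have FV: "F \<subseteq> V" if "F \<in> facets \<Delta>" for F using that face by (simp add: facets_def)
  have ed: "e + d = card V" using card_mono[OF V FV[OF F0]] by (simp add: e_def d_def)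
  have le_d: "card H \<le> d" if H: "H \<in> \<Delta>" for H
  proof -
    obtain F where "F \<in> facets \<Delta>" "H \<subseteq> F" using face_subset_facet[OF fin H] by blast
    then show ?thesis using cardF card_mono[of F H] FV finite_subset[OF _ V] by metis
  qed
  let ?U = "(\<lambda>F. chi (V - F)) ` facets \<Delta>"
  \<comment> \<open>These facets index the generators divisible by the variable of \<open>v\<close>,
    that is, the part \<open>A\<close>.\<close>
  define \<F> where "\<F> = {F \<in> facets \<Delta>. v \<notin> F}"
  have keys: "ks (chi (V - F)) = V - F" for F by (rule keys_chi) (use V in simp)
  have U1: "{u \<in> ?U. v \<in> ks u} = (\<lambda>F. chi (V - F)) ` \<F>"
    using v(1) by (auto simp: \<F>_def keys)
  have ac: "acyclic_at TYPE('k) V {\<sigma>. \<sigma> \<subseteq> V - G \<and> (\<exists>F\<in>\<F>. \<sigma> \<union> G \<subseteq> F)} q"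
    if G: "G \<subseteq> V" "q + card G < d" for G q
  proof (cases "is_cone \<Delta> v")
    case True
    \<comment> \<open>Here \<open>A\<close> is the zero ideal.\<close>
    then have "\<F> = {}" by (auto simp: is_cone_def \<F>_def)
    then show ?thesis using acyclic_at_empty by simp
  next
    case False
    \<comment> \<open>Without a cone condition (i) fails, so the exclusive or leaves condition
      (ii).\<close>
    then have cm: "cohen_macaulay_complex TYPE('k) (V - {v}) (del \<Delta> v)"
      and dim: "complex_dim (del \<Delta> v) = complex_dim \<Delta>" using xor by blast+
    let ?V = "V - {v}" and ?E = "del \<Delta> v"
    have V': "finite ?V" using V by simp
    have E: "?E \<subseteq> \<Delta>" "\<And>F. F \<in> ?E \<Longrightarrow> F \<subseteq> ?V" using face by (auto simp: del_def)
    have downE: "H \<in> ?E" if "F \<in> ?E" "H \<subseteq> F" for F H using that down by (auto simp: del_def)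
    have scE: "simplicial_complex ?V ?E" using E(2) downE by (auto simp: simplicial_complex_def)
    have finE: "finite ?E" using E(1) fin(1) finite_subset by blast
    have "{} \<in> ?E" using F0 down by (auto simp: del_def facets_def)
    \<comment> \<open>Equality of dimensions provides a face of the deletion with \<open>d\<close>
      elements, which sets the height bound.\<close>
    then have "complex_dim ?E \<in> (\<lambda>F. int (card F) - 1) ` ?E"
      unfolding complex_dim_def using finE by (intro Max_in) auto
    moreover have "complex_dim \<Delta> = int d - 1"
      unfolding d_def by (rule complex_dim_eq[OF fin(1)]) (use F0 le_d in \<open>auto simp: facets_def d_def\<close>)
    ultimately obtain F1 where F1: "F1 \<in> ?E" "card F1 = d" using dim by auto
    have dV: "d \<le> card ?V" using card_mono[OF V' E(2)[OF F1(1)]] F1(2) by simp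
    \<comment> \<open>The multidegree \<open>W\<close> part of the Koszul degree
      \<open>card W - p\<close>, which exceeds \<open>card ?V - d\<close>.\<close>
    have restr: "acyclic_at TYPE('k) ?V {\<sigma>. \<sigma> \<subseteq> W \<and> \<sigma> \<in> ?E} p"
      if W: "W \<subseteq> ?V" "p + card ?V < card W + d" for W p
    proof (rule acyclic_at_restriction[OF V' W(1) downE])
      show "card W - p + p = card W" using W(2) dV by simp
      show "kexact ?V (mideal ?V (chi ` {N. N \<subseteq> ?V \<and> N \<notin> ?E}) :: 'k mpoly set) (card W - p)"
        by (rule cohen_macaulay_complex_kexact[OF V' scE F1(1) cm]) (use W(2) F1(2) dV in simp)
    qed
    have link: "acyclic_at TYPE('k) ?V {\<sigma>. \<sigma> \<subseteq> ?V - H \<and> \<sigma> \<union> H \<in> ?E} p"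
      if H: "H \<subseteq> ?V" "p + card H < d" for H p
    proof (rule acyclic_at_link[OF V' downE restr])
      show "finite H" using H(1) V' finite_subset by blast
      then have "card (?V - H) = card ?V - card H" using H(1) by (intro card_Diff_subset)
      then show "p + card ?V < card (?V - H) + d" using H(2) card_mono[OF V' H(1)] by linarith
    qed (use H in auto)
    \<comment> \<open>Purity of the deletion, from the links in degree 0; with it every facet of the
      deletion is a facet of the complex.\<close>
    have facetE: "card H = d" if "H \<in> facets ?E" for H
    proof (rule pure_of_links_acyclic[OF V' _ _ that])
      show "F \<subseteq> ?V \<and> card F \<le> d" if "F \<in> ?E" for F using E that le_d by blast
      show "acyclic_at TYPE('k) ?V {\<sigma>. \<sigma> \<subseteq> ?V - H \<and> \<sigma> \<union> H \<in> ?E} 0" if "H \<subseteq> ?V" "card H < d" for H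
        using link[of H 0] that by simp
    qed
    have iff: "(\<exists>F\<in>\<F>. \<tau> \<subseteq> F) \<longleftrightarrow> \<tau> \<in> ?E" for \<tau>
    proof
      assume "\<exists>F\<in>\<F>. \<tau> \<subseteq> F"
      then show "\<tau> \<in> ?E" using down by (auto simp: \<F>_def facets_def del_def)
    next
      assume \<tau>: "\<tau> \<in> ?E"
      obtain H where H: "H \<in> facets ?E" "\<tau> \<subseteq> H"
        using face_subset_facet[OF finE _ \<tau>] E(1) fin(2) by blast
      have "H \<in> \<Delta>" "v \<notin> H" using H(1) by (auto simp: facets_def del_def)
      \<comment> \<open>\<open>H\<close> already has the largest cardinality possible in the whole
        complex.\<close>
      moreover have "K = H" if "K \<in> \<Delta>" "H \<subseteq> K" for K
        using card_seteq[OF fin(2)[OF that(1)] that(2)] le_d[OF that(1)] facetE[OF H(1)] by simp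
      ultimately have "H \<in> \<F>" by (simp add: \<F>_def facets_def)
      then show "\<exists>F\<in>\<F>. \<tau> \<subseteq> F" using H(2) by blast
    qed
    show ?thesis
    proof (cases "v \<in> G")
      case True
      then have "{\<sigma>. \<sigma> \<subseteq> V - G \<and> (\<exists>F\<in>\<F>. \<sigma> \<union> G \<subseteq> F)} = {}" by (auto simp: \<F>_def)
      then show ?thesis using acyclic_at_empty by metis
    next
      case False
      then have "{\<sigma>. \<sigma> \<subseteq> V - G \<and> (\<exists>F\<in>\<F>. \<sigma> \<union> G \<subseteq> F)} = {\<sigma>. \<sigma> \<subseteq> ?V - G \<and> \<sigma> \<union> G \<in> ?E}"
        unfolding iff using E(2) by blast
      \<comment> \<open>The link statement is over \<open>V - {v}\<close> and has to be carried to
        the ground set \<open>V\<close> of the dual ideal.\<close>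
      moreover have "acyclic_at TYPE('k) V {\<sigma>. \<sigma> \<subseteq> ?V - G \<and> \<sigma> \<union> G \<in> ?E} q"
        by (rule acyclic_at_ambient[OF V _ _ link]) (use G False in auto)
      ultimately show ?thesis by simp
    qed
  qed
  have "admits_splitting V v (mideal V ?U :: 'k mpoly set)"
  proof (rule admits_splitting_of_linear[OF V v(1)])
    show "ks u \<subseteq> V" if "u \<in> ?U" for u using that by (auto simp: keys)
    show "tdeg u = e" if "u \<in> ?U" for u
    proof -
      obtain F where F: "F \<in> facets \<Delta>" "u = chi (V - F)" using \<open>u \<in> ?U\<close> by blast
      then have "card (V - F) = card V - card F"
        using FV[OF F(1)] V finite_subset by (intro card_Diff_subset) auto
      then show ?thesis using F V cardF by (simp add: tdeg_chi e_def)
    qed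
    fix q :: nat and j :: int assume "j \<noteq> int q + int e"
    then show "KZ V (mideal V {u \<in> ?U. v \<in> ks u} :: 'k mpoly set) q j \<subseteq> KB V (mideal V {u \<in> ?U. v \<in> ks u}) q j"
      unfolding U1 by (intro alexander_dual_linear[OF V _ ed ac]) (use FV cardF in \<open>auto simp: \<F>_def\<close>)
  qed
  then show ?thesis
    using v(2) alexander_dual_ideal_eq[OF V, of \<Delta>, where 'k = 'k] unfolding V_def by metis
qed

end
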